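(* The category of free $U(\mathfrak{h})$-modules of rank $1$ over the Ramond algebra $\mathcal{R}$ is equivalent to the category of free $U(\mathfrak{H})$-modules of rank $2$ over the Neveu-Schwarz algebra $\mathcal{NS}$.
   Context: All spaces are over $\mathbb{C}$. For $\epsilon\in\{0,\frac12\}$, let $\mathrm{SVir}[\epsilon]$ be the Lie superalgebra whose even part has basis $\{L_n\mid n\in\mathbb{Z}\}$ and whose odd part has basis $\{G_r\mid r\in\epsilon+\mathbb{Z}\}$, with brackets $[L_m,L_n]=(m-n)L_{m+n}$, $[L_m,G_r]=(\frac m2-r)G_{m+r}$, $[G_r,G_s]=2L_{r+s}$ for $m,n\in\mathbb{Z}$, $r,s\in\epsilon+\mathbb{Z}$. The Ramond algebra is $\mathcal{R}=\mathrm{SVir}[0]$, with canonical Cartan subalgebra $\mathfrak{h}=\mathbb{C}L_0\oplus\mathbb{C}G_0$; the Neveu-Schwarz algebra is $\mathcal{NS}=\mathrm{SVir}[\frac12]$, with canonical Cartan subalgebra $\mathfrak{H}=\mathbb{C}L_0$. $U(\cdot)$ denotes the universal enveloping algebra, so $U(\mathfrak{h})=\mathbb{C}[L_0]\oplus G_0\mathbb{C}[L_0]$ with $G_0^2=L_0$, and $U(\mathfrak{H})=\mathbb{C}[L_0]$. A module over a Lie superalgebra $A$ always means a supermodule $M=M_{\bar 0}\oplus M_{\bar 1}$ with $A_{\bar i}\cdot M_{\bar j}\subseteq M_{\bar i+\bar j}$. The first category is the full subcategory of $\mathcal{R}$-modules whose objects are the $\mathcal{R}$-modules whose restriction to $U(\mathfrak{h})$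 is free of rank $1$; the second is the full subcategory of $\mathcal{NS}$-modules whose objects are the $\mathcal{NS}$-modules whose restriction to $U(\mathfrak{H})$ is free of rank $2$ (with a basis of two homogeneous elements). Morphisms are (parity-preserving) homomorphisms of supermodules. *)

theory Defs
  imports
    Complex_Main
    "HOL-Library.Poly_Mapping"
    "HOL-Library.Z2"
    "HOL-Library.FuncSet"
    "HOL-Computational_Algebra.Polynomial"
    "HOL-Algebra.Module"
begin

text \<open>
  Hom-sets of different pairs of objects need not be disjoint, so composition, and the
  morphism part of a functor, take the source and target objects as arguments:
  \<open>Comp C X Y Z g f\<close> is the composite of \<open>f : X \<rightarrow> Y\<close> and \<open>g : Y \<rightarrow> Z\<close>.
\<close>

record ('o, 'm) category =
  Obj :: "'o set"
  Hom :: "'o \<Rightarrow> 'o \<Rightarrow> 'm set"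
  Ident :: "'o \<Rightarrow> 'm"
  Comp :: "'o \<Rightarrow> 'o \<Rightarrow> 'o \<Rightarrow> 'm \<Rightarrow> 'm \<Rightarrow> 'm"

locale category =
  fixes C :: "('o, 'm) category"
  assumes ident_hom: "X \<in> Obj C \<Longrightarrow> Ident C X \<in> Hom C X X"
    and comp_hom:
      "\<lbrakk>X \<in> Obj C; Y \<in> Obj C; Z \<in> Obj C; f \<in> Hom C X Y; g \<in> Hom C Y Z\<rbrakk>
        \<Longrightarrow> Comp C X Y Z g f \<in> Hom C X Z"
    and comp_ident_right:
      "\<lbrakk>X \<in> Obj C; Y \<in> Obj C; f \<in> Hom C X Y\<rbrakk> \<Longrightarrow> Comp C X X Y f (Ident C X) = f"
    and comp_ident_left:
      "\<lbrakk>X \<in> Obj C; Y \<in> Obj C; f \<in> Hom C X Y\<rbrakk> \<Longrightarrow> Comp C X Y Y (Ident C Y) f = f"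
    and comp_assoc:
      "\<lbrakk>W \<in> Obj C; X \<in> Obj C; Y \<in> Obj C; Z \<in> Obj C;
        f \<in> Hom C W X; g \<in> Hom C X Y; h \<in> Hom C Y Z\<rbrakk>
        \<Longrightarrow> Comp C W Y Z h (Comp C W X Y g f) = Comp C W X Z (Comp C X Y Z h g) f"

definition iso_in :: "('o, 'm) category \<Rightarrow> 'o \<Rightarrow> 'o \<Rightarrow> 'm \<Rightarrow> bool" where
  "iso_in C X Y f \<longleftrightarrow> f \<in> Hom C X Y \<and>
    (\<exists>g \<in> Hom C Y X. Comp C X Y X g f = Ident C X \<and> Comp C Y X Y f g = Ident C Y)"

locale cat_functor = dom: category C + cod: category D
  for C :: "('o, 'm) category" and D :: "('p, 'n) category" +
  fixes Fo :: "'o \<Rightarrow> 'p" and Fm :: "'o \<Rightarrow> 'o \<Rightarrow> 'm \<Rightarrow> 'n"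
  assumes map_obj: "X \<in> Obj C \<Longrightarrow> Fo X \<in> Obj D"
    and map_hom:
      "\<lbrakk>X \<in> Obj C; Y \<in> Obj C; f \<in> Hom C X Y\<rbrakk> \<Longrightarrow> Fm X Y f \<in> Hom D (Fo X) (Fo Y)"
    and map_ident: "X \<in> Obj C \<Longrightarrow> Fm X X (Ident C X) = Ident D (Fo X)"
    and map_comp:
      "\<lbrakk>X \<in> Obj C; Y \<in> Obj C; Z \<in> Obj C; f \<in> Hom C X Y; g \<in> Hom C Y Z\<rbrakk>
        \<Longrightarrow> Fm X Z (Comp C X Y Z g f) = Comp D (Fo X) (Fo Y) (Fo Z) (Fm Y Z g) (Fm X Y f)"

locale natural_iso =
  F: cat_functor C D Fo Fm + G: cat_functor C D Go Gm
  for C :: "('o, 'm) category" and D :: "('p, 'n) category"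
    and Fo Fm Go Gm +
  fixes \<tau> :: "'o \<Rightarrow> 'n"
  assumes component_iso: "X \<in> Obj C \<Longrightarrow> iso_in D (Fo X) (Go X) (\<tau> X)"
    and naturality:
      "\<lbrakk>X \<in> Obj C; Y \<in> Obj C; f \<in> Hom C X Y\<rbrakk>
        \<Longrightarrow> Comp D (Fo X) (Fo Y) (Go Y) (\<tau> Y) (Fm X Y f)
          = Comp D (Fo X) (Go X) (Go Y) (Gm X Y f) (\<tau> X)"

definition equivalent_categories :: "('o, 'm) category \<Rightarrow> ('p, 'n) category \<Rightarrow> bool" where
  "equivalent_categories C D \<longleftrightarrow>
    (\<exists>Fo Fm Go Gm. cat_functor C D Fo Fm \<and> cat_functor D C Go Gm \<and>
      (\<exists>\<eta>. natural_iso C C (\<lambda>X. X) (\<lambda>X Y f. f)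
              (\<lambda>X. Go (Fo X)) (\<lambda>X Y f. Gm (Fo X) (Fo Y) (Fm X Y f)) \<eta>) \<and>
      (\<exists>\<epsilon>. natural_iso D D (\<lambda>X. Fo (Go X)) (\<lambda>X Y f. Fm (Go X) (Go Y) (Gm X Y f))
              (\<lambda>X. X) (\<lambda>X Y f. f) \<epsilon>))"

text \<open>
  All the symbols \<open>L n\<close>, \<open>G r\<close> live in one type, with \<open>r\<close> an arbitrary rational; \<open>SVir[\<epsilon>]\<close>
  is the span of those \<open>L n\<close> and of the \<open>G r\<close> with \<open>r \<in> \<epsilon> + \<int>\<close>. Vectors are finitely
  supported families of complex coefficients. Parities are elements of the two-element
  field \<open>bit\<close>.
\<close>

datatype svir_basis = L int | G rat

type_synonym svir_vec = "svir_basis \<Rightarrow>\<^sub>0 complex"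

definition svir_index :: "rat \<Rightarrow> bit \<Rightarrow> svir_basis set" where
  "svir_index \<epsilon> i = (if i = 0 then range L else {G (\<epsilon> + of_int k) | k. True})"

definition svir_part :: "rat \<Rightarrow> bit \<Rightarrow> svir_vec set" where
  "svir_part \<epsilon> i = {x. Poly_Mapping.keys x \<subseteq> svir_index \<epsilon> i}"

definition svir :: "rat \<Rightarrow> svir_vec set" where
  "svir \<epsilon> = {x. Poly_Mapping.keys x \<subseteq> svir_index \<epsilon> 0 \<union> svir_index \<epsilon> 1}"

definition scale :: "complex \<Rightarrow> svir_vec \<Rightarrow> svir_vec" where
  "scale c = Poly_Mapping.map ((*) c)"

text \<open>
  In the last equation the floor is harmless: \<open>r + s\<close> is an integer for
  \<open>r, s \<in> \<epsilon> + \<int>\<close> and \<open>\<epsilon> \<in> {0, 1/2}\<close>.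
\<close>

fun basis_bracket :: "svir_basis \<Rightarrow> svir_basis \<Rightarrow> svir_vec" where
  "basis_bracket (L m) (L n) = Poly_Mapping.single (L (m + n)) (of_int (m - n))"
| "basis_bracket (L m) (G r) = Poly_Mapping.single (G (of_int m + r)) (of_rat (of_int m / 2 - r))"
| "basis_bracket (G r) (L m) = Poly_Mapping.single (G (of_int m + r)) (- of_rat (of_int m / 2 - r))"
| "basis_bracket (G r) (G s) = Poly_Mapping.single (L \<lfloor>r + s\<rfloor>) 2"

definition svir_bracket :: "svir_vec \<Rightarrow> svir_vec \<Rightarrow> svir_vec" where
  "svir_bracket x y =
    (\<Sum>a\<in>Poly_Mapping.keys x. \<Sum>b\<in>Poly_Mapping.keys y.
      scale (Poly_Mapping.lookup x a * Poly_Mapping.lookup y b) (basis_bracket a b))"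

abbreviation Lvec :: "int \<Rightarrow> svir_vec" where
  "Lvec n \<equiv> Poly_Mapping.single (L n) 1"

abbreviation Gvec :: "rat \<Rightarrow> svir_vec" where
  "Gvec r \<equiv> Poly_Mapping.single (G r) 1"

definition ring_of :: "'a::comm_ring_1 itself \<Rightarrow> 'a ring" where
  "ring_of _ = \<lparr>carrier = UNIV, monoid.mult = (*), one = 1, zero = 0, add = (+)\<rparr>"

abbreviation complex_ring :: "complex ring" where
  "complex_ring \<equiv> ring_of TYPE(complex)"

text \<open>
  The fields \<open>mult\<close> and \<open>one\<close>, which \<^type>\<open>module\<close> inherits from rings, are ignored.
\<close>

record 'v svir_module = "(complex, 'v) module" +
  part :: "bit \<Rightarrow> 'v set"
  act :: "svir_vec \<Rightarrow> 'v \<Rightarrow> 'v"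

locale svir_supermodule = module complex_ring M
  for \<epsilon> :: rat and M :: "'v svir_module" (structure) +
  assumes part_submodule: "submodule (part M i) complex_ring M"
    and part_direct_sum:
      "v \<in> carrier M \<Longrightarrow> \<exists>!p. p \<in> part M 0 \<times> part M 1 \<and> v = fst p \<oplus>\<^bsub>M\<^esub> snd p"
    and act_closed: "\<lbrakk>x \<in> svir \<epsilon>; v \<in> carrier M\<rbrakk> \<Longrightarrow> act M x v \<in> carrier M"
    and act_add_left:
      "\<lbrakk>x \<in> svir \<epsilon>; y \<in> svir \<epsilon>; v \<in> carrier M\<rbrakk>
        \<Longrightarrow> act M (x + y) v = act M x v \<oplus>\<^bsub>M\<^esub> act M y v"
    and act_scale_left:
      "\<lbrakk>x \<in> svir \<epsilon>; v \<in> carrier M\<rbrakk> \<Longrightarrow> act M (scale c x) v = c \<odot>\<^bsub>M\<^esub> act M x v"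
    and act_add_right:
      "\<lbrakk>x \<in> svir \<epsilon>; v \<in> carrier M; w \<in> carrier M\<rbrakk>
        \<Longrightarrow> act M x (v \<oplus>\<^bsub>M\<^esub> w) = act M x v \<oplus>\<^bsub>M\<^esub> act M x w"
    and act_scale_right:
      "\<lbrakk>x \<in> svir \<epsilon>; v \<in> carrier M\<rbrakk> \<Longrightarrow> act M x (c \<odot>\<^bsub>M\<^esub> v) = c \<odot>\<^bsub>M\<^esub> act M x v"
    and act_part:
      "\<lbrakk>x \<in> svir_part \<epsilon> i; v \<in> part M j\<rbrakk> \<Longrightarrow> act M x v \<in> part M (i + j)"
    and act_bracket:
      "\<lbrakk>x \<in> svir_part \<epsilon> i; y \<in> svir_part \<epsilon> j; v \<in> carrier M\<rbrakk>
        \<Longrightarrow> act M (svir_bracket x y) v =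
          (if i = 1 \<and> j = 1 then act M x (act M y v) \<oplus>\<^bsub>M\<^esub> act M y (act M x v)
           else act M x (act M y v) \<ominus>\<^bsub>M\<^esub> act M y (act M x v))"

text \<open>
  Homomorphisms are functions that are \<open>undefined\<close> outside the carrier, so that equality
  of homomorphisms is equality of functions.
\<close>

definition svir_hom :: "rat \<Rightarrow> 'v svir_module \<Rightarrow> 'v svir_module \<Rightarrow> ('v \<Rightarrow> 'v) set" where
  "svir_hom \<epsilon> M N = {f \<in> carrier M \<rightarrow>\<^sub>E carrier N.
    (\<forall>v\<in>carrier M. \<forall>w\<in>carrier M. f (v \<oplus>\<^bsub>M\<^esub> w) = f v \<oplus>\<^bsub>N\<^esub> f w) \<and>
    (\<forall>c. \<forall>v\<in>carrier M. f (c \<odot>\<^bsub>M\<^esub> v) = c \<odot>\<^bsub>N\<^esub> f v) \<and>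
    (\<forall>i. f ` part M i \<subseteq> part N i) \<and>
    (\<forall>x\<in>svir \<epsilon>. \<forall>v\<in>carrier M. f (act M x v) = act N x (f v))}"

definition module_basis :: "('r, 'a) ring_scheme \<Rightarrow> ('r, 'v, 'b) module_scheme \<Rightarrow> 'v set \<Rightarrow> bool"
  where "module_basis R N B \<longleftrightarrow> module R N \<and> finite B \<and> B \<subseteq> carrier N \<and>
    (\<forall>v\<in>carrier N. \<exists>!u. u \<in> B \<rightarrow>\<^sub>E carrier R \<and> v = finsum N (\<lambda>b. u b \<odot>\<^bsub>N\<^esub> b) B)"

text \<open>\<open>U(\<HH>) = \<complex>[L\<^sub>0]\<close>, and \<open>(p, q)\<close> stands for
  \<open>p(L\<^sub>0) + G\<^sub>0 q(L\<^sub>0)\<close> in \<open>U(\<hh>) = \<complex>[L\<^sub>0] \<oplus> G\<^sub>0 \<complex>[L\<^sub>0]\<close>;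
  here \<open>[L\<^sub>0, G\<^sub>0] = 0\<close> and \<open>G\<^sub>0\<^sup>2 = L\<^sub>0\<close>.\<close>

definition U_HH :: "complex poly ring" where
  "U_HH = ring_of TYPE(complex poly)"

definition U_hh :: "(complex poly \<times> complex poly) ring" where
  "U_hh = \<lparr>carrier = UNIV,
    monoid.mult = (\<lambda>(p, q) (p', q'). (p * p' + [:0, 1:] * q * q', p * q' + q * p')),
    one = (1, 0), zero = (0, 0),
    add = (\<lambda>(p, q) (p', q'). (p + p', q + q'))\<rparr>"

definition act_HH :: "'v svir_module \<Rightarrow> complex poly \<Rightarrow> 'v \<Rightarrow> 'v" where
  "act_HH M p v =
    finsum M (\<lambda>i. coeff p i \<odot>\<^bsub>M\<^esub> ((act M (Lvec 0) ^^ i) v)) {..Polynomial.degree p}"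

definition act_hh :: "'v svir_module \<Rightarrow> complex poly \<times> complex poly \<Rightarrow> 'v \<Rightarrow> 'v" where
  "act_hh M = (\<lambda>(p, q) v. act_HH M p v \<oplus>\<^bsub>M\<^esub> act M (Gvec 0) (act_HH M q v))"

definition with_scalars :: "('u \<Rightarrow> 'v \<Rightarrow> 'v) \<Rightarrow> 'v svir_module \<Rightarrow> ('u, 'v) module" where
  "with_scalars s M = \<lparr>carrier = carrier M, monoid.mult = monoid.mult M, one = one M,
    zero = zero M, add = add M, smult = s\<rparr>"

definition restrict_HH :: "'v svir_module \<Rightarrow> (complex poly, 'v) module" where
  "restrict_HH M = with_scalars (act_HH M) M"

definition restrict_hh :: "'v svir_module \<Rightarrow> (complex poly \<times> complex poly, 'v) module" where
  "restrict_hh M = with_scalars (act_hh M) M"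

text \<open>
  The type \<open>'v\<close> serves as the universe: the objects are the modules whose underlying set is
  a set of elements of \<open>'v\<close>. A module of the kind considered here has the cardinality of the
  continuum, so every type that is at least that large has isomorphic copies of all of them.
\<close>

definition svir_full_subcategory ::
    "rat \<Rightarrow> ('v svir_module \<Rightarrow> bool) \<Rightarrow> ('v svir_module, 'v \<Rightarrow> 'v) category" where
  "svir_full_subcategory \<epsilon> P = \<lparr>
    Obj = {M. svir_supermodule \<epsilon> M \<and> P M},
    Hom = svir_hom \<epsilon>,
    Ident = (\<lambda>M. \<lambda>v\<in>carrier M. v),
    Comp = (\<lambda>M _ _ g f. compose (carrier M) g f)\<rparr>"

text \<open>
  The \<open>U(\<hh>)\<close>-basis is not required to be homogeneous, but it always is: the parity involution
  sends a basis vector \<open>v\<close> to \<open>(A + G\<^sub>0 B) v\<close> with \<open>A\<^sup>2 - L\<^sub>0 B\<^sup>2 = 1\<close>, so \<open>B = 0\<close> and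
  \<open>A = \<plusminus>1\<close> for degree reasons.
\<close>

definition ramond_rank1 :: "('v svir_module, 'v \<Rightarrow> 'v) category" where
  "ramond_rank1 = svir_full_subcategory 0
    (\<lambda>M. \<exists>B. module_basis U_hh (restrict_hh M) B \<and> card B = 1)"

definition neveu_schwarz_rank2 :: "('v svir_module, 'v \<Rightarrow> 'v) category" where
  "neveu_schwarz_rank2 = svir_full_subcategory (1/2)
    (\<lambda>M. \<exists>B. module_basis U_HH (restrict_HH M) B \<and> card B = 2 \<and> B \<subseteq> part M 0 \<union> part M 1)"

end

theory Submission
  imports Defs "HOL-Library.Product_Plus"
begin

text \<open>
  Let \<open>M\<close> be a module over either algebra with a homogeneous \<open>\<complex>[L\<^sub>0]\<close>-basis \<open>v, w\<close> of opposite
  parities. Since \<open>L\<^sub>m\<close> and \<open>G\<^sub>r\<close> are semilinear for the shifts \<open>f(x) \<mapsto> f(x + m)\<close> and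
  \<open>f(x) \<mapsto> f(x + r)\<close>, the action is determined by the polynomials through which they act on
  \<open>v\<close> and \<open>w\<close>. Degree considerations in \<open>[G\<^sub>r, G\<^sub>-\<^sub>r] = 2 L\<^sub>0\<close> and \<open>[L\<^sub>m, L\<^sub>-\<^sub>m] = 2 m L\<^sub>0\<close> show that,
  after exchanging and rescaling \<open>v\<close> and \<open>w\<close>, there are \<open>\<mu> \<noteq> 0\<close> and \<open>\<alpha>\<close> with
  \<open>G\<^sub>r v = \<mu>\<^sup>2\<^sup>r w\<close>, \<open>G\<^sub>r w = \<mu>\<^sup>2\<^sup>r (L\<^sub>0 + 2 r \<alpha>) v\<close>, \<open>L\<^sub>m v = \<mu>\<^sup>2\<^sup>m (L\<^sub>0 + m \<alpha>) v\<close> and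
  \<open>L\<^sub>m w = \<mu>\<^sup>2\<^sup>m (L\<^sub>0 + m (\<alpha> + 1/2)) w\<close>. The formulas are the same for \<open>r \<in> \<int>\<close> and for
  \<open>r \<in> 1/2 + \<int>\<close>, so each module carries an action of the other algebra on the same space; the
  root \<open>\<mu>\<close> of \<open>\<mu>\<^sup>2\<close> is fixed once and for all. Up to the factor \<open>\<mu>\<^sup>2\<^sup>r\<close> the action of \<open>G\<^sub>r\<close> is
  polynomial in \<open>r\<close>, and \<open>\<mu>\<close> is unchanged by a nonzero morphism, so a map commutes with one
  action if and only if it commutes with the other. Hence both functors are the identity on maps,
  and their composites are naturally isomorphic to the identity by identity maps.
\<close>

section \<open>Classification of the structure polynomials\<close>

definition shift :: "complex \<Rightarrow> complex poly \<Rightarrow> complex poly" where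
  "shift c p = pcompose p [:c, 1:]"

lemma poly_shift [simp]: "poly (shift c p) z = poly p (z + c)"
  by (simp add: shift_def poly_pcompose add.commute)

lemma shift_add [simp]: "shift c (p + q) = shift c p + shift c q"
  by (simp add: shift_def pcompose_add)

lemma shift_diff [simp]: "shift c (p - q) = shift c p - shift c q"
  by (simp add: shift_def pcompose_diff)

lemma shift_mult [simp]: "shift c (p * q) = shift c p * shift c q"
  by (simp add: shift_def pcompose_mult)

lemma shift_smult [simp]: "shift c (Polynomial.smult a p) = Polynomial.smult a (shift c p)"
  by (simp add: shift_def pcompose_smult)

lemma shift_shift [simp]: "shift c (shift d p) = shift (c + d) p"
  by (rule poly_ext) (simp add: algebra_simps)

lemma shift_0_left [simp]: "shift 0 p = p"
  by (rule poly_ext) simp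

lemma shift_0 [simp]: "shift c 0 = 0"
  by (simp add: shift_def)

lemma shift_1 [simp]: "shift c 1 = 1"
  by (simp add: shift_def pcompose_1)

lemma shift_pCons: "shift c (pCons a p) = [:a:] + [:c, 1:] * shift c p"
  by (simp add: shift_def pcompose_pCons)

lemma shift_const [simp]: "shift c [:a:] = [:a:]"
  by (simp add: shift_def)

lemma shift_linear [simp]: "shift c [:a, d:] = [:a + c * d, d:]"
  by (simp add: shift_def pcompose_pCons)

lemma degree_shift [simp]: "degree (shift c p) = degree p"
  by (simp add: shift_def degree_pcompose)

lemma shift_eq_0_iff [simp]: "shift c p = 0 \<longleftrightarrow> p = 0"
proof
  assume "shift c p = 0"
  then have "shift (- c) (shift c p) = 0" by simp
  then show "p = 0" by simp
qed simp

lemma lead_coeff_shift [simp]: "lead_coeff (shift c p) = lead_coeff p"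
  using lead_coeff_comp[of "[:c, 1:]" p] by (simp add: shift_def degree_pcompose)

lemma poly_eq_0_if_infinite_roots:
  fixes p :: "complex poly"
  assumes "infinite S" "\<And>z. z \<in> S \<Longrightarrow> poly p z = 0"
  shows "p = 0"
proof (rule ccontr)
  assume "p \<noteq> 0"
  then have "finite {z. poly p z = 0}" by (rule poly_roots_finite)
  moreover have "S \<subseteq> {z. poly p z = 0}" using assms(2) by auto
  ultimately show False using assms(1) finite_subset by blast
qed

text \<open>\<open>p\<close> has the nonzero period \<open>c - d\<close>, so \<open>p\<close> minus
  the constant \<open>poly p 0\<close> vanishes at all natural multiples of \<open>c - d\<close>,
  which are infinitely many points.\<close>

lemma shift_periodic_imp_const:
  assumes "shift c p = shift d p" "c \<noteq> d"
  shows "degree p = 0"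
proof -
  have per: "poly p (z + (c - d)) = poly p z" for z
  proof -
    have "poly (shift c p) (z - d) = poly (shift d p) (z - d)" using assms by simp
    then show ?thesis by (simp add: algebra_simps)
  qed
  have root: "poly p (of_nat n * (c - d)) = poly p 0" for n
  proof (induction n)
    case (Suc n)
    have "of_nat (Suc n) * (c - d) = of_nat n * (c - d) + (c - d)" by (simp add: algebra_simps)
    then show ?case using per[of "of_nat n * (c - d)"] Suc by (simp del: of_nat_Suc)
  qed simp
  have "infinite (range (\<lambda>n::nat. of_nat n * (c - d)))"
    by (rule range_inj_infinite) (use assms in \<open>auto intro!: injI\<close>)
  then have "p - [:poly p 0:] = 0"
    by (rule poly_eq_0_if_infinite_roots) (use root in auto)
  then have "p = [:poly p 0:]" by simp
  then show ?thesis by (metis degree_pCons_0)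
qed

lemma degree_0_obtain:
  assumes "degree p = 0" obtains c where "p = [:c:]"
  using assms degree_eq_zeroE by blast

lemma degree_1_obtain:
  fixes p :: "'a::zero poly"
  assumes "degree p = 1" obtains c d where "p = [:c, d:]" "d \<noteq> 0"
proof -
  have "p = [:coeff p 0, coeff p 1:]"
    by (rule poly_eqI) (use assms in \<open>auto simp: coeff_pCons coeff_eq_0 split: nat.split\<close>)
  then show ?thesis using that[of "coeff p 0" "coeff p 1"] assms
    by (metis One_nat_def degree_0 leading_coeff_0_iff zero_neq_one)
qed

text \<open>
  Weights of odd vectors are doubled throughout, so that \<open>G\<^sub>r\<close> has the integer index \<open>j = 2 r\<close>
  and the algebra is \<open>SVir[e/2]\<close> with \<open>e \<in> {0, 1}\<close>.
  In a module with homogeneous \<open>\<complex>[L\<^sub>0]\<close>-basis \<open>v, w\<close>, the polynomials below are given by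
  \<open>L\<^sub>m v = a\<^sub>m v\<close>, \<open>L\<^sub>m w = b\<^sub>m w\<close>, \<open>G\<^sub>r v = g\<^sub>2\<^sub>r w\<close> and \<open>G\<^sub>r w = h\<^sub>2\<^sub>r v\<close>.
\<close>

locale svir_coeffs =
  fixes e :: int and a b g h :: "int \<Rightarrow> complex poly"
  assumes e: "e = 0 \<or> e = 1"
    and GG_v: "\<lbrakk>even (j - e); even (k - e)\<rbrakk> \<Longrightarrow>
      shift (of_int j / 2) (g k) * h j + shift (of_int k / 2) (g j) * h k = 2 * a ((j + k) div 2)"
    and GG_w: "\<lbrakk>even (j - e); even (k - e)\<rbrakk> \<Longrightarrow>
      shift (of_int j / 2) (h k) * g j + shift (of_int k / 2) (h j) * g k = 2 * b ((j + k) div 2)"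
    and LG_v: "even (j - e) \<Longrightarrow>
      shift (of_int m) (g j) * b m - shift (of_int j / 2) (a m) * g j
        = [:of_int (m - j) / 2:] * g (j + 2 * m)"
    and LL_v: "shift (of_int m) (a (- m)) * a m - shift (- of_int m) (a m) * a (- m) = [:0, of_int (2 * m):]"
    and L0: "a 0 = [:0, 1:]" "b 0 = [:0, 1:]"
begin

text \<open>With \<open>j = 2 r\<close>, \<open>K\<close> and \<open>K'\<close> are the coefficients
  of \<open>G\<^sub>r G\<^sub>-\<^sub>r\<close> and \<open>G\<^sub>-\<^sub>r G\<^sub>r\<close> on
  \<open>v\<close>. Their anticommutator is \<open>2 L\<^sub>0\<close> on \<open>v\<close> and on
  \<open>w\<close>; eliminating \<open>K'\<close> shows that the shifts of \<open>K\<close> by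
  \<open>r\<close> and \<open>-r\<close> differ by \<open>j\<close>, exactly as for the polynomial
  x. So \<open>K - x\<close> has period \<open>j\<close> and is constant. For \<open>j = 0\<close>
  the claim is \<open>G\<^sub>0\<^sup>2 = L\<^sub>0\<close>.\<close>

lemma GG_minus:
  assumes "even (j - e)"
  shows "\<exists>c. shift (of_int j / 2) (g (- j)) * h j = [:c, 1:]"
proof (cases "j = 0")
  case True
  then have "2 * (g 0 * h 0) = 2 * [:0, 1:]"
    using GG_v[of 0 0] assms L0 by simp
  then have "g 0 * h 0 = [:0, 1:]" by (metis mult_cancel_left zero_neq_numeral)
  with True show ?thesis by simp
next
  case False
  define K where "K = shift (of_int j / 2) (g (- j)) * h j"
  define K' where "K' = shift (- of_int j / 2) (g j) * h (- j)"
  define P where "P = K - [:0, 1:]"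
  have j': "even (- j - e)" using assms by presburger
  have "K + K' = [:0, 2:]"
    using GG_v[OF assms j'] L0 by (simp add: K_def K'_def numeral_poly)
  then have "shift (of_int j / 2) (K + K') = [:of_int j, 2:]" by simp
  moreover have "shift (of_int j / 2) K' + shift (- of_int j / 2) K = [:0, 2:]"
    using GG_w[OF assms j'] L0 by (simp add: K_def K'_def numeral_poly mult.commute)
  moreover have "shift (of_int j / 2) K - shift (- of_int j / 2) K
      = shift (of_int j / 2) (K + K') - (shift (of_int j / 2) K' + shift (- of_int j / 2) K)"
    unfolding shift_add by simp
  ultimately have "shift (of_int j / 2) K - shift (- of_int j / 2) K = [:of_int j, 2:] - [:0, 2:]"
    by (simp only:)
  then have "shift (of_int j / 2) P - shift (- of_int j / 2) P = 0"
    by (simp add: P_def algebra_simps)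
  then have "shift (of_int j / 2) P = shift (- of_int j / 2) P" by simp
  then have "degree P = 0" by (rule shift_periodic_imp_const) (use False in auto)
  then obtain c where "P = [:c:]" by (rule degree_0_obtain)
  then have "shift (of_int j / 2) (g (- j)) * h j = [:c:] + [:0, 1:]"
    unfolding P_def K_def by (metis diff_add_cancel)
  then show ?thesis by auto
qed

lemma degree_g_h:
  assumes "even (j - e)"
  shows "degree (g (- j)) + degree (h j) = 1"
proof -
  obtain c where c: "shift (of_int j / 2) (g (- j)) * h j = [:c, 1:]"
    using GG_minus[OF assms] by blast
  then have "degree (shift (of_int j / 2) (g (- j)) * h j) = 1" by simp
  moreover have "shift (of_int j / 2) (g (- j)) \<noteq> 0" "h j \<noteq> 0" using c by auto
  ultimately show ?thesis
    using degree_mult_eq[of "shift (of_int j / 2) (g (- j))" "h j"] by auto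
qed

text \<open>\<open>A\<close> is the coefficient of \<open>L\<^sub>m L\<^sub>-\<^sub>m\<close> on
  \<open>v\<close>, and its shift by \<open>-m\<close> that of
  \<open>L\<^sub>-\<^sub>m L\<^sub>m\<close>. The commutator is a difference equation for
  \<open>A\<close>, with the particular solution \<open>B = x (x + m)\<close>; solutions differ by
  constants, so \<open>A\<close> has degree 2.\<close>

lemma degree_a:
  assumes "m \<noteq> 0"
  shows "degree (a m) + degree (a (- m)) = 2"
proof -
  define A where "A = shift (of_int m) (a (- m)) * a m"
  define B :: "complex poly" where "B = [:0, of_int m, 1:]"
  have "shift (- of_int m) A = shift (- of_int m) (a m) * a (- m)"
    by (simp add: A_def mult.commute)
  then have "A - shift (- of_int m) A = [:0, of_int (2 * m):]"
    using LL_v[of m] by (simp only: A_def)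
  moreover have "B - shift (- of_int m) B = [:0, of_int (2 * m):]"
    by (simp add: B_def shift_pCons algebra_simps)
  moreover have "(A - B) - shift (- of_int m) (A - B)
      = (A - shift (- of_int m) A) - (B - shift (- of_int m) B)"
    by simp
  ultimately have "shift 0 (A - B) = shift (- of_int m) (A - B)"
    by (simp only: diff_self right_minus_eq shift_0_left)
  then have "degree (A - B) = 0"
    by (rule shift_periodic_imp_const) (use assms in auto)
  then obtain c where "A - B = [:c:]" by (rule degree_0_obtain)
  then have "A = B + [:c:]" by (metis diff_add_cancel add.commute)
  then have A: "A = [:c, of_int m, 1:]" by (simp add: B_def)
  then have "shift (of_int m) (a (- m)) \<noteq> 0" "a m \<noteq> 0" by (auto simp: A_def)
  then show ?thesis
    using A degree_mult_eq[of "shift (of_int m) (a (- m))" "a m"] by (auto simp: A_def)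
qed

text \<open>
  If \<open>g\<^sub>j\<close> and \<open>h\<^sub>j\<close> were both constant, then so would be \<open>L\<^sub>j\<close> on \<open>v\<close> and \<open>w\<close>, and
  \<open>[L\<^sub>j, G]\<close> with \<open>G\<close> of doubled weight \<open>-3j\<close> would force \<open>g\<^sub>-\<^sub>j\<close> to be constant too.
\<close>

lemma not_both_const:
  assumes j: "even (j - e)" "j \<noteq> 0" and "degree (g j) = 0" "degree (h j) = 0"
  shows False
proof -
  obtain c where c: "g j = [:c:]" by (rule degree_0_obtain[OF assms(3)])
  obtain d where d: "h j = [:d:]" by (rule degree_0_obtain[OF assms(4)])
  have "2 * a j = 2 * [:c * d:]" using GG_v[OF j(1) j(1)] c d
    by (simp add: numeral_poly algebra_simps)
  then have a: "a j = [:c * d:]" by (metis mult_cancel_left zero_neq_numeral)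
  have "2 * b j = 2 * [:c * d:]" using GG_w[OF j(1) j(1)] c d
    by (simp add: numeral_poly algebra_simps)
  then have b: "b j = [:c * d:]" by (metis mult_cancel_left zero_neq_numeral)
  have deg1: "degree (g (- j)) = 1" using degree_g_h[OF j(1)] assms(4) by simp
  have j3: "even (- 3 * j - e)" "even (3 * j - e)" using j(1) by presburger+
  have "degree (g (- 3 * j)) \<le> 1" using degree_g_h[of "3 * j"] j3 by simp
  then obtain p q where g3: "g (- 3 * j) = [:p, q:]"
  proof (cases "degree (g (- 3 * j)) = 0")
    case True
    then show ?thesis by (metis that degree_0_obtain pCons_0_0)
  next
    case False
    then show ?thesis using \<open>degree (g (- 3 * j)) \<le> 1\<close> that
      by (metis degree_1_obtain le_neq_implies_less less_one)
  qed
  \<comment> \<open>Since \<open>a j\<close> and \<open>b j\<close> are the same constant, the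
    leading terms cancel and the commutator leaves only a constant, although the weight
    \<open>-3j + 2j\<close> reached is that of \<open>g (- j)\<close>, which has degree 1.\<close>
  have "[:of_int (j - (- 3 * j)) / 2:] * g (- 3 * j + 2 * j) = [:of_int j * q * (c * d):]"
    using LG_v[OF j3(1), of j, symmetric] unfolding a b g3 by (simp add: algebra_simps)
  then have "[:2 * of_int j:] * g (- j) = [:of_int j * q * (c * d):]" by simp
  moreover have "degree ([:2 * of_int j:] * g (- j)) = 1"
    using deg1 j(2) degree_mult_eq[of "[:2 * of_int j:]" "g (- j)"] by auto
  ultimately show False by simp
qed

text \<open>The degrees of \<open>g (- j)\<close>, \<open>h j\<close> and of \<open>g j\<close>,
  \<open>h (- j)\<close> both sum to 1. For \<open>j \<noteq> 0\<close> the pairs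
  \<open>g j\<close>, \<open>h j\<close> and \<open>g (- j)\<close>, \<open>h (- j)\<close> each
  have degree sum at least 1; the total being 2, equality holds in both.\<close>

lemma degree_g_minus:
  assumes j: "even (j - e)"
  shows "degree (g (- j)) = degree (g j)" "degree (g j) + degree (h j) = 1"
proof -
  have j': "even (- j - e)" using j by presburger
  note d = degree_g_h[OF j] degree_g_h[OF j', simplified]
  have "j = 0 \<or> (\<not> (degree (g j) = 0 \<and> degree (h j) = 0) \<and> \<not> (degree (g (- j)) = 0 \<and> degree (h (- j)) = 0))"
    using not_both_const[OF j] not_both_const[OF j'] by auto
  then show "degree (g (- j)) = degree (g j)" "degree (g j) + degree (h j) = 1"
    using d by auto
qed

text \<open>If \<open>g j\<close> is constant and \<open>g k\<close> is linear, the anticommutator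
  on \<open>v\<close> has one term of degree 2 and one constant term, so \<open>a\<close> has degree
  2 at \<open>(j + k) div 2\<close>. The same holds for \<open>- j\<close> and \<open>- k\<close>,
  and the two degrees sum to 4 instead of 2.\<close>

lemma degree_g_const:
  assumes j: "even (j - e)" and k: "even (k - e)" and "degree (g j) = 0"
  shows "degree (g k) = 0"
proof (rule ccontr)
  assume k1: "degree (g k) \<noteq> 0"
  have jk: "even (j + k)" using j k by presburger
  have *: "degree (a ((j + k) div 2)) = 2"
    if j: "even (j - e)" and k: "even (k - e)" and j0: "degree (g j) = 0" and k1: "degree (g k) \<noteq> 0" for j k
  proof -
    have d: "degree (h j) = 1" "degree (g k) = 1" "degree (h k) = 0"
      using degree_g_minus(2)[OF j] degree_g_minus(2)[OF k] j0 k1 by auto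
    have nz: "h j \<noteq> 0" "g k \<noteq> 0" using d by auto
    have "degree (shift (of_int j / 2) (g k) * h j) = 2"
      using d nz by (subst degree_mult_eq) auto
    moreover have "degree (shift (of_int k / 2) (g j) * h k) \<le> 0"
      using d j0 degree_mult_le[of "shift (of_int k / 2) (g j)" "h k"] by simp
    ultimately have "degree (2 * a ((j + k) div 2)) = 2"
      unfolding GG_v[OF j k, symmetric] by (subst degree_add_eq_left) auto
    then show ?thesis by (cases "a ((j + k) div 2) = 0") (simp_all add: degree_mult_eq)
  qed
  have "j \<noteq> - k" "j \<noteq> k" using assms(3) k1 degree_g_minus(1)[OF k] by auto
  then have "(j + k) div 2 \<noteq> 0" using jk by presburger
  moreover have "(- j + - k) div 2 = - ((j + k) div 2)" using jk by presburger
  moreover have "even (- j - e)" "even (- k - e)" using j k by presburger+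
  ultimately show False
    using *[OF j k assms(3) k1] *[of "- j" "- k"] degree_a[of "(j + k) div 2"] assms(3) k1
      degree_g_minus(1)[OF j] degree_g_minus(1)[OF k] by simp
qed

end


section \<open>Normal form when all \<open>G\<^sub>r v\<close> are constant multiples of
  \<open>w\<close>\<close>

lemma int_parity_induct [consumes 1, case_names base step]:
  fixes j e :: int
  assumes "even (j - e)" "P e"
    and "\<And>i. even (i - e) \<Longrightarrow> P i \<longleftrightarrow> P (i + 2)"
  shows "P j"
proof -
  have "P (e + 2 * k)" for k
  proof (induction k rule: int_induct[where k = 0])
    case base
    then show ?case using assms(2) by simp
  next
    case (step1 i)
    then show ?case using assms(3)[of "e + 2 * i"] by (simp add: algebra_simps)
  next
    case (step2 i)
    then show ?case using assms(3)[of "e + 2 * (i - 1)"] by (simp add: algebra_simps)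
  qed
  moreover obtain k where "j = e + 2 * k" using assms(1) by (metis add_diff_cancel_left' diff_add_cancel dvdE add.commute)
  ultimately show ?thesis by simp
qed

text \<open>No generality is lost: if one \<open>g j\<close> is constant then all are, and if none
  is, then all \<open>h j\<close> are constant and exchanging \<open>v\<close> and \<open>w\<close>
  leads here.\<close>

locale svir_coeffs_normalized = svir_coeffs +
  assumes g_const: "even (j - e) \<Longrightarrow> degree (g j) = 0"
begin

definition "\<gamma> j = coeff (g j) 0"
definition "\<kappa> j = coeff (h j) 1"
definition "\<eta> j = coeff (h j) 0"

lemma g_eq: "even (j - e) \<Longrightarrow> g j = [:\<gamma> j:]"
  using g_const[of j] unfolding \<gamma>_def by (metis coeff_pCons_0 degree_0_obtain)

lemma h_eq: "even (j - e) \<Longrightarrow> h j = [:\<eta> j, \<kappa> j:]"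
proof -
  assume j: "even (j - e)"
  then have "degree (h j) = 1" using degree_g_minus(2)[OF j] g_const[OF j] by simp
  then obtain c d where "h j = [:c, d:]" by (rule degree_1_obtain)
  then show ?thesis by (simp add: \<eta>_def \<kappa>_def)
qed

text \<open>Compares leading coefficients in \<open>GG_minus\<close>.\<close>

lemma \<kappa>_\<gamma>: "even (j - e) \<Longrightarrow> \<kappa> j * \<gamma> (- j) = 1"
proof -
  assume j: "even (j - e)"
  then have j': "even (- j - e)" by presburger
  obtain c where "shift (of_int j / 2) (g (- j)) * h j = [:c, 1:]"
    using GG_minus[OF j] by blast
  then show ?thesis by (simp add: g_eq[OF j'] h_eq[OF j] mult.commute)
qed

lemma \<gamma>_nonzero: "even (j - e) \<Longrightarrow> \<gamma> j \<noteq> 0"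
  using \<kappa>_\<gamma>[of "- j"] by (auto simp: algebra_simps)

text \<open>Expresses \<open>a m\<close> and \<open>b m\<close> for \<open>m = (r + s) / 2\<close>
  through the anticommutator of the operators of doubled weights \<open>r\<close> and
  \<open>s\<close>, and inserts them into the commutator with the one of doubled weight
  \<open>t\<close>. At the point 0 the unknown constants \<open>\<eta> r\<close> and
  \<open>\<eta> s\<close> cancel.\<close>

lemma \<gamma>_\<kappa>_relation:
  assumes r: "even (r - e)" and s: "even (s - e)" and t: "even (t - e)"
  shows "\<gamma> t * (of_int (r - t) * \<gamma> r * \<kappa> s + of_int (s - t) * \<gamma> s * \<kappa> r)
    = of_int (r + s - 2 * t) * \<gamma> (r + s + t)"
proof -
  define m where "m = (r + s) div 2"
  have m: "2 * m = r + s" using r s unfolding m_def by presburger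
  have mc: "(of_int m :: complex) = (of_int r + of_int s) / 2"
    using arg_cong[OF m, of "of_int :: int \<Rightarrow> complex"] by (simp add: eq_divide_eq mult.commute)
  have t': "even (t + 2 * m - e)" using t by presburger
  have A: "2 * poly (a m) z = \<gamma> s * (\<eta> r + \<kappa> r * z) + \<gamma> r * (\<eta> s + \<kappa> s * z)" for z
    using arg_cong[OF GG_v[OF r s], of "\<lambda>p. poly p z"]
    unfolding g_eq[OF r] g_eq[OF s] h_eq[OF r] h_eq[OF s] m_def[symmetric] by (simp add: algebra_simps)
  have B: "2 * poly (b m) 0 = \<gamma> r * (\<eta> s + \<kappa> s * (of_int r / 2)) + \<gamma> s * (\<eta> r + \<kappa> r * (of_int s / 2))"
    using arg_cong[OF GG_w[OF r s], of "\<lambda>p. poly p 0"]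
    unfolding g_eq[OF r] g_eq[OF s] h_eq[OF r] h_eq[OF s] m_def[symmetric] by (simp add: algebra_simps)
  have eq: "\<gamma> t * poly (b m) 0 - poly (a m) (of_int t / 2) * \<gamma> t = of_int (m - t) / 2 * \<gamma> (t + 2 * m)"
    (is "?l = ?r")
    using arg_cong[OF LG_v[OF t, of m], of "\<lambda>p. poly p 0"]
    unfolding g_eq[OF t] g_eq[OF t'] by (simp add: mult.commute)
  have "\<gamma> t * (2 * poly (b m) 0 - 2 * poly (a m) (of_int t / 2)) = 2 * ?l"
    by (simp add: algebra_simps)
  also have "\<dots> = 2 * ?r" by (simp only: eq)
  also have "\<dots> = of_int (m - t) * \<gamma> (t + 2 * m)" by simp
  finally have "\<gamma> t * (2 * poly (b m) 0 - 2 * poly (a m) (of_int t / 2)) = of_int (m - t) * \<gamma> (t + 2 * m)" .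
  then have "\<gamma> t * (2 * poly (b m) 0 - 2 * poly (a m) (of_int t / 2)) = of_int (m - t) * \<gamma> (r + s + t)"
    by (simp only: m add.commute)
  then show ?thesis unfolding A B by (simp add: mc algebra_simps)
qed

text \<open>\<open>c\<close> is the factor by which \<open>w\<close> has to be rescaled.\<close>

lemma normal_form:
  obtains c \<mu> \<alpha> where "c \<noteq> 0" "\<mu> \<noteq> 0" "csqrt (\<mu>\<^sup>2) = \<mu>"
    "\<And>j. even (j - e) \<Longrightarrow> g j = [:c * \<mu> powi j:]"
    "\<And>j. even (j - e) \<Longrightarrow> h j = [:of_int j * \<alpha> * \<mu> powi j / c, \<mu> powi j / c:]"
    "\<And>m. a m = [:\<mu> powi (2 * m):] * [:of_int m * \<alpha>, 1:]"
    "\<And>m. b m = [:\<mu> powi (2 * m):] * [:of_int m * (\<alpha> + 1 / 2), 1:]"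
proof -
  \<comment> \<open>The common value of \<open>\<gamma> s * \<gamma> (- s)\<close>. The index
    \<open>e + 2\<close> is nonzero even for \<open>e = 0\<close>, so the factor
    \<open>2 (e + 2)\<close> can be cancelled below.\<close>
  define \<rho> where "\<rho> = \<gamma> (e + 2) * \<gamma> (- (e + 2))"
  have \<rho>: "\<gamma> s = \<rho> * \<kappa> s" if s: "even (s - e)" for s
  proof -
    let ?j = "e + 2"
    have "\<gamma> (- ?j) * (of_int (?j - (- ?j)) * \<gamma> ?j * \<kappa> s + of_int (s - (- ?j)) * \<gamma> s * \<kappa> ?j)
      = of_int (?j + s - 2 * (- ?j)) * \<gamma> (?j + s + (- ?j))"
      by (rule \<gamma>_\<kappa>_relation) (use s e in auto)
    then have "2 * of_int ?j * (\<gamma> (- ?j) * \<gamma> ?j) * \<kappa> s + of_int (s + ?j) * \<gamma> s * (\<kappa> ?j * \<gamma> (- ?j))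
      = of_int (s + 3 * ?j) * \<gamma> s"
      by (simp add: algebra_simps)
    moreover have "\<kappa> ?j * \<gamma> (- ?j) = 1" by (rule \<kappa>_\<gamma>) simp
    ultimately have "2 * of_int ?j * (\<rho> * \<kappa> s) = 2 * of_int ?j * \<gamma> s"
      by (simp add: \<rho>_def algebra_simps)
    moreover have "2 * (of_int ?j :: complex) \<noteq> 0" using e by auto
    ultimately show ?thesis by (metis mult_cancel_left)
  qed
  have \<rho>0: "\<rho> \<noteq> 0" unfolding \<rho>_def using e by (auto intro!: \<gamma>_nonzero)
  have \<rho>': "\<gamma> s * \<gamma> (- s) = \<rho>" if s: "even (s - e)" for s
    using \<rho>[OF s] \<kappa>_\<gamma>[OF s] by (simp add: mult.assoc)
  have e1: "even (e - e)" "even (e + 2 - e)" "even (- e - e)" by auto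
  define l where "l = \<gamma> (e + 2) / \<gamma> e"
  have l0: "l \<noteq> 0" unfolding l_def using \<gamma>_nonzero e1 by auto
  have rec: "\<gamma> (t + 2) = l * \<gamma> t" if t: "even (t - e)" for t
  \<comment> \<open>The general case cancels the factor \<open>2 - 2 t\<close>. At
    \<open>t = 1\<close> parity forces \<open>e = 1\<close>, and the recursion is the definition of
    \<open>l\<close>.\<close>
  proof (cases "t = 1")
    case True
    with e t have "e = 1" by auto
    with True show ?thesis using \<gamma>_nonzero[OF e1(1)] by (simp add: l_def)
  next
    case False
    have "\<gamma> t * (of_int (e + 2 - t) * \<gamma> (e + 2) * \<kappa> (- e) + of_int (- e - t) * \<gamma> (- e) * \<kappa> (e + 2))
      = of_int (e + 2 + (- e) - 2 * t) * \<gamma> (e + 2 + (- e) + t)"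
      by (rule \<gamma>_\<kappa>_relation) (use t e1 in auto)
    then have "\<rho> * (\<gamma> t * (of_int (e + 2 - t) * \<gamma> (e + 2) * \<kappa> (- e) + of_int (- e - t) * \<gamma> (- e) * \<kappa> (e + 2)))
      = \<rho> * (of_int (2 - 2 * t) * \<gamma> (t + 2))"
      by (simp add: add.commute)
    then have "of_int (2 - 2 * t) * (\<gamma> t * \<gamma> (e + 2) * \<gamma> (- e)) = of_int (2 - 2 * t) * (\<rho> * \<gamma> (t + 2))"
      using \<rho>[OF e1(2)] \<rho>[OF e1(3)] by (simp add: algebra_simps)
    moreover have "(of_int (2 - 2 * t) :: complex) \<noteq> 0" using False by (simp only: of_int_eq_0_iff)
    ultimately have "\<gamma> t * \<gamma> (e + 2) * \<gamma> (- e) = \<rho> * \<gamma> (t + 2)" by (metis mult_cancel_left)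
    then have "\<gamma> (- e) * (\<gamma> t * \<gamma> (e + 2)) = \<gamma> (- e) * (\<gamma> e * \<gamma> (t + 2))"
      using \<rho>'[OF e1(1)] by (simp add: algebra_simps)
    then have "\<gamma> t * \<gamma> (e + 2) = \<gamma> e * \<gamma> (t + 2)" using \<gamma>_nonzero[OF e1(3)] by simp
    then show ?thesis using \<gamma>_nonzero[OF e1(1)] by (simp add: l_def field_simps)
  qed
  \<comment> \<open>Choosing the principal root removes the ambiguity of sign. In the model,
    replacing \<open>\<mu>\<close> by \<open>-\<mu>\<close> leaves all \<open>L\<^sub>m\<close> and
    all \<open>G\<^sub>r\<close> with integer \<open>r\<close> unchanged but negates
    \<open>G\<^sub>r\<close> for \<open>r\<close> in \<open>1/2 + \<int>\<close>.\<close>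
  define \<mu> where "\<mu> = csqrt l"
  have \<mu>2: "\<mu>\<^sup>2 = l" by (simp add: \<mu>_def)
  have \<mu>0: "\<mu> \<noteq> 0" using l0 \<mu>2 by auto
  have \<mu>_add: "\<mu> powi (j + 2) = \<mu> powi j * l" for j
    using \<mu>0 \<mu>2 by (simp add: power_int_add)
  define c where "c = \<gamma> e / \<mu> powi e"
  have c0: "c \<noteq> 0" unfolding c_def using \<gamma>_nonzero[OF e1(1)] \<mu>0 by simp
  have \<gamma>: "\<gamma> j = c * \<mu> powi j" if "even (j - e)" for j
    using that
  proof (induction j rule: int_parity_induct)
    case base
    then show ?case using \<mu>0 by (simp add: c_def)
  next
    case (step i)
    then show ?case using rec[OF step] l0 by (auto simp: \<mu>_add)
  qed
  have "\<rho> = c\<^sup>2"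
    using \<rho>'[OF e1(1)] \<gamma>[OF e1(1)] \<gamma>[OF e1(3)] \<mu>0 by (simp add: power_int_minus power2_eq_square field_simps)
  then have \<kappa>: "\<kappa> j = \<mu> powi j / c" if "even (j - e)" for j
    using \<rho>[OF that] \<gamma>[OF that] c0 by (simp add: field_simps power2_eq_square)
  \<comment> \<open>The constant term of \<open>h j\<close> once its leading coefficient is scaled
    to 1; the formulas for \<open>a m\<close> and \<open>b m\<close> involve only the sums
    \<open>\<theta> r + \<theta> s\<close>.\<close>
  define \<theta> where "\<theta> j = c * \<eta> j / \<mu> powi j" for j
  have \<eta>: "\<eta> j = \<theta> j * \<mu> powi j / c" for j using c0 \<mu>0 by (simp add: \<theta>_def)
  have \<mu>_half: "\<mu> powi (2 * m) = \<mu> powi r * \<mu> powi s" if "r + s = 2 * m" for r s m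
    using \<mu>0 by (simp add: that[symmetric] power_int_add)
  have a_m: "2 * a m = [:\<mu> powi (2 * m) * (\<theta> r + \<theta> s), 2 * \<mu> powi (2 * m):]"
    if r: "even (r - e)" and s: "even (s - e)" and m: "r + s = 2 * m" for r s m
    using GG_v[OF r s, symmetric] c0 \<mu>0 unfolding m \<mu>_half[OF m]
    unfolding g_eq[OF r] g_eq[OF s] h_eq[OF r] h_eq[OF s] \<gamma>[OF r] \<gamma>[OF s] \<kappa>[OF r] \<kappa>[OF s] \<eta>
    by (simp add: algebra_simps \<mu>_half[OF m])
  have b_m: "2 * b m = [:\<mu> powi (2 * m) * (\<theta> r + \<theta> s + of_int m), 2 * \<mu> powi (2 * m):]"
    if r: "even (r - e)" and s: "even (s - e)" and m: "r + s = 2 * m" for r s m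
  proof -
    have mc: "(of_int m :: complex) = (of_int r + of_int s) / 2"
      using arg_cong[OF m, of "of_int :: int \<Rightarrow> complex"] by (simp add: eq_divide_eq mult.commute)
    show ?thesis
      using GG_w[OF r s, symmetric] c0 \<mu>0 unfolding m mc \<mu>_half[OF m]
      unfolding g_eq[OF r] g_eq[OF s] h_eq[OF r] h_eq[OF s] \<gamma>[OF r] \<gamma>[OF s] \<kappa>[OF r] \<kappa>[OF s] \<eta>
      by (simp add: algebra_simps \<mu>_half[OF m] add_divide_distrib)
  qed
  \<comment> \<open>The constant term of \<open>L\<^sub>1\<close> on \<open>v\<close> after division
    by \<open>\<mu>\<^sup>2\<close>. It fixes \<open>\<theta> (r + 2) + \<theta> (- r)\<close>,
    while \<open>a 0 = x\<close> makes \<open>\<theta>\<close> odd; together they give the recursion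
    with step \<open>2 * \<alpha>\<close>.\<close>
  define \<alpha> where "\<alpha> = coeff (a 1) 0 / l"
  have \<theta>_minus: "\<theta> r + \<theta> (- r) = 0" if "even (r - e)" for r
    using a_m[of r "- r" 0] that L0 by (simp add: numeral_poly)
  have \<theta>_add: "\<theta> (r + 2) = \<theta> r + 2 * \<alpha>" if "even (r - e)" for r
  proof -
    have "2 * a 1 = [:\<mu> powi (2 * 1) * (\<theta> (r + 2) + \<theta> (- r)), 2 * \<mu> powi (2 * 1):]"
      by (rule a_m) (use that in auto)
    then have "coeff (2 * a 1) 0 = l * (\<theta> (r + 2) + \<theta> (- r))"
      by (simp add: \<mu>2)
    then have "2 * (l * \<alpha>) = l * (\<theta> (r + 2) + \<theta> (- r))"
      using l0 by (simp add: \<alpha>_def numeral_poly)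
    then have "l * (2 * \<alpha>) = l * (\<theta> (r + 2) + \<theta> (- r))" by simp
    then have "2 * \<alpha> = \<theta> (r + 2) + \<theta> (- r)" using l0 by (metis mult_cancel_left)
    then show ?thesis using \<theta>_minus[OF that] by (simp add: algebra_simps add_eq_0_iff)
  qed
  have \<theta>: "\<theta> j = of_int j * \<alpha>" if "even (j - e)" for j
    using that
  proof (induction j rule: int_parity_induct)
    case base
    \<comment> \<open>For \<open>e = 0\<close> oddness gives \<open>\<theta> 0 = 0\<close>; for
      \<open>e = 1\<close> it must be combined with the recursion from -1 to 1.\<close>
    show ?case using e
    proof
      assume "e = 0"
      then show ?thesis using \<theta>_minus[of 0] by simp
    next
      assume e: "e = 1"
      then have "\<theta> 1 = - \<theta> (- 1)" using \<theta>_minus[of 1] by (simp add: add_eq_0_iff)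
      moreover have "\<theta> 1 = \<theta> (- 1) + 2 * \<alpha>" using \<theta>_add[of "- 1"] e by simp
      ultimately have "\<theta> 1 + \<theta> 1 = - \<theta> (- 1) + (\<theta> (- 1) + 2 * \<alpha>)" by (rule arg_cong2[where f = "(+)"])
      then have "2 * \<theta> 1 = 2 * \<alpha>" by simp
      then have "\<theta> 1 = \<alpha>" by (metis mult_cancel_left zero_neq_numeral)
      then show ?thesis using e by simp
    qed
  next
    case (step i)
    then show ?case using \<theta>_add[OF step] by (simp add: algebra_simps)
  qed
  \<comment> \<open>Every \<open>L\<^sub>m\<close> is half the anticommutator of the odd operators
    of doubled weights \<open>e\<close> and \<open>2 m - e\<close>, so all \<open>a m\<close> and
    \<open>b m\<close> are now known.\<close>
  have ex: "even (e - e)" "even ((2 * m - e) - e)" "e + (2 * m - e) = 2 * m" for m by auto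
  have \<theta>m: "\<theta> e + \<theta> (2 * m - e) = 2 * of_int m * \<alpha>" for m
    using \<theta>[OF ex(1)] \<theta>[OF ex(2)[of m]] by (simp add: algebra_simps)
  have "2 * a m = 2 * ([:\<mu> powi (2 * m):] * [:of_int m * \<alpha>, 1:])" for m
    using a_m[OF ex] \<theta>m[of m] by (simp add: numeral_poly)
  then have a: "a m = [:\<mu> powi (2 * m):] * [:of_int m * \<alpha>, 1:]" for m
    by (metis mult_cancel_left zero_neq_numeral)
  have "2 * b m = 2 * ([:\<mu> powi (2 * m):] * [:of_int m * (\<alpha> + 1 / 2), 1:])" for m
    using b_m[OF ex, of m] unfolding \<theta>m by (simp add: numeral_poly algebra_simps)
  then have b: "b m = [:\<mu> powi (2 * m):] * [:of_int m * (\<alpha> + 1 / 2), 1:]" for m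
    by (metis mult_cancel_left zero_neq_numeral)
  show ?thesis
  proof (rule that[OF c0 \<mu>0 _ _ _ a b])
    show "csqrt (\<mu>\<^sup>2) = \<mu>" unfolding \<mu>2 by (simp add: \<mu>_def)
    show "g j = [:c * \<mu> powi j:]" if "even (j - e)" for j
      using g_eq[OF that] \<gamma>[OF that] by simp
    show "h j = [:of_int j * \<alpha> * \<mu> powi j / c, \<mu> powi j / c:]" if "even (j - e)" for j
      using h_eq[OF that] \<kappa>[OF that] \<eta>[of j] \<theta>[OF that] by simp
  qed
qed

end

section \<open>The model action and its intertwiners\<close>

type_synonym poly2 = "complex poly \<times> complex poly"

definition pscale :: "complex poly \<Rightarrow> poly2 \<Rightarrow> poly2" (infixr \<open>*\<^sub>v\<close> 75) where
  "f *\<^sub>v u = (f * fst u, f * snd u)"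

lemma pscale_Pair [simp]: "f *\<^sub>v (p, q) = (f * p, f * q)"
  by (simp add: pscale_def)

lemma pscale_simps [simp]:
  "1 *\<^sub>v u = u" "0 *\<^sub>v u = 0" "f *\<^sub>v 0 = 0" "f *\<^sub>v g *\<^sub>v u = (f * g) *\<^sub>v u"
  by (simp_all add: pscale_def mult.assoc zero_prod_def)

lemma pscale_distrib:
  "f *\<^sub>v (u + v) = f *\<^sub>v u + f *\<^sub>v v" "(f + g) *\<^sub>v u = f *\<^sub>v u + g *\<^sub>v u"
  "f *\<^sub>v (u - v) = f *\<^sub>v u - f *\<^sub>v v"
  by (simp_all add: pscale_def algebra_simps)

lemma pscale_sum: "f *\<^sub>v sum s A = (\<Sum>i\<in>A. f *\<^sub>v s i)"
  by (induction A rule: infinite_finite_induct) (simp_all add: pscale_distrib)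

text \<open>Linearity over \<complex> only, with scalars written as constant polynomials: the
  operators of \<open>L\<^sub>m\<close> and \<open>G\<^sub>r\<close> are merely semilinear over
  \<open>\<complex>[L\<^sub>0]\<close>.\<close>

definition clinear :: "(poly2 \<Rightarrow> poly2) \<Rightarrow> bool" where
  "clinear T \<longleftrightarrow> (\<forall>u v. T (u + v) = T u + T v) \<and> (\<forall>c u. T ([:c:] *\<^sub>v u) = [:c:] *\<^sub>v T u)"

lemma clinearD:
  assumes "clinear T"
  shows "T (u + v) = T u + T v" "T ([:c:] *\<^sub>v u) = [:c:] *\<^sub>v T u" "T 0 = 0"
    "T (sum s A) = (\<Sum>i\<in>A. T (s i))"
proof -
  show *: "T (u + v) = T u + T v" "T ([:c:] *\<^sub>v u) = [:c:] *\<^sub>v T u" for u v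
    using assms unfolding clinear_def by blast+
  show 0: "T 0 = 0" using *(1)[of 0 0] by simp
  show "T (sum s A) = (\<Sum>i\<in>A. T (s i))"
    by (induction A rule: infinite_finite_induct) (simp_all add: * 0)
qed

definition lin_ext :: "(svir_basis \<Rightarrow> poly2 \<Rightarrow> poly2) \<Rightarrow> svir_vec \<Rightarrow> poly2 \<Rightarrow> poly2" where
  "lin_ext T x u = (\<Sum>k\<in>Poly_Mapping.keys x. [:Poly_Mapping.lookup x k:] *\<^sub>v T k u)"

lemma lin_ext_superset:
  assumes "finite S" "Poly_Mapping.keys x \<subseteq> S"
  shows "lin_ext T x u = (\<Sum>k\<in>S. [:Poly_Mapping.lookup x k:] *\<^sub>v T k u)"
  unfolding lin_ext_def
  by (rule sum.mono_neutral_left) (use assms in \<open>auto simp: in_keys_iff\<close>)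

lemma lin_ext_single [simp]: "lin_ext T (Poly_Mapping.single k c) u = [:c:] *\<^sub>v T k u"
  by (simp add: lin_ext_def)

lemma lin_ext_0 [simp]: "lin_ext T 0 u = 0"
  by (simp add: lin_ext_def)

lemma lin_ext_add: "lin_ext T (x + y) u = lin_ext T x u + lin_ext T y u"
proof -
  let ?S = "Poly_Mapping.keys x \<union> Poly_Mapping.keys y"
  have S: "finite ?S" "Poly_Mapping.keys (x + y) \<subseteq> ?S" "Poly_Mapping.keys x \<subseteq> ?S" "Poly_Mapping.keys y \<subseteq> ?S"
    by (auto dest: subsetD[OF Poly_Mapping.keys_add])
  have "[:Poly_Mapping.lookup (x + y) k:] *\<^sub>v T k u
    = [:Poly_Mapping.lookup x k:] *\<^sub>v T k u + [:Poly_Mapping.lookup y k:] *\<^sub>v T k u" for k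
    by (simp add: lookup_add flip: pscale_distrib(2))
  then show ?thesis
    using lin_ext_superset[OF S(1,2)] lin_ext_superset[OF S(1,3)] lin_ext_superset[OF S(1,4)]
    by (simp add: sum.distrib)
qed

lemma lin_ext_sum: "lin_ext T (sum s A) u = (\<Sum>i\<in>A. lin_ext T (s i) u)"
  by (induction A rule: infinite_finite_induct) (simp_all add: lin_ext_add)

lemma lookup_scale [simp]: "Poly_Mapping.lookup (scale c x) k = c * Poly_Mapping.lookup x k"
  by (simp add: scale_def Poly_Mapping.map.rep_eq when_def)

lemma keys_scale: "Poly_Mapping.keys (scale c x) \<subseteq> Poly_Mapping.keys x"
  by (auto simp: in_keys_iff)

lemma scale_single [simp]: "scale c (Poly_Mapping.single k d) = Poly_Mapping.single k (c * d)"
  by (rule poly_mapping_eqI) (simp add: lookup_single when_def)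

lemma lin_ext_scale: "lin_ext T (scale c x) u = [:c:] *\<^sub>v lin_ext T x u"
  unfolding lin_ext_superset[OF finite_keys keys_scale] lin_ext_def[of T x] by (simp add: pscale_sum mult.commute)

lemma clinear_lin_ext:
  assumes "\<And>k. clinear (T k)"
  shows "clinear (lin_ext T x)"
  unfolding clinear_def lin_ext_def
  by (simp add: clinearD[OF assms] pscale_distrib pscale_sum sum.distrib mult.commute)

lemma lin_ext_bracket:
  "lin_ext T (svir_bracket x y) u = (\<Sum>k\<in>Poly_Mapping.keys x. \<Sum>l\<in>Poly_Mapping.keys y.
    [:Poly_Mapping.lookup x k * Poly_Mapping.lookup y l:] *\<^sub>v lin_ext T (basis_bracket k l) u)"
  by (simp add: svir_bracket_def lin_ext_sum lin_ext_scale)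

lemma lin_ext_lin_ext:
  assumes "\<And>k. clinear (T k)"
  shows "lin_ext T x (lin_ext T y u) = (\<Sum>k\<in>Poly_Mapping.keys x. \<Sum>l\<in>Poly_Mapping.keys y.
    [:Poly_Mapping.lookup x k * Poly_Mapping.lookup y l:] *\<^sub>v T k (T l u))"
  by (simp add: lin_ext_def clinearD[OF assms] pscale_sum mult.commute)

section \<open>Representations on pairs and the common model\<close>

definition svir_rep :: "rat \<Rightarrow> (svir_basis \<Rightarrow> poly2 \<Rightarrow> poly2) \<Rightarrow> bool" where
  "svir_rep \<epsilon> T \<longleftrightarrow> (\<forall>k. clinear (T k)) \<and>
    (\<forall>i j. \<forall>k\<in>svir_index \<epsilon> i. \<forall>l\<in>svir_index \<epsilon> j. \<forall>u. lin_ext T (basis_bracket k l) u =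
      (if i = 1 \<and> j = 1 then T k (T l u) + T l (T k u) else T k (T l u) - T l (T k u)))"

text \<open>Both sides are bilinear in \<open>x\<close> and \<open>y\<close>; since these are
  homogeneous, one sign applies to all pairs of basis symbols.\<close>

lemma svir_rep_bracket:
  assumes T: "svir_rep \<epsilon> T" and x: "x \<in> svir_part \<epsilon> i" and y: "y \<in> svir_part \<epsilon> j"
  shows "lin_ext T (svir_bracket x y) u =
    (if i = 1 \<and> j = 1 then lin_ext T x (lin_ext T y u) + lin_ext T y (lin_ext T x u)
     else lin_ext T x (lin_ext T y u) - lin_ext T y (lin_ext T x u))"
proof -
  have lin: "\<And>k. clinear (T k)" using T by (simp add: svir_rep_def)
  have idx: "Poly_Mapping.keys x \<subseteq> svir_index \<epsilon> i" "Poly_Mapping.keys y \<subseteq> svir_index \<epsilon> j"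
    using x y by (simp_all add: svir_part_def)
  let ?l = "\<lambda>k l. [:Poly_Mapping.lookup x k * Poly_Mapping.lookup y l:]"
  have "lin_ext T (svir_bracket x y) u = (\<Sum>k\<in>Poly_Mapping.keys x. \<Sum>l\<in>Poly_Mapping.keys y.
    if i = 1 \<and> j = 1 then ?l k l *\<^sub>v T k (T l u) + ?l k l *\<^sub>v T l (T k u)
    else ?l k l *\<^sub>v T k (T l u) - ?l k l *\<^sub>v T l (T k u))"
    unfolding lin_ext_bracket
  proof (intro sum.cong refl)
    fix k l assume "k \<in> Poly_Mapping.keys x" "l \<in> Poly_Mapping.keys y"
    then have "lin_ext T (basis_bracket k l) u =
      (if i = 1 \<and> j = 1 then T k (T l u) + T l (T k u) else T k (T l u) - T l (T k u))"
      using T idx unfolding svir_rep_def by blast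
    then show "?l k l *\<^sub>v lin_ext T (basis_bracket k l) u =
      (if i = 1 \<and> j = 1 then ?l k l *\<^sub>v T k (T l u) + ?l k l *\<^sub>v T l (T k u)
       else ?l k l *\<^sub>v T k (T l u) - ?l k l *\<^sub>v T l (T k u))"
      by (simp add: pscale_distrib)
  qed
  moreover have "lin_ext T y (lin_ext T x u)
    = (\<Sum>k\<in>Poly_Mapping.keys x. \<Sum>l\<in>Poly_Mapping.keys y. ?l k l *\<^sub>v T l (T k u))"
    unfolding lin_ext_lin_ext[OF lin] by (subst sum.swap) (simp add: mult.commute)
  ultimately show ?thesis
    by (simp add: lin_ext_lin_ext[OF lin] sum.distrib sum_subtractf)
qed

text \<open>The normal form with \<open>w\<close> rescaled so that \<open>c = 1\<close>. For a
  half-integer \<open>r\<close> the floor is exactly the doubled weight \<open>2 * r\<close>, so a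
  single formula serves both algebras.\<close>

fun model :: "complex \<Rightarrow> complex \<Rightarrow> svir_basis \<Rightarrow> poly2 \<Rightarrow> poly2" where
  "model \<mu> \<alpha> (L m) (p, q) =
    [:\<mu> powi (2 * m):] *\<^sub>v ([:of_int m * \<alpha>, 1:] * shift (of_int m) p,
      [:of_int m * (\<alpha> + 1 / 2), 1:] * shift (of_int m) q)"
| "model \<mu> \<alpha> (G r) (p, q) =
    [:\<mu> powi \<lfloor>2 * r\<rfloor>:] *\<^sub>v ([:2 * of_rat r * \<alpha>, 1:] * shift (of_rat r) q, shift (of_rat r) p)"

lemma model_G_half [simp]:
  "model \<mu> \<alpha> (G (of_int j / 2)) (p, q) = [:\<mu> powi j:] *\<^sub>v
    ([:of_int j * \<alpha>, 1:] * shift (of_int j / 2) q, shift (of_int j / 2) p)"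
  by (simp add: of_rat_divide)

declare model.simps(2) [simp del]

lemma svir_index_0: "svir_index \<epsilon> 0 = range L"
  by (simp add: svir_index_def)

lemma svir_index_1: "svir_index (of_int e / 2) 1 = {G (of_int j / 2) | j. even (j - e)}"
proof -
  have "\<exists>j. of_int e / 2 + of_int k = (of_int j / 2 :: rat) \<and> even (j - e)" for k
    by (rule exI[of _ "e + 2 * k"]) (simp add: add_divide_distrib)
  moreover have "\<exists>k. (of_int j / 2 :: rat) = of_int e / 2 + of_int k" if "even (j - e)" for j
  proof -
    from that obtain k where "j = e + 2 * k" by (metis add_diff_cancel_left' diff_add_cancel dvdE add.commute)
    then show ?thesis by (intro exI[of _ k]) (simp add: add_divide_distrib)
  qed
  ultimately show ?thesis by (fastforce simp: svir_index_def)
qed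

lemma bit_cases: "(i :: bit) = 0 \<or> i = 1"
  by (cases i) auto

lemma half_add_half: "of_int m + (of_int j / 2 :: rat) = of_int (2 * m + j) / 2"
  by simp

lemma floor_half_add_half:
  assumes "even (j + k)"
  shows "\<lfloor>of_int j / 2 + of_int k / 2 :: rat\<rfloor> = (j + k) div 2"
proof -
  obtain n where n: "j + k = 2 * n" using assms by blast
  have "of_int j / 2 + of_int k / 2 = (of_int (j + k) / 2 :: rat)" by (simp add: add_divide_distrib)
  also have "\<dots> = of_int n" using n by simp
  finally have "of_int j / 2 + of_int k / 2 = (of_int n :: rat)" .
  then show ?thesis unfolding n by (simp only: floor_of_int)
qed

lemma clinear_model: "clinear (model \<mu> \<alpha> k)"
  unfolding clinear_def
  by (cases k) (auto simp: model.simps(2) algebra_simps smult_add_right)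

text \<open>Powers of \<open>\<mu>\<close> multiply under composition, and what remains of each
  bracket relation is a polynomial identity in the weights and x, whatever the parity class of the
  odd indices.\<close>

lemma svir_rep_model:
  assumes \<mu>: "\<mu> \<noteq> 0"
  shows "svir_rep (of_int e / 2) (model \<mu> \<alpha>)"
proof -
  have LL: "lin_ext (model \<mu> \<alpha>) (basis_bracket (L m) (L n)) u
      = model \<mu> \<alpha> (L m) (model \<mu> \<alpha> (L n) u) - model \<mu> \<alpha> (L n) (model \<mu> \<alpha> (L m) u)" for m n u
    using \<mu> by (cases u) (auto intro!: poly_ext simp: power_int_add distrib_left algebra_simps add_divide_distrib diff_divide_distrib)
  have LG: "lin_ext (model \<mu> \<alpha>) (basis_bracket (L m) (G (of_int j / 2))) u
      = model \<mu> \<alpha> (L m) (model \<mu> \<alpha> (G (of_int j / 2)) u) - model \<mu> \<alpha> (G (of_int j / 2)) (model \<mu> \<alpha> (L m) u)" for m j u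
  proof -
    define i where "i = 2 * m + j"
    have i: "\<mu> powi i = \<mu> powi (2 * m) * \<mu> powi j" "(of_int i :: complex) = 2 * of_int m + of_int j"
      using \<mu> by (simp_all add: i_def power_int_add)
    have c: "(of_rat (of_int m / 2 - of_int j / 2) :: complex) = of_int m / 2 - of_int j / 2"
      by (simp add: of_rat_diff of_rat_divide)
    show ?thesis
      unfolding basis_bracket.simps half_add_half i_def[symmetric] c
      by (cases u) (auto intro!: poly_ext simp: i algebra_simps add_divide_distrib diff_divide_distrib)
  qed
  have GL: "lin_ext (model \<mu> \<alpha>) (basis_bracket (G (of_int j / 2)) (L m)) u
      = model \<mu> \<alpha> (G (of_int j / 2)) (model \<mu> \<alpha> (L m) u) - model \<mu> \<alpha> (L m) (model \<mu> \<alpha> (G (of_int j / 2)) u)" for m j u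
  proof -
    have "lin_ext (model \<mu> \<alpha>) (basis_bracket (G (of_int j / 2)) (L m)) u
      = - lin_ext (model \<mu> \<alpha>) (basis_bracket (L m) (G (of_int j / 2))) u"
      by (simp add: pscale_def)
    then show ?thesis unfolding LG by simp
  qed
  have GG: "lin_ext (model \<mu> \<alpha>) (basis_bracket (G (of_int j / 2)) (G (of_int k / 2))) u
      = model \<mu> \<alpha> (G (of_int j / 2)) (model \<mu> \<alpha> (G (of_int k / 2)) u)
      + model \<mu> \<alpha> (G (of_int k / 2)) (model \<mu> \<alpha> (G (of_int j / 2)) u)" if "even (j + k)" for j k u
  proof -
    obtain n where n: "j + k = 2 * n" using \<open>even (j + k)\<close> by blast
    have "of_int j + of_int k = (2 * of_int n :: complex)"
      using arg_cong[OF n, of "of_int :: int \<Rightarrow> complex"] by simp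
    then have k: "(of_int k :: complex) = 2 * of_int n - of_int j" by (simp add: algebra_simps)
    have p: "\<mu> powi (2 * n) = \<mu> powi j * \<mu> powi k"
      using \<mu> by (simp add: n[symmetric] power_int_add)
    then have p': "\<mu> powi (n * 2) = \<mu> powi j * \<mu> powi k" by (simp only: mult.commute)
    have "(j + k) div 2 = n" using n by simp
    then show ?thesis
      unfolding basis_bracket.simps floor_half_add_half[OF that]
      by (cases u) (auto intro!: poly_ext simp: k p p' algebra_simps diff_divide_distrib)
  qed
  show ?thesis
    unfolding svir_rep_def
  proof (intro conjI allI ballI)
    fix i j k l u
    assume k: "k \<in> svir_index (of_int e / 2) i" and l: "l \<in> svir_index (of_int e / 2) j"
    show "lin_ext (model \<mu> \<alpha>) (basis_bracket k l) u =
      (if i = 1 \<and> j = 1 then model \<mu> \<alpha> k (model \<mu> \<alpha> l u) + model \<mu> \<alpha> l (model \<mu> \<alpha> k u)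
       else model \<mu> \<alpha> k (model \<mu> \<alpha> l u) - model \<mu> \<alpha> l (model \<mu> \<alpha> k u))"
      using bit_cases[of i] bit_cases[of j] k l
      by (auto simp: svir_index_0 svir_index_1 LL LG GL GG simp del: basis_bracket.simps model_G_half)
  qed (rule clinear_model)
qed

section \<open>Maps commuting with two model actions\<close>

lemma poly_eq_0_on_parity_class:
  fixes R :: "complex poly"
  assumes "\<And>j. even (j - e) \<Longrightarrow> poly R (of_int j) = 0"
  shows "poly R t = 0"
proof -
  have "infinite (range (\<lambda>n::nat. of_int (e + 2 * int n) :: complex))"
    by (rule range_inj_infinite) (auto intro!: injI)
  then have "R = 0"
  proof (rule poly_eq_0_if_infinite_roots)
    fix z assume "z \<in> range (\<lambda>n::nat. of_int (e + 2 * int n) :: complex)"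
    then obtain n where "z = of_int (e + 2 * int n)" by blast
    then show "poly R z = 0" by (simp only:) (rule assms, simp)
  qed
  then show ?thesis by simp
qed

text \<open>Shifts and monic linear factors do not affect leading coefficients. This recovers
  \<open>\<mu>\<^sup>2\<close> from a nonzero intertwiner.\<close>

lemma lead_coeff_shift_eqD:
  assumes "[:s:] * ([:x, 1:] * p) = [:t:] * ([:y, 1:] * shift c p)" "p \<noteq> 0"
  shows "s = t"
  using arg_cong[OF assms(1), of lead_coeff] assms(2)
  by (simp only: lead_coeff_mult lead_coeff_shift) simp

text \<open>
  The operator of \<open>G\<^sub>r\<close>, divided by \<open>\<mu>\<^sup>2\<^sup>r\<close>, depends polynomially on \<open>r\<close>, so an intertwiner for
  all \<open>r \<in> \<epsilon> + \<int>\<close> is one for all half-integers \<open>r\<close>.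
\<close>

lemma model_intertwiner:
  assumes h: "clinear h" and \<mu>: "\<mu> \<noteq> 0" "csqrt (\<mu>\<^sup>2) = \<mu>" and \<nu>: "csqrt (\<nu>\<^sup>2) = \<nu>"
    and L: "\<And>m u. h (model \<mu> \<alpha> (L m) u) = model \<nu> \<beta> (L m) (h u)"
    and G: "\<And>j u. even (j - e) \<Longrightarrow> h (model \<mu> \<alpha> (G (of_int j / 2)) u) = model \<nu> \<beta> (G (of_int j / 2)) (h u)"
  shows "h (model \<mu> \<alpha> (G (of_int j / 2)) u) = model \<nu> \<beta> (G (of_int j / 2)) (h u)"
proof -
  have L0: "model \<mu> \<alpha> (L 0) u = [:0, 1:] *\<^sub>v u" for \<mu> \<alpha> u
    by (cases u) (simp add: algebra_simps)
  have hX: "h ([:0, 1:] *\<^sub>v u) = [:0, 1:] *\<^sub>v h u" for u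
    using L[of 0 u] unfolding L0 .
  have hf: "h (f *\<^sub>v u) = f *\<^sub>v h u" for f u
  proof (induction f)
    case (pCons c f)
    have f: "pCons c f = [:c:] + [:0, 1:] * f" by simp
    show ?case
      unfolding f pscale_distrib(2) clinearD(1,2)[OF h] pscale_simps(4)[symmetric] hX pCons ..
  qed (simp add: clinearD(3)[OF h])
  \<comment> \<open>Commuting with \<open>L\<^sub>0\<close> makes \<open>h\<close> linear over the
    polynomials, so it is a 2 by 2 matrix, determined by the images of the two basis
    vectors.\<close>
  obtain a b where ab: "h (1, 0) = (a, b)" by (meson surj_pair)
  obtain c d where cd: "h (0, 1) = (c, d)" by (meson surj_pair)
  have h_eq: "h (p, q) = (p * a + q * c, p * b + q * d)" for p q
  proof -
    have "(p, q) = p *\<^sub>v (1, 0) + q *\<^sub>v (0, 1)" by simp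
    then have "h (p, q) = p *\<^sub>v h (1, 0) + q *\<^sub>v h (0, 1)" by (simp only: clinearD(1)[OF h] hf)
    then show ?thesis by (simp add: ab cd)
  qed
  show ?thesis
  proof (cases "a = 0 \<and> b = 0 \<and> c = 0 \<and> d = 0")
    case True
    then show ?thesis using h_eq by (cases u) simp
  next
    case False
    \<comment> \<open>Some matrix entry is nonzero; comparing leading coefficients in its relation
      for \<open>L\<^sub>1\<close> gives \<open>\<mu>\<^sup>2 = \<nu>\<^sup>2\<close>, and the
      choice of root then gives \<open>\<mu> = \<nu>\<close>.\<close>
    have La: "[:\<mu>\<^sup>2:] * ([:\<alpha>, 1:] * a) = [:\<nu>\<^sup>2:] * ([:\<beta>, 1:] * shift 1 a)"
      and Lb: "[:\<mu>\<^sup>2:] * ([:\<alpha>, 1:] * b) = [:\<nu>\<^sup>2:] * ([:\<beta> + 1 / 2, 1:] * shift 1 b)"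
      using L[of 1 "(1, 0)"] unfolding model.simps(1) pscale_Pair h_eq
      by (simp_all add: smult_add_right mult.commute)
    have Lc: "[:\<mu>\<^sup>2:] * ([:\<alpha> + 1 / 2, 1:] * c) = [:\<nu>\<^sup>2:] * ([:\<beta>, 1:] * shift 1 c)"
      and Ld: "[:\<mu>\<^sup>2:] * ([:\<alpha> + 1 / 2, 1:] * d) = [:\<nu>\<^sup>2:] * ([:\<beta> + 1 / 2, 1:] * shift 1 d)"
      using L[of 1 "(0, 1)"] unfolding model.simps(1) pscale_Pair h_eq
      by (simp_all add: smult_add_right mult.commute)
    have "a \<noteq> 0 \<or> b \<noteq> 0 \<or> c \<noteq> 0 \<or> d \<noteq> 0" using False by simp
    then have \<mu>\<nu>2: "\<mu>\<^sup>2 = \<nu>\<^sup>2"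
      by (elim disjE) (erule lead_coeff_shift_eqD[OF La] lead_coeff_shift_eqD[OF Lb]
        lead_coeff_shift_eqD[OF Lc] lead_coeff_shift_eqD[OF Ld])+
    have \<nu>\<mu>: "\<nu> = \<mu>" using \<nu> \<mu>(2) unfolding \<mu>\<nu>2 by (rule trans[OF sym])
    have cancel: "u = v" if "[:\<mu> powi j:] *\<^sub>v u = [:\<mu> powi j:] *\<^sub>v v" for j u v
    proof -
      have "[:inverse (\<mu> powi j):] * [:\<mu> powi j:] = 1" using \<mu>(1) by (simp add: one_pCons)
      then show ?thesis
        using arg_cong[OF that, of "\<lambda>w. [:inverse (\<mu> powi j):] *\<^sub>v w"] by (simp only: pscale_simps)
    qed
    note simps = model_G_half hf h_eq \<nu>\<mu> shift_0 shift_1 mult_zero_left mult_zero_right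
      mult_1_left mult_1_right add_0_left add_0_right
    have e1: "c = [:of_int j * \<beta>, 1:] * shift (of_int j / 2) b" "d = shift (of_int j / 2) a"
      and e2: "[:of_int j * \<alpha>, 1:] * a = [:of_int j * \<beta>, 1:] * shift (of_int j / 2) d"
        "[:of_int j * \<alpha>, 1:] * b = shift (of_int j / 2) c"
      if j: "even (j - e)" for j
    proof -
      have "(c, d) = ([:of_int j * \<beta>, 1:] * shift (of_int j / 2) b, shift (of_int j / 2) a)"
        using G[OF j, of "(1, 0)"] unfolding simps by (rule cancel)
      then show "c = [:of_int j * \<beta>, 1:] * shift (of_int j / 2) b" "d = shift (of_int j / 2) a"
        by (simp_all only: prod.inject)
      have "([:of_int j * \<alpha>, 1:] * a, [:of_int j * \<alpha>, 1:] * b)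
        = ([:of_int j * \<beta>, 1:] * shift (of_int j / 2) d, shift (of_int j / 2) c)"
        using G[OF j, of "(0, 1)"] unfolding simps by (rule cancel)
      then show "[:of_int j * \<alpha>, 1:] * a = [:of_int j * \<beta>, 1:] * shift (of_int j / 2) d"
        "[:of_int j * \<alpha>, 1:] * b = shift (of_int j / 2) c"
        by (simp_all only: prod.inject)
    qed
    \<comment> \<open>For fixed \<open>z\<close> the difference of the two sides is a polynomial in
      \<open>j\<close>; \<open>pcompose b [:z, 1 / 2:]\<close> is the function sending t to
      \<open>b (z + t/2)\<close>. It vanishes on a parity class, hence identically. The next three
      equations follow the same pattern.\<close>
    have E1: "c = [:of_int j * \<beta>, 1:] * shift (of_int j / 2) b" for j
    proof (rule poly_ext)
      fix z
      have "poly ([:poly c z:] - [:z, \<beta>:] * pcompose b [:z, 1 / 2:]) (of_int j) = 0"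
        by (rule poly_eq_0_on_parity_class[of e])
          (subst e1(1), assumption, simp add: poly_pcompose algebra_simps)
      then show "poly c z = poly ([:of_int j * \<beta>, 1:] * shift (of_int j / 2) b) z"
        by (simp add: poly_pcompose algebra_simps)
    qed
    have E2: "d = shift (of_int j / 2) a" for j
    proof (rule poly_ext)
      fix z
      have "poly ([:poly d z:] - pcompose a [:z, 1 / 2:]) (of_int j) = 0"
        by (rule poly_eq_0_on_parity_class[of e])
          (subst e1(2), assumption, simp add: poly_pcompose algebra_simps)
      then show "poly d z = poly (shift (of_int j / 2) a) z"
        by (simp add: poly_pcompose algebra_simps)
    qed
    have E3: "[:of_int j * \<alpha>, 1:] * a = [:of_int j * \<beta>, 1:] * shift (of_int j / 2) d" for j
    proof (rule poly_ext)
      fix z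
      have "poly ([:z, \<alpha>:] * [:poly a z:] - [:z, \<beta>:] * pcompose d [:z, 1 / 2:]) (of_int j) = 0"
        by (rule poly_eq_0_on_parity_class[of e])
          (drule e2(1), drule arg_cong[where f = "\<lambda>p. poly p z"], simp add: poly_pcompose algebra_simps)
      then show "poly ([:of_int j * \<alpha>, 1:] * a) z = poly ([:of_int j * \<beta>, 1:] * shift (of_int j / 2) d) z"
        by (simp add: poly_pcompose algebra_simps)
    qed
    have E4: "[:of_int j * \<alpha>, 1:] * b = shift (of_int j / 2) c" for j
    proof (rule poly_ext)
      fix z
      have "poly ([:z, \<alpha>:] * [:poly b z:] - pcompose c [:z, 1 / 2:]) (of_int j) = 0"
        by (rule poly_eq_0_on_parity_class[of e])
          (drule e2(2), drule arg_cong[where f = "\<lambda>p. poly p z"], simp add: poly_pcompose algebra_simps)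
      then show "poly ([:of_int j * \<alpha>, 1:] * b) z = poly (shift (of_int j / 2) c) z"
        by (simp add: poly_pcompose algebra_simps)
    qed
    obtain p q where u: "u = (p, q)" by (meson surj_pair)
    let ?s = "shift (of_int j / 2)"
    have "h (model \<mu> \<alpha> (G (of_int j / 2)) u) = [:\<mu> powi j:] *\<^sub>v
      (?s q * ([:of_int j * \<alpha>, 1:] * a) + ?s p * c, ?s q * ([:of_int j * \<alpha>, 1:] * b) + ?s p * d)"
      unfolding u model_G_half hf h_eq by (simp only: mult.left_commute mult.commute)
    also have "?s p * c = ?s p * ([:of_int j * \<beta>, 1:] * ?s b)" by (subst E1[of j]) (rule refl)
    also have "?s p * d = ?s p * ?s a" by (subst E2[of j]) (rule refl)
    also have "[:\<mu> powi j:] *\<^sub>v (?s q * ([:of_int j * \<alpha>, 1:] * a) + ?s p * ([:of_int j * \<beta>, 1:] * ?s b),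
        ?s q * ([:of_int j * \<alpha>, 1:] * b) + ?s p * ?s a) = model \<nu> \<beta> (G (of_int j / 2)) (h u)"
      unfolding u h_eq model_G_half \<nu>\<mu> E3[of j] E4[of j] by (simp add: algebra_simps)
    finally show ?thesis .
  qed
qed

section \<open>Modules with a homogeneous basis\<close>

lemma ring_of_simps [simp]:
  "carrier (ring_of TYPE('a::comm_ring_1)) = UNIV"
  "monoid.mult (ring_of TYPE('a)) = (*)" "one (ring_of TYPE('a)) = 1"
  "zero (ring_of TYPE('a)) = 0" "add (ring_of TYPE('a)) = (+)"
  by (simp_all add: ring_of_def)

lemma cring_ring_of: "cring (ring_of TYPE('a::comm_ring_1))"
proof (rule cringI)
  show "abelian_group (ring_of TYPE('a))"
  proof (rule abelian_groupI)
    fix x :: 'a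
    show "\<exists>y\<in>carrier (ring_of TYPE('a)). y \<oplus>\<^bsub>ring_of TYPE('a)\<^esub> x = \<zero>\<^bsub>ring_of TYPE('a)\<^esub>"
      by (rule bexI[of _ "- x"]) simp_all
  qed (simp_all add: algebra_simps)
  show "comm_monoid (ring_of TYPE('a))"
    by (rule comm_monoidI) (simp_all add: algebra_simps)
qed (simp_all add: algebra_simps)

lemma U_hh_simps [simp]:
  "carrier U_hh = UNIV" "one U_hh = (1, 0)" "zero U_hh = 0"
  "monoid.mult U_hh (p, q) (p', q') = (p * p' + [:0, 1:] * q * q', p * q' + q * p')"
  "add U_hh = (+)"
  by (simp_all add: U_hh_def fun_eq_iff zero_prod_def)

lemma cring_U_hh: "cring U_hh"
proof (rule cringI)
  show "abelian_group U_hh"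
  proof (rule abelian_groupI)
    fix x :: poly2
    show "\<exists>y\<in>carrier U_hh. y \<oplus>\<^bsub>U_hh\<^esub> x = \<zero>\<^bsub>U_hh\<^esub>"
      by (rule bexI[of _ "- x"]) simp_all
  qed (auto simp: algebra_simps)
  show "comm_monoid U_hh"
    by (rule comm_monoidI) (auto simp: algebra_simps split_paired_all)
qed (auto simp: algebra_simps split_paired_all)

lemma bij_betw_iff_Ex1:
  assumes "f \<in> A \<rightarrow> B"
  shows "bij_betw f A B \<longleftrightarrow> (\<forall>y\<in>B. \<exists>!x. x \<in> A \<and> y = f x)"
proof
  assume "bij_betw f A B"
  then show "\<forall>y\<in>B. \<exists>!x. x \<in> A \<and> y = f x"
    unfolding bij_betw_def inj_on_def by blast
next
  assume *: "\<forall>y\<in>B. \<exists>!x. x \<in> A \<and> y = f x"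
  have "inj_on f A"
  proof (rule inj_onI)
    fix x y assume "x \<in> A" "y \<in> A" "f x = f y"
    then show "x = y" using * assms by blast
  qed
  moreover have "f ` A = B" using * assms by blast
  ultimately show "bij_betw f A B" by (simp add: bij_betw_def)
qed

text \<open>In this form the coefficient families of a basis with one or two elements can be
  replaced by ring elements or pairs of them.\<close>

lemma module_basis_iff_bij_betw:
  assumes "finite B"
  shows "module_basis R N B \<longleftrightarrow> module R N \<and> B \<subseteq> carrier N \<and>
    bij_betw (\<lambda>u. finsum N (\<lambda>b. u b \<odot>\<^bsub>N\<^esub> b) B) (B \<rightarrow>\<^sub>E carrier R) (carrier N)"
proof -
  have "(\<lambda>u. finsum N (\<lambda>b. u b \<odot>\<^bsub>N\<^esub> b) B) \<in> (B \<rightarrow>\<^sub>E carrier R) \<rightarrow> carrier N"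
    if "module R N" "B \<subseteq> carrier N"
  proof -
    interpret module R N by fact
    show ?thesis by (rule Pi_I, rule finsum_closed) (use \<open>B \<subseteq> carrier N\<close> in \<open>auto simp: PiE_iff\<close>)
  qed
  from bij_betw_iff_Ex1[OF this] show ?thesis
    unfolding module_basis_def using assms by blast
qed

lemma module_basis_single_iff:
  "module_basis R N {b} \<longleftrightarrow> module R N \<and> b \<in> carrier N \<and>
    bij_betw (\<lambda>p. p \<odot>\<^bsub>N\<^esub> b) (carrier R) (carrier N)"
proof -
  let ?f = "\<lambda>p. \<lambda>c\<in>{b}. p"
  have bij: "bij_betw ?f (carrier R) ({b} \<rightarrow>\<^sub>E carrier R)"
    by (rule bij_betw_byWitness[where f' = "\<lambda>u. u b"])
      (auto simp: PiE_iff extensional_def fun_eq_iff split: if_splits)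
  have "finsum N (\<lambda>c. ?f p c \<odot>\<^bsub>N\<^esub> c) {b} = p \<odot>\<^bsub>N\<^esub> b"
    if "module R N" "b \<in> carrier N" "p \<in> carrier R" for p
  proof -
    interpret module R N by fact
    show ?thesis using that by simp
  qed
  then have "bij_betw ((\<lambda>u. finsum N (\<lambda>c. u c \<odot>\<^bsub>N\<^esub> c) {b}) \<circ> ?f) (carrier R) (carrier N)
    \<longleftrightarrow> bij_betw (\<lambda>p. p \<odot>\<^bsub>N\<^esub> b) (carrier R) (carrier N)" if "module R N" "b \<in> carrier N"
    using that by (intro bij_betw_cong) (simp only: o_apply)
  then show ?thesis
    unfolding module_basis_iff_bij_betw[OF finite.insertI[OF finite.emptyI]] bij_betw_comp_iff[OF bij]
    by blast
qed

lemma module_basis_pair_iff: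
  assumes "b \<noteq> c"
  shows "module_basis R N {b, c} \<longleftrightarrow> module R N \<and> b \<in> carrier N \<and> c \<in> carrier N \<and>
    bij_betw (\<lambda>(p, q). p \<odot>\<^bsub>N\<^esub> b \<oplus>\<^bsub>N\<^esub> q \<odot>\<^bsub>N\<^esub> c) (carrier R \<times> carrier R) (carrier N)"
proof -
  let ?f = "\<lambda>(p, q). \<lambda>d\<in>{b, c}. if d = b then p else q"
  have bij: "bij_betw ?f (carrier R \<times> carrier R) ({b, c} \<rightarrow>\<^sub>E carrier R)"
    by (rule bij_betw_byWitness[where f' = "\<lambda>u. (u b, u c)"])
      (use assms in \<open>auto simp: PiE_iff extensional_def fun_eq_iff split: if_splits\<close>)
  have "finsum N (\<lambda>d. ?f pq d \<odot>\<^bsub>N\<^esub> d) {b, c} = (case pq of (p, q) \<Rightarrow> p \<odot>\<^bsub>N\<^esub> b \<oplus>\<^bsub>N\<^esub> q \<odot>\<^bsub>N\<^esub> c)"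
    if "module R N" "b \<in> carrier N" "c \<in> carrier N" "pq \<in> carrier R \<times> carrier R" for pq
  proof -
    interpret module R N by fact
    show ?thesis using that assms by (auto simp: finsum_insert)
  qed
  then have "bij_betw ((\<lambda>u. finsum N (\<lambda>d. u d \<odot>\<^bsub>N\<^esub> d) {b, c}) \<circ> ?f) (carrier R \<times> carrier R) (carrier N)
    \<longleftrightarrow> bij_betw (\<lambda>(p, q). p \<odot>\<^bsub>N\<^esub> b \<oplus>\<^bsub>N\<^esub> q \<odot>\<^bsub>N\<^esub> c) (carrier R \<times> carrier R) (carrier N)"
    if "module R N" "b \<in> carrier N" "c \<in> carrier N"
    using that by (intro bij_betw_cong) (simp only: o_apply)
  then show ?thesis
    unfolding module_basis_iff_bij_betw[OF finite.insertI[OF finite.insertI[OF finite.emptyI]]]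
      bij_betw_comp_iff[OF bij]
    by blast
qed

text \<open>Parity relative to that of \<open>v\<close>: degree 0 consists of the multiples of
  \<open>v\<close>, degree 1 of those of \<open>w\<close>.\<close>

definition graded_part :: "bit \<Rightarrow> poly2 set" where
  "graded_part j = (if j = 0 then {u. snd u = 0} else {u. fst u = 0})"

definition graded :: "rat \<Rightarrow> (svir_basis \<Rightarrow> poly2 \<Rightarrow> poly2) \<Rightarrow> bool" where
  "graded \<epsilon> T \<longleftrightarrow> (\<forall>i j. \<forall>k\<in>svir_index \<epsilon> i. \<forall>u\<in>graded_part j. T k u \<in> graded_part (i + j))"

lemma graded_part_lin_ext:
  assumes T: "graded \<epsilon> T" and x: "x \<in> svir_part \<epsilon> i" and u: "u \<in> graded_part j"
  shows "lin_ext T x u \<in> graded_part (i + j)"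
proof -
  have "T k u \<in> graded_part (i + j)" if "k \<in> Poly_Mapping.keys x" for k
    using that T x u unfolding graded_def svir_part_def by blast
  then show ?thesis
    by (auto simp: graded_part_def lin_ext_def fst_sum snd_sum pscale_def split: if_splits)
qed

lemma graded_model: "graded (of_int e / 2) (model \<mu> \<alpha>)"
  unfolding graded_def
proof (intro allI ballI)
  fix i j :: bit and k u
  assume "k \<in> svir_index (of_int e / 2) i" "u \<in> graded_part j"
  then show "model \<mu> \<alpha> k u \<in> graded_part (i + j)"
    using bit_cases[of i] bit_cases[of j]
    by (cases u) (auto simp: svir_index_0 svir_index_1 graded_part_def)
qed

lemma bit_add_self [simp]: "(i :: bit) + (i + j) = j"
  using bit_cases[of i] bit_cases[of j] by auto

text \<open>
  \<open>\<Phi> (p, q)\<close> is \<open>p(L\<^sub>0) v + q(L\<^sub>0) w\<close> for a basis \<open>v, w\<close> of parities \<open>i\<close> and \<open>i + 1\<close>.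
\<close>

locale presentation =
  fixes M :: "'v svir_module" and i :: bit and \<Phi> :: "poly2 \<Rightarrow> 'v"
  assumes module: "module complex_ring M"
    and bij: "bij_betw \<Phi> UNIV (carrier M)"
    and \<Phi>_add: "\<Phi> (u + v) = \<Phi> u \<oplus>\<^bsub>M\<^esub> \<Phi> v"
    and \<Phi>_smult: "\<Phi> ([:c:] *\<^sub>v u) = c \<odot>\<^bsub>M\<^esub> \<Phi> u"
    and part_eq: "part M (i + j) = \<Phi> ` graded_part j"
begin

sublocale module complex_ring M by (rule module)

definition coords :: "'v \<Rightarrow> poly2" where
  "coords = inv_into UNIV \<Phi>"

lemma \<Phi>_closed [simp]: "\<Phi> u \<in> carrier M"
  using bij by (auto simp: bij_betw_def)

lemma inj_\<Phi>: "inj \<Phi>"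
  using bij by (simp add: bij_betw_def)

lemma \<Phi>_inject [simp]: "\<Phi> u = \<Phi> v \<longleftrightarrow> u = v"
  by (rule inj_eq[OF inj_\<Phi>])

lemma coords_\<Phi> [simp]: "coords (\<Phi> u) = u"
  unfolding coords_def by (rule inv_f_f[OF inj_\<Phi>])

lemma \<Phi>_coords [simp]: "v \<in> carrier M \<Longrightarrow> \<Phi> (coords v) = v"
  unfolding coords_def using bij by (auto simp: bij_betw_def intro: f_inv_into_f)

lemma carrier_cases:
  assumes "v \<in> carrier M" obtains u where "v = \<Phi> u"
  using assms by (metis \<Phi>_coords)

lemma \<Phi>_zero: "\<Phi> 0 = \<zero>\<^bsub>M\<^esub>"
proof -
  have "\<Phi> 0 \<oplus>\<^bsub>M\<^esub> \<Phi> 0 = \<Phi> 0" using \<Phi>_add[of 0 0] by simp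
  then show ?thesis by (simp add: M.add.r_cancel_one)
qed

lemma \<Phi>_diff: "\<Phi> (u - v) = \<Phi> u \<ominus>\<^bsub>M\<^esub> \<Phi> v"
proof -
  have "\<Phi> u = \<Phi> (u - v) \<oplus>\<^bsub>M\<^esub> \<Phi> v" by (simp flip: \<Phi>_add)
  then show ?thesis by (simp add: a_minus_def M.a_assoc M.r_neg)
qed

lemma \<Phi>_sum: "finite S \<Longrightarrow> finsum M (\<lambda>k. \<Phi> (s k)) S = \<Phi> (sum s S)"
  by (induction S rule: finite_induct) (simp_all add: \<Phi>_zero \<Phi>_add finsum_insert)

text \<open>If \<open>L\<^sub>0\<close> is multiplication by x in coordinates, its powers are
  multiplication by monomials, and \<open>p\<close> is the sum of its monomials.\<close>

lemma act_HH_\<Phi>: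
  assumes "\<And>u. act M (Lvec 0) (\<Phi> u) = \<Phi> ([:0, 1:] *\<^sub>v u)"
  shows "act_HH M p (\<Phi> u) = \<Phi> (p *\<^sub>v u)"
proof -
  have pow: "(act M (Lvec 0) ^^ n) (\<Phi> u) = \<Phi> (monom 1 n *\<^sub>v u)" for n
    by (induction n) (simp_all add: assms monom_0 monom_Suc mult.commute flip: one_pCons)
  have "act_HH M p (\<Phi> u) = finsum M (\<lambda>n. \<Phi> (monom (coeff p n) n *\<^sub>v u)) {..degree p}"
    unfolding act_HH_def pow \<Phi>_smult[symmetric] by (simp add: smult_monom)
  also have "\<dots> = \<Phi> ((\<Sum>n\<le>degree p. monom (coeff p n) n) *\<^sub>v u)"
    by (simp add: \<Phi>_sum pscale_def sum_distrib_right flip: sum_prod)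
  also have "\<dots> = \<Phi> (p *\<^sub>v u)" unfolding poly_as_sum_of_monoms ..
  finally show ?thesis .
qed

end

section \<open>Replacing the action on a presented module\<close>

definition realizes :: "rat \<Rightarrow> 'v svir_module \<Rightarrow> (poly2 \<Rightarrow> 'v) \<Rightarrow> (svir_basis \<Rightarrow> poly2 \<Rightarrow> poly2) \<Rightarrow> bool" where
  "realizes \<epsilon> M \<Phi> T \<longleftrightarrow> (\<forall>x\<in>svir \<epsilon>. \<forall>u. act M x (\<Phi> u) = \<Phi> (lin_ext T x u))"

text \<open>Space, scalar multiplication and grading are kept, so that one function can be a
  morphism before and after the change. The new action is defined on all symbols and thus for both
  algebras.\<close>

definition with_action ::
    "'v svir_module \<Rightarrow> (poly2 \<Rightarrow> 'v) \<Rightarrow> (svir_basis \<Rightarrow> poly2 \<Rightarrow> poly2) \<Rightarrow> 'v svir_module" where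
  "with_action M \<Phi> T = M\<lparr>act := \<lambda>x v. \<Phi> (lin_ext T x (inv_into UNIV \<Phi> v))\<rparr>"

lemma with_action_simps [simp]:
  "carrier (with_action M \<Phi> T) = carrier M" "zero (with_action M \<Phi> T) = zero M"
  "add (with_action M \<Phi> T) = add M" "smult (with_action M \<Phi> T) = smult M"
  "part (with_action M \<Phi> T) = part M"
  by (simp_all add: with_action_def)

text \<open>Lets group axioms pass between records that differ in other fields, such as a module and
  its restriction to another scalar ring.\<close>

lemma abelian_group_transfer:
  assumes "carrier A = carrier B" "add A = add B" "zero A = zero B" "abelian_group B"
  shows "abelian_group A"
proof -
  interpret B: abelian_group B by fact
  show ?thesis
    by (rule abelian_groupI) (auto simp: assms(1-3) B.a_ac intro: B.l_neg)
qed

lemma module_transfer: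
  assumes "carrier A = carrier B" "add A = add B" "zero A = zero B" "smult A = smult B" "module R B"
  shows "module R A"
  using assms abelian_group_transfer[of A B] by (simp add: module_def module_axioms_def)

lemma submodule_transfer:
  fixes A B :: "('c, 'v, 'm) module_scheme"
  assumes "carrier A = carrier B" "add A = add B" "zero A = zero B" "smult A = smult B" "submodule H R B"
  shows "submodule H R A"
  using assms by (simp add: submodule_def submodule_axioms_def)

context presentation
begin

lemma presentation_with_action: "presentation (with_action M \<Phi> T) i \<Phi>"
proof -
  have "module complex_ring (with_action M \<Phi> T)"
    by (rule module_transfer[OF _ _ _ _ module]) simp_all
  then show ?thesis
    by (rule presentation.intro) (simp_all only: with_action_simps bij \<Phi>_add \<Phi>_smult part_eq)
qed

lemma realizes_with_action: "realizes \<epsilon> (with_action M \<Phi> T) \<Phi> T"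
  by (simp add: realizes_def with_action_def flip: coords_def)

lemma svir_supermodule_with_action:
  assumes sup: "svir_supermodule \<delta> M" and rep: "svir_rep \<epsilon> T" and gr: "graded \<epsilon> T"
  shows "svir_supermodule \<epsilon> (with_action M \<Phi> T)"
proof -
  let ?N = "with_action M \<Phi> T"
  interpret N: presentation ?N i \<Phi> by (rule presentation_with_action)
  have lin: "clinear (lin_ext T x)" for x
    by (rule clinear_lin_ext) (use rep in \<open>simp add: svir_rep_def\<close>)
  have act: "act ?N x (\<Phi> u) = \<Phi> (lin_ext T x u)" for x u
    by (simp add: with_action_def flip: coords_def)
  show ?thesis
  proof (intro svir_supermodule.intro N.module svir_supermodule_axioms.intro)
    show "submodule (part ?N j) complex_ring ?N" for j
      using submodule_transfer[OF _ _ _ _ svir_supermodule.part_submodule[OF sup], of ?N j] by simp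
    show "\<exists>!p. p \<in> part ?N 0 \<times> part ?N 1 \<and> v = fst p \<oplus>\<^bsub>?N\<^esub> snd p" if "v \<in> carrier ?N" for v
      using svir_supermodule.part_direct_sum[OF sup] that by simp
    fix x y v w and c :: complex
    show "act ?N x v \<in> carrier ?N" if "v \<in> carrier ?N"
      using that by (elim N.carrier_cases) (simp only: act N.\<Phi>_closed)
    show "act ?N (x + y) v = act ?N x v \<oplus>\<^bsub>?N\<^esub> act ?N y v" if "v \<in> carrier ?N"
      using that by (elim N.carrier_cases) (simp only: act lin_ext_add N.\<Phi>_add)
    show "act ?N (scale c x) v = c \<odot>\<^bsub>?N\<^esub> act ?N x v" if "v \<in> carrier ?N"
      using that by (elim N.carrier_cases) (simp only: act lin_ext_scale N.\<Phi>_smult)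
    show "act ?N x (v \<oplus>\<^bsub>?N\<^esub> w) = act ?N x v \<oplus>\<^bsub>?N\<^esub> act ?N x w" if "v \<in> carrier ?N" "w \<in> carrier ?N"
      using that by (elim N.carrier_cases) (simp only: act clinearD(1)[OF lin] N.\<Phi>_add[symmetric])
    show "act ?N x (c \<odot>\<^bsub>?N\<^esub> v) = c \<odot>\<^bsub>?N\<^esub> act ?N x v" if "v \<in> carrier ?N"
      using that by (elim N.carrier_cases) (simp only: act clinearD(2)[OF lin] N.\<Phi>_smult[symmetric])
    show "act ?N x v \<in> part ?N (j + k)" if x: "x \<in> svir_part \<epsilon> j" and v: "v \<in> part ?N k" for j k
    proof -
      \<comment> \<open>The presentation describes parts by parity relative to \<open>i\<close>, and
        \<open>k\<close> has relative parity \<open>i + k\<close> because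
        \<open>i + i = 0\<close>.\<close>
      have "v \<in> part ?N (i + (i + k))" using v by (simp only: bit_add_self)
      then have "v \<in> \<Phi> ` graded_part (i + k)" by (simp only: N.part_eq)
      then obtain u where u: "u \<in> graded_part (i + k)" "v = \<Phi> u" by blast
      have "act ?N x v \<in> part ?N (i + (j + (i + k)))"
        unfolding u(2) act N.part_eq using graded_part_lin_ext[OF gr x u(1)] by (rule imageI)
      moreover have "i + (j + (i + k)) = j + k" by (metis add.left_commute bit_add_self)
      ultimately show ?thesis by (simp only:)
    qed
    show "act ?N (svir_bracket x y) v =
      (if j = 1 \<and> k = 1 then act ?N x (act ?N y v) \<oplus>\<^bsub>?N\<^esub> act ?N y (act ?N x v)
       else act ?N x (act ?N y v) \<ominus>\<^bsub>?N\<^esub> act ?N y (act ?N x v))"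
      if x: "x \<in> svir_part \<epsilon> j" and y: "y \<in> svir_part \<epsilon> k" and v: "v \<in> carrier ?N" for j k
      using v by (elim N.carrier_cases)
        (simp only: act svir_rep_bracket[OF rep x y] N.\<Phi>_add N.\<Phi>_diff split: if_split, simp)
  qed
qed

end

section \<open>Freeness of modules with a model action\<close>

lemma with_scalars_simps [simp]:
  "carrier (with_scalars s M) = carrier M" "zero (with_scalars s M) = zero M"
  "add (with_scalars s M) = add M" "smult (with_scalars s M) = s"
  by (simp_all add: with_scalars_def)

lemma Lvec_in_svir: "Lvec m \<in> svir \<epsilon>" "Lvec m \<in> svir_part \<epsilon> 0"
  by (auto simp: svir_def svir_part_def svir_index_0)

lemma Gvec_in_svir:
  "even (j - e) \<Longrightarrow> Gvec (of_int j / 2) \<in> svir (of_int e / 2)"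
  "even (j - e) \<Longrightarrow> Gvec (of_int j / 2) \<in> svir_part (of_int e / 2) 1"
  by (auto simp: svir_def svir_part_def svir_index_1)

lemma Gvec_0_in_svir: "Gvec 0 \<in> svir 0" "Gvec 0 \<in> svir_part 0 1"
  using Gvec_in_svir[of 0 0] by simp_all

context presentation
begin

lemma act_HH_model:
  assumes "realizes \<epsilon> M \<Phi> (model \<mu> \<alpha>)"
  shows "act_HH M p (\<Phi> u) = \<Phi> (p *\<^sub>v u)"
proof (rule act_HH_\<Phi>)
  fix u show "act M (Lvec 0) (\<Phi> u) = \<Phi> ([:0, 1:] *\<^sub>v u)"
    using assms Lvec_in_svir(1) by (cases u) (simp add: realizes_def)
qed

text \<open>\<open>G\<^sub>0\<close> sends \<open>(f, g)\<close> to \<open>(x g, f)\<close>, so the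
  outcome is the product of \<open>(p, q)\<close> and \<open>(f, g)\<close> in \<open>U_hh\<close>:
  in coordinates the restriction is the regular module.\<close>

lemma act_hh_model:
  assumes "realizes 0 M \<Phi> (model \<mu> \<alpha>)"
  shows "act_hh M (p, q) (\<Phi> (f, g)) = \<Phi> (p * f + [:0, 1:] * q * g, p * g + q * f)"
proof -
  have "act M (Gvec 0) (\<Phi> (f, g)) = \<Phi> ([:0, 1:] * g, f)" for f g
    using assms Gvec_0_in_svir(1) model_G_half[of \<mu> \<alpha> 0 f g] by (simp add: realizes_def)
  then show ?thesis
    by (simp add: act_hh_def act_HH_model[OF assms] mult.assoc flip: \<Phi>_add)
qed

lemma module_basis_HH:
  assumes T: "realizes \<epsilon> M \<Phi> (model \<mu> \<alpha>)"
  shows "module_basis U_HH (restrict_HH M) {\<Phi> (1, 0), \<Phi> (0, 1)}"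
proof (subst module_basis_pair_iff, simp, intro conjI)
  let ?N = "restrict_HH M"
  have N: "abelian_group ?N"
    by (rule abelian_group_transfer[OF _ _ _ M.abelian_group_axioms]) (simp_all add: restrict_HH_def)
  show "module U_HH ?N"
  proof (rule moduleI[OF _ N])
    show "cring U_HH" unfolding U_HH_def by (rule cring_ring_of)
  qed (auto elim!: carrier_cases simp: U_HH_def restrict_HH_def act_HH_model[OF T] pscale_distrib distrib_left distrib_right simp flip: \<Phi>_add)
  have "(\<lambda>(p, q). p \<odot>\<^bsub>?N\<^esub> \<Phi> (1, 0) \<oplus>\<^bsub>?N\<^esub> q \<odot>\<^bsub>?N\<^esub> \<Phi> (0, 1)) = \<Phi>"
    by (simp add: fun_eq_iff restrict_HH_def act_HH_model[OF T] flip: \<Phi>_add)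
  then show "bij_betw (\<lambda>(p, q). p \<odot>\<^bsub>?N\<^esub> \<Phi> (1, 0) \<oplus>\<^bsub>?N\<^esub> q \<odot>\<^bsub>?N\<^esub> \<Phi> (0, 1))
      (carrier U_HH \<times> carrier U_HH) (carrier ?N)"
    using bij by (simp add: U_HH_def restrict_HH_def)
qed (simp_all add: restrict_HH_def)

text \<open>The pair \<open>(1, 0)\<close> is the unit of \<open>U_hh\<close>, so the map sending a
  scalar to its multiple of \<open>\<Phi> (1, 0)\<close> is \<open>\<Phi>\<close> itself.\<close>

lemma module_basis_hh:
  assumes T: "realizes 0 M \<Phi> (model \<mu> \<alpha>)"
  shows "module_basis U_hh (restrict_hh M) {\<Phi> (1, 0)}"
proof (subst module_basis_single_iff, intro conjI)
  let ?N = "restrict_hh M"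
  have N: "abelian_group ?N"
    by (rule abelian_group_transfer[OF _ _ _ M.abelian_group_axioms]) (simp_all add: restrict_hh_def)
  show "module U_hh ?N"
  proof (rule moduleI[OF _ N])
    show "cring U_hh" by (rule cring_U_hh)
  qed (auto elim!: carrier_cases simp: split_paired_all restrict_hh_def act_hh_model[OF T] algebra_simps
      simp flip: \<Phi>_add)
  have "(\<lambda>p. p \<odot>\<^bsub>?N\<^esub> \<Phi> (1, 0)) = \<Phi>"
    by (simp add: fun_eq_iff restrict_hh_def act_hh_model[OF T])
  then show "bij_betw (\<lambda>p. p \<odot>\<^bsub>?N\<^esub> \<Phi> (1, 0)) (carrier U_hh) (carrier ?N)"
    using bij by (simp add: restrict_hh_def)
qed (simp_all add: restrict_hh_def)

lemma model_in_ramond_rank1: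
  assumes "svir_supermodule 0 M" "realizes 0 M \<Phi> (model \<mu> \<alpha>)"
  shows "M \<in> Obj ramond_rank1"
  using assms module_basis_hh[OF assms(2)]
  by (auto simp: ramond_rank1_def svir_full_subcategory_def intro!: exI[of _ "{\<Phi> (1, 0)}"])

lemma model_in_neveu_schwarz_rank2:
  assumes "svir_supermodule (1 / 2) M" "realizes (1 / 2) M \<Phi> (model \<mu> \<alpha>)"
  shows "M \<in> Obj neveu_schwarz_rank2"
proof -
  have "\<Phi> (1, 0) \<in> part M (i + 0)" "\<Phi> (0, 1) \<in> part M (i + 1)"
    unfolding part_eq by (auto simp: graded_part_def)
  then have "{\<Phi> (1, 0), \<Phi> (0, 1)} \<subseteq> part M 0 \<union> part M 1"
    using bit_cases[of i] by auto
  moreover have "card {\<Phi> (1, 0), \<Phi> (0, 1)} = 2" by simp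
  ultimately show ?thesis
    using assms(1) module_basis_HH[OF assms(2)]
    unfolding neveu_schwarz_rank2_def svir_full_subcategory_def by auto
qed

end

section \<open>Normal form of a module\<close>

lemma poly_mapping_eq_sum_single:
  "x = (\<Sum>k\<in>Poly_Mapping.keys x. Poly_Mapping.single k (Poly_Mapping.lookup x k))"
  by (rule poly_mapping_eqI)
    (auto simp: lookup_sum lookup_single when_def in_keys_iff)

lemma svir_bracket_single:
  "svir_bracket (Poly_Mapping.single k 1) (Poly_Mapping.single l 1) = basis_bracket k l"
proof -
  have "scale 1 x = x" for x by (rule poly_mapping_eqI) simp
  then show ?thesis by (simp add: svir_bracket_def)
qed

text \<open>\<open>T\<close> turns x into x + c on coefficients; constants commute with
  \<open>T\<close>, and induction over the coefficients of \<open>f\<close> does the rest.\<close>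

lemma semilinear:
  assumes T: "clinear T" and X: "\<And>u. T ([:0, 1:] *\<^sub>v u) = [:c, 1:] *\<^sub>v T u"
  shows "T (f *\<^sub>v u) = shift c f *\<^sub>v T u"
proof (induction f)
  case (pCons d f)
  have f: "pCons d f = [:d:] + [:0, 1:] * f" by simp
  have "T (pCons d f *\<^sub>v u) = T ([:d:] *\<^sub>v u) + T ([:0, 1:] *\<^sub>v f *\<^sub>v u)"
    unfolding f pscale_distrib(2) clinearD(1)[OF T] by simp
  also have "\<dots> = [:d:] *\<^sub>v T u + [:c, 1:] *\<^sub>v shift c f *\<^sub>v T u"
    unfolding X clinearD(2)[OF T] pCons ..
  also have "\<dots> = shift c (pCons d f) *\<^sub>v T u"
    unfolding shift_pCons pscale_distrib(2) by simp
  finally show ?case .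
qed (simp add: clinearD(3)[OF T])

context svir_supermodule
begin

lemma act_zero_left: "v \<in> carrier M \<Longrightarrow> act M 0 v = \<zero>\<^bsub>M\<^esub>"
proof -
  assume v: "v \<in> carrier M"
  have "scale 0 0 = 0" by (rule poly_mapping_eqI) simp
  then have "act M 0 v = 0 \<odot>\<^bsub>M\<^esub> act M 0 v"
    using act_scale_left[of 0 v 0] v by (simp add: svir_def)
  then show ?thesis using v act_closed[of 0 v] smult_l_null by (simp add: svir_def)
qed

lemma act_zero_right:
  assumes "x \<in> svir \<epsilon>"
  shows "act M x \<zero>\<^bsub>M\<^esub> = \<zero>\<^bsub>M\<^esub>"
proof -
  have "act M x \<zero>\<^bsub>M\<^esub> = act M x (0 \<odot>\<^bsub>M\<^esub> \<zero>\<^bsub>M\<^esub>)" using smult_r_null[of 0] by simp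
  also have "\<dots> = 0 \<odot>\<^bsub>M\<^esub> act M x \<zero>\<^bsub>M\<^esub>" by (rule act_scale_right) (use assms in auto)
  also have "\<dots> = \<zero>\<^bsub>M\<^esub>" using smult_l_null act_closed[OF assms] by simp
  finally show ?thesis .
qed

lemma act_single:
  assumes "k \<in> svir_index \<epsilon> j" "v \<in> carrier M"
  shows "act M (Poly_Mapping.single k c) v = c \<odot>\<^bsub>M\<^esub> act M (Poly_Mapping.single k 1) v"
proof -
  have "Poly_Mapping.single k 1 \<in> svir \<epsilon>" using assms(1) bit_cases[of j] by (auto simp: svir_def)
  then show ?thesis using act_scale_left[of "Poly_Mapping.single k 1" v c] assms(2) by simp
qed

lemma part_carrier: "v \<in> part M i \<Longrightarrow> v \<in> carrier M"
  using submoduleE(1)[OF part_submodule] by blast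

lemma part_closed:
  "\<lbrakk>v \<in> part M i; w \<in> part M i\<rbrakk> \<Longrightarrow> v \<oplus>\<^bsub>M\<^esub> w \<in> part M i"
  "v \<in> part M i \<Longrightarrow> c \<odot>\<^bsub>M\<^esub> v \<in> part M i" "\<zero>\<^bsub>M\<^esub> \<in> part M i"
proof -
  show "\<lbrakk>v \<in> part M i; w \<in> part M i\<rbrakk> \<Longrightarrow> v \<oplus>\<^bsub>M\<^esub> w \<in> part M i"
    using submoduleE(5)[OF part_submodule] .
  show *: "v \<in> part M i \<Longrightarrow> c \<odot>\<^bsub>M\<^esub> v \<in> part M i" for c v
    using submoduleE(4)[OF part_submodule] by simp
  obtain v where "v \<in> part M i" using submoduleE(2)[OF part_submodule] by blast
  then show "\<zero>\<^bsub>M\<^esub> \<in> part M i" using *[of v 0] smult_l_null[OF part_carrier] by simp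
qed

lemma part_direct_sumD:
  assumes "v \<in> part M i" "v' \<in> part M i" "w \<in> part M (i + 1)" "w' \<in> part M (i + 1)"
    and eq: "v \<oplus>\<^bsub>M\<^esub> w = v' \<oplus>\<^bsub>M\<^esub> w'"
  shows "v = v'" "w = w'"
proof -
  have c: "v \<in> carrier M" "v' \<in> carrier M" "w \<in> carrier M" "w' \<in> carrier M"
    using assms part_carrier by blast+
  have 1: "\<exists>!p. p \<in> part M 0 \<times> part M 1 \<and> v \<oplus>\<^bsub>M\<^esub> w = fst p \<oplus>\<^bsub>M\<^esub> snd p"
    by (rule part_direct_sum) (use c in auto)
  have uniq: "p = q" if "p \<in> part M 0 \<times> part M 1" "v \<oplus>\<^bsub>M\<^esub> w = fst p \<oplus>\<^bsub>M\<^esub> snd p"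
    "q \<in> part M 0 \<times> part M 1" "v \<oplus>\<^bsub>M\<^esub> w = fst q \<oplus>\<^bsub>M\<^esub> snd q" for p q
    using the1_equality[OF 1 conjI[OF that(1,2)]] the1_equality[OF 1 conjI[OF that(3,4)]]
    by (rule trans[OF sym])
  have "v = v' \<and> w = w'"
    using bit_cases[of i]
  proof
    assume "i = 0"
    then have "(v, w) = (v', w')"
      by (intro uniq) (use assms(1-4) in \<open>simp_all add: eq\<close>)
    then show ?thesis by simp
  next
    assume i: "i = 1"
    have "v \<oplus>\<^bsub>M\<^esub> w = w \<oplus>\<^bsub>M\<^esub> v" "v' \<oplus>\<^bsub>M\<^esub> w' = w' \<oplus>\<^bsub>M\<^esub> v'" using c by (simp_all add: M.a_comm)
    then have "(w, v) = (w', v')"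
      by (intro uniq) (use assms(1-4) i in \<open>simp_all add: eq[symmetric]\<close>)
    then show ?thesis by simp
  qed
  then show "v = v'" "w = w'" by simp_all
qed

lemma realizesI:
  assumes P: "presentation M i \<Phi>"
    and T: "\<And>j k u. k \<in> svir_index \<epsilon> j \<Longrightarrow> act M (Poly_Mapping.single k 1) (\<Phi> u) = \<Phi> (T k u)"
  shows "realizes \<epsilon> M \<Phi> T"
  unfolding realizes_def
proof (intro ballI allI)
  fix x u assume x: "x \<in> svir \<epsilon>"
  interpret P: presentation M i \<Phi> by fact
  let ?l = "Poly_Mapping.lookup x" and ?I = "svir_index \<epsilon> 0 \<union> svir_index \<epsilon> 1"
  \<comment> \<open>Membership of the partial sums in \<open>svir\<close> is carried along because
    additivity of the action is available only there.\<close>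
  have "act M (\<Sum>k\<in>S. Poly_Mapping.single k (?l k)) (\<Phi> u) = \<Phi> (\<Sum>k\<in>S. [:?l k:] *\<^sub>v T k u)
    \<and> (\<Sum>k\<in>S. Poly_Mapping.single k (?l k)) \<in> svir \<epsilon>"
    if "finite S" "S \<subseteq> ?I" for S
    using that
  proof (induction S rule: finite_induct)
    case empty
    then show ?case by (simp add: act_zero_left P.\<Phi>_zero svir_def)
  next
    case (insert k S)
    then obtain j where k: "k \<in> svir_index \<epsilon> j" by blast
    have s: "Poly_Mapping.single k (?l k) \<in> svir \<epsilon>" using k bit_cases[of j] by (auto simp: svir_def)
    have IH: "act M (\<Sum>k\<in>S. Poly_Mapping.single k (?l k)) (\<Phi> u) = \<Phi> (\<Sum>k\<in>S. [:?l k:] *\<^sub>v T k u)"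
      "(\<Sum>k\<in>S. Poly_Mapping.single k (?l k)) \<in> svir \<epsilon>"
      using insert.IH insert.prems by (simp_all only: insert_subset)
    have "Poly_Mapping.keys (Poly_Mapping.single k (?l k) + (\<Sum>k\<in>S. Poly_Mapping.single k (?l k))) \<subseteq> ?I"
      using Poly_Mapping.keys_add[of "Poly_Mapping.single k (?l k)"] s IH(2) unfolding svir_def by blast
    moreover have "act M (Poly_Mapping.single k (?l k) + (\<Sum>k\<in>S. Poly_Mapping.single k (?l k))) (\<Phi> u)
      = \<Phi> ([:?l k:] *\<^sub>v T k u + (\<Sum>k\<in>S. [:?l k:] *\<^sub>v T k u))"
      by (simp only: act_add_left[OF s IH(2) P.\<Phi>_closed] IH(1) act_single[OF k P.\<Phi>_closed, where c = "?l k"] T[OF k]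
          P.\<Phi>_add P.\<Phi>_smult)
    ultimately show ?case
      unfolding sum.insert[OF insert(1,2)] by (simp only: svir_def mem_Collect_eq simp_thms)
  qed
  from this[of "Poly_Mapping.keys x", THEN conjunct1] show "act M x (\<Phi> u) = \<Phi> (lin_ext T x u)"
    using x unfolding lin_ext_def poly_mapping_eq_sum_single[of x, symmetric] svir_def by simp
qed

end

section \<open>Extraction of the structure polynomials\<close>

context presentation
begin

text \<open>Change of basis, applied with \<open>d = 0\<close> to rescale \<open>w\<close> and with
  \<open>d = 1\<close> to exchange \<open>v\<close> and \<open>w\<close>.\<close>

lemma presentation_comp:
  assumes "bij \<psi>" "clinear \<psi>" "\<And>j. \<psi> ` graded_part j = graded_part (d + j)"
  shows "presentation M (i + d) (\<Phi> \<circ> \<psi>)"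
proof (rule presentation.intro)
  show "bij_betw (\<Phi> \<circ> \<psi>) UNIV (carrier M)" using assms(1) bij by (rule bij_betw_trans)
  show "part M (i + d + j) = (\<Phi> \<circ> \<psi>) ` graded_part j" for j
    using part_eq[of "d + j"] assms(3) by (simp only: image_comp[symmetric] add.assoc)
qed (simp_all only: module o_apply clinearD[OF assms(2)] \<Phi>_add \<Phi>_smult)

end

text \<open>A homogeneous basis over \<open>\<complex>[L\<^sub>0]\<close> in which only
  \<open>L\<^sub>0\<close> is known in advance; all other operators are read off in
  coordinates.\<close>

locale presented_supermodule = presentation M i \<Phi> + S: svir_supermodule "of_int e / 2" M
  for M :: "'v svir_module" and i \<Phi> and e :: int +
  assumes e: "e = 0 \<or> e = 1"
    and act_L0: "act M (Lvec 0) (\<Phi> u) = \<Phi> ([:0, 1:] *\<^sub>v u)"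
begin

definition T :: "svir_basis \<Rightarrow> poly2 \<Rightarrow> poly2" where
  "T k u = coords (act M (Poly_Mapping.single k 1) (\<Phi> u))"

lemma single_in_svir:
  "k \<in> svir_index (of_int e / 2) j \<Longrightarrow> Poly_Mapping.single k 1 \<in> svir (of_int e / 2)"
  "k \<in> svir_index (of_int e / 2) j \<Longrightarrow> Poly_Mapping.single k 1 \<in> svir_part (of_int e / 2) j"
  using bit_cases[of j] by (auto simp: svir_def svir_part_def)

lemma act_eq: "k \<in> svir_index (of_int e / 2) j \<Longrightarrow> act M (Poly_Mapping.single k 1) (\<Phi> u) = \<Phi> (T k u)"
  using S.act_closed[OF single_in_svir(1) \<Phi>_closed] by (simp add: T_def)

lemma clinear_T:
  assumes k: "k \<in> svir_index (of_int e / 2) j"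
  shows "clinear (T k)"
  unfolding clinear_def
proof (intro conjI allI)
  note s = single_in_svir(1)[OF k]
  show "T k (u + v) = T k u + T k v" for u v
    using S.act_add_right[OF s \<Phi>_closed \<Phi>_closed, of u v]
    by (simp only: \<Phi>_add[symmetric] act_eq[OF k] \<Phi>_inject)
  show "T k ([:c:] *\<^sub>v u) = [:c:] *\<^sub>v T k u" for c u
    using S.act_scale_right[OF s \<Phi>_closed, of c u]
    by (simp only: \<Phi>_smult[symmetric] act_eq[OF k] \<Phi>_inject)
qed

lemma graded_T:
  assumes k: "k \<in> svir_index (of_int e / 2) j" and u: "u \<in> graded_part l"
  shows "T k u \<in> graded_part (j + l)"
proof -
  have "\<Phi> u \<in> part M (i + l)" unfolding part_eq using u by (rule imageI)
  from S.act_part[OF single_in_svir(2)[OF k] this] have "\<Phi> (T k u) \<in> part M (j + (i + l))"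
    by (simp only: act_eq[OF k])
  then have "\<Phi> (T k u) \<in> part M (i + (j + l))" by (simp only: add.left_commute)
  then show ?thesis unfolding part_eq using inj_\<Phi> by (simp only: inj_image_mem_iff)
qed

lemma bracket_T:
  assumes k: "k \<in> svir_index (of_int e / 2) j" and l: "l \<in> svir_index (of_int e / 2) j'"
    and b: "basis_bracket k l = Poly_Mapping.single n c" and n: "n \<in> svir_index (of_int e / 2) j''"
  shows "[:c:] *\<^sub>v T n u = (if j = 1 \<and> j' = 1 then T k (T l u) + T l (T k u) else T k (T l u) - T l (T k u))"
proof -
  have "act M (basis_bracket k l) (\<Phi> u) = \<Phi> ([:c:] *\<^sub>v T n u)"
    unfolding b by (simp only: S.act_single[OF n \<Phi>_closed, where c = c] act_eq[OF n] \<Phi>_smult)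
  then have "\<Phi> ([:c:] *\<^sub>v T n u) =
    \<Phi> (if j = 1 \<and> j' = 1 then T k (T l u) + T l (T k u) else T k (T l u) - T l (T k u))"
    using S.act_bracket[OF single_in_svir(2)[OF k] single_in_svir(2)[OF l] \<Phi>_closed, of u]
    unfolding svir_bracket_single
    by (simp only: act_eq[OF k] act_eq[OF l] \<Phi>_add \<Phi>_diff if_distrib[of \<Phi>])
  then show ?thesis by (simp only: \<Phi>_inject)
qed

lemma L_index: "L m \<in> svir_index (of_int e / 2) 0"
  by (simp add: svir_index_0)

lemma G_index: "even (j - e) \<Longrightarrow> G (of_int j / 2) \<in> svir_index (of_int e / 2) 1"
  by (auto simp: svir_index_1)

lemma T_L0: "T (L 0) u = [:0, 1:] *\<^sub>v u"
  using act_L0[of u] act_eq[OF L_index[of 0], of u] by simp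

lemma T_LL: "[:of_int (m - n):] *\<^sub>v T (L (m + n)) u = T (L m) (T (L n) u) - T (L n) (T (L m) u)"
  using bracket_T[OF L_index[of m] L_index[of n] basis_bracket.simps(1) L_index] by simp

lemma T_LG:
  assumes j: "even (j - e)"
  shows "[:of_int (m - j) / 2:] *\<^sub>v T (G (of_int (j + 2 * m) / 2)) u
    = T (L m) (T (G (of_int j / 2)) u) - T (G (of_int j / 2)) (T (L m) u)"
proof -
  have r: "of_int m + of_int j / 2 = (of_int (j + 2 * m) / 2 :: rat)"
    by (simp add: add_divide_distrib)
  have c: "(of_rat (of_int m / 2 - of_int j / 2) :: complex) = of_int (m - j) / 2"
    by (simp add: of_rat_diff of_rat_divide diff_divide_distrib)
  have "basis_bracket (L m) (G (of_int j / 2))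
      = Poly_Mapping.single (G (of_int (j + 2 * m) / 2)) (of_int (m - j) / 2)"
    by (simp only: basis_bracket.simps r c)
  moreover have "even (j + 2 * m - e)" using j by presburger
  ultimately show ?thesis
    using bracket_T[OF L_index[of m] G_index[OF j] _ G_index[of "j + 2 * m"], of "of_int (m - j) / 2" u]
    by (simp only: zero_neq_one simp_thms if_False)
qed

lemma T_GG:
  assumes j: "even (j - e)" and k: "even (k - e)"
  shows "[:2:] *\<^sub>v T (L ((j + k) div 2)) u
    = T (G (of_int j / 2)) (T (G (of_int k / 2)) u) + T (G (of_int k / 2)) (T (G (of_int j / 2)) u)"
proof -
  have "even (j + k)" using j k by presburger
  from floor_half_add_half[OF this] have "basis_bracket (G (of_int j / 2)) (G (of_int k / 2))
      = Poly_Mapping.single (L ((j + k) div 2)) 2"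
    by (simp only: basis_bracket.simps)
  from bracket_T[OF G_index[OF j] G_index[OF k] this L_index, of u] show ?thesis by simp
qed

text \<open>One component each suffices: by parity \<open>L\<^sub>m\<close> preserves the lines of
  \<open>v\<close> and \<open>w\<close> over \<open>\<complex>[L\<^sub>0]\<close>, and
  \<open>G\<^sub>r\<close> exchanges them.\<close>

definition "a m = fst (T (L m) (1, 0))"
definition "b m = snd (T (L m) (0, 1))"
definition "g j = snd (T (G (of_int j / 2)) (1, 0))"
definition "h j = fst (T (G (of_int j / 2)) (0, 1))"

lemma graded_part_1_0: "(p, 0) \<in> graded_part 0" "(0, q) \<in> graded_part 1"
  by (simp_all add: graded_part_def)

lemma pair_eq: "(p, q) = p *\<^sub>v (1, 0) + q *\<^sub>v (0, 1)"
  by simp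

text \<open>\<open>[L\<^sub>m, L\<^sub>0] = m L\<^sub>m\<close> makes the operator semilinear for
  the shift by \<open>m\<close>, so its values on the two basis vectors determine it.\<close>

lemma T_L: "T (L m) (p, q) = (shift (of_int m) p * a m, shift (of_int m) q * b m)"
proof -
  note lin = clinear_T[OF L_index[of m]]
  have "T (L m) ([:0, 1:] *\<^sub>v u) = [:of_int m, 1:] *\<^sub>v T (L m) u" for u
  proof -
    have "T (L m) ([:0, 1:] *\<^sub>v u) = [:of_int m:] *\<^sub>v T (L m) u + [:0, 1:] *\<^sub>v T (L m) u"
      using T_LL[of m 0 u] by (simp add: T_L0 diff_eq_eq)
    then show ?thesis by (simp flip: pscale_distrib(2))
  qed
  note semi = semilinear[OF lin this]
  have "T (L m) (1, 0) = (a m, 0)" "T (L m) (0, 1) = (0, b m)"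
    using graded_T[OF L_index[of m] graded_part_1_0(1)[of 1]] graded_T[OF L_index[of m] graded_part_1_0(2)[of 1]]
    by (simp_all add: a_def b_def graded_part_def prod_eq_iff)
  then show ?thesis
    by (subst pair_eq) (simp only: clinearD(1)[OF lin] semi, simp)
qed

lemma T_G:
  assumes j: "even (j - e)"
  shows "T (G (of_int j / 2)) (p, q) = (shift (of_int j / 2) q * h j, shift (of_int j / 2) p * g j)"
proof -
  let ?T = "T (G (of_int j / 2))"
  note lin = clinear_T[OF G_index[OF j]]
  have "?T ([:0, 1:] *\<^sub>v u) = [:of_int j / 2, 1:] *\<^sub>v ?T u" for u
  proof -
    have "[:0, 1:] *\<^sub>v ?T u - [:- of_int j / 2:] *\<^sub>v ?T u = ?T ([:0, 1:] *\<^sub>v u)"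
      using T_LG[OF j, of 0 u] by (simp add: T_L0)
    moreover have "[:0, 1:] *\<^sub>v ?T u - [:- of_int j / 2:] *\<^sub>v ?T u = [:of_int j / 2, 1:] *\<^sub>v ?T u"
      by (simp add: pscale_def)
    ultimately show ?thesis by simp
  qed
  note semi = semilinear[OF lin this]
  have "?T (1, 0) = (0, g j)" "?T (0, 1) = (h j, 0)"
    using graded_T[OF G_index[OF j] graded_part_1_0(1)[of 1]] graded_T[OF G_index[OF j] graded_part_1_0(2)[of 1]]
    by (simp_all add: g_def h_def graded_part_def prod_eq_iff)
  then show ?thesis
    by (subst pair_eq) (simp only: clinearD(1)[OF lin] semi, simp)
qed

text \<open>Each relation is a component of a bracket relation evaluated at \<open>(1, 0)\<close> or
  \<open>(0, 1)\<close>.\<close>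

lemma svir_coeffs: "svir_coeffs e a b g h"
proof
  show "e = 0 \<or> e = 1" by (rule e)
  show "shift (of_int j / 2) (g k) * h j + shift (of_int k / 2) (g j) * h k = 2 * a ((j + k) div 2)"
    "shift (of_int j / 2) (h k) * g j + shift (of_int k / 2) (h j) * g k = 2 * b ((j + k) div 2)"
    if jk: "even (j - e)" "even (k - e)" for j k
    using T_GG[OF jk, of "(1, 0)"] T_GG[OF jk, of "(0, 1)"]
    by (simp_all add: T_L T_G[OF jk(1)] T_G[OF jk(2)] numeral_poly)
  show "shift (of_int m) (g j) * b m - shift (of_int j / 2) (a m) * g j = [:of_int (m - j) / 2:] * g (j + 2 * m)"
    if j: "even (j - e)" for j m
  proof -
    have j': "even (j + 2 * m - e)" using j by presburger
    show ?thesis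
      using T_LG[OF j, of m "(1, 0)"] unfolding T_L T_G[OF j] T_G[OF j'] by simp
  qed
  have a0: "a 0 = [:0, 1:]" "b 0 = [:0, 1:]" using T_L0 by (simp_all add: a_def b_def)
  then show "a 0 = [:0, 1:]" "b 0 = [:0, 1:]" .
  show "shift (of_int m) (a (- m)) * a m - shift (- of_int m) (a m) * a (- m) = [:0, of_int (2 * m):]" for m
    using T_LL[of m "- m" "(1, 0)"] by (simp add: T_L a0)
qed

lemma normalize:
  assumes g: "\<And>j. even (j - e) \<Longrightarrow> degree (g j) = 0"
  shows "\<exists>\<Psi> \<mu> \<alpha>. presentation M i \<Psi> \<and> realizes (of_int e / 2) M \<Psi> (model \<mu> \<alpha>) \<and> \<mu> \<noteq> 0 \<and> csqrt (\<mu>\<^sup>2) = \<mu>"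
proof -
  interpret C: svir_coeffs_normalized e a b g h
    using svir_coeffs g by (simp add: svir_coeffs_normalized_def svir_coeffs_normalized_axioms_def)
  obtain c \<mu> \<alpha> where c: "c \<noteq> 0" and \<mu>: "\<mu> \<noteq> 0" "csqrt (\<mu>\<^sup>2) = \<mu>"
    and gj: "\<And>j. even (j - e) \<Longrightarrow> g j = [:c * \<mu> powi j:]"
    and hj: "\<And>j. even (j - e) \<Longrightarrow> h j = [:of_int j * \<alpha> * \<mu> powi j / c, \<mu> powi j / c:]"
    and am: "\<And>m. a m = [:\<mu> powi (2 * m):] * [:of_int m * \<alpha>, 1:]"
    and bm: "\<And>m. b m = [:\<mu> powi (2 * m):] * [:of_int m * (\<alpha> + 1 / 2), 1:]"
    using C.normal_form by blast
  \<comment> \<open>Composition with \<open>\<psi>\<close> replaces \<open>w\<close> by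
    \<open>c w\<close>, which absorbs the factor \<open>c\<close> in \<open>g j\<close> and
    \<open>h j\<close>.\<close>
  define \<psi> :: "poly2 \<Rightarrow> poly2" where "\<psi> = (\<lambda>(p, q). (p, [:c:] * q))"
  have \<psi>: "presentation M (i + 0) (\<Phi> \<circ> \<psi>)"
  proof (rule presentation_comp)
    show "bij \<psi>"
      by (rule o_bij[of "\<lambda>(p, q). (p, [:inverse c:] * q)"])
        (use c in \<open>auto simp: \<psi>_def fun_eq_iff\<close>)
    show "clinear \<psi>" by (auto simp: clinear_def \<psi>_def smult_add_right algebra_simps)
    show "\<psi> ` graded_part j = graded_part (0 + j)" for j
    proof -
      have "u \<in> \<psi> ` graded_part j" if "u \<in> graded_part j" for u
        by (rule image_eqI[of _ _ "(fst u, [:inverse c:] * snd u)"])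
          (use that c in \<open>auto simp: \<psi>_def graded_part_def prod_eq_iff split: if_splits\<close>)
      moreover have "\<psi> u \<in> graded_part j" if "u \<in> graded_part j" for u
        using that by (cases u) (auto simp: \<psi>_def graded_part_def split: if_splits)
      ultimately show ?thesis by auto
    qed
  qed
  have "realizes (of_int e / 2) M (\<Phi> \<circ> \<psi>) (model \<mu> \<alpha>)"
  proof (rule S.realizesI[OF \<psi>])
    fix j k and u :: poly2 assume k: "k \<in> svir_index (of_int e / 2) j"
    obtain p q where u: "u = (p, q)" by (cases u)
    have "T k (\<psi> u) = \<psi> (model \<mu> \<alpha> k u)"
      using bit_cases[of j]
    proof
      assume "j = 0"
      then obtain m where m: "k = L m" using k by (auto simp: svir_index_0)
      show ?thesis unfolding m u by (simp add: T_L \<psi>_def am bm algebra_simps smult_add_right)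
    next
      assume "j = 1"
      then obtain l where l: "k = G (of_int l / 2)" "even (l - e)" using k by (auto simp: svir_index_1)
      show ?thesis unfolding l u \<psi>_def prod.case T_G[OF l(2)] model_G_half gj[OF l(2)] hj[OF l(2)]
        using c by (simp add: algebra_simps smult_add_right)
    qed
    then show "act M (Poly_Mapping.single k 1) ((\<Phi> \<circ> \<psi>) u) = (\<Phi> \<circ> \<psi>) (model \<mu> \<alpha> k u)"
      by (simp add: act_eq[OF k])
  qed
  with \<psi>[unfolded add_0_right] \<mu> show ?thesis by blast
qed

lemma swapped: "presented_supermodule M (i + 1) (\<Phi> \<circ> prod.swap) e"
proof -
  have P: "presentation M (i + 1) (\<Phi> \<circ> prod.swap)"
  proof (rule presentation_comp)
    show "clinear prod.swap" by (auto simp: clinear_def)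
    show "prod.swap ` graded_part j = graded_part (1 + j)" for j
      using bit_cases[of j] by (auto simp: graded_part_def image_iff)
  qed simp
  show ?thesis
    by (intro presented_supermodule.intro P S.svir_supermodule_axioms presented_supermodule_axioms.intro)
      (use e act_L0 in \<open>auto simp: pscale_def\<close>)
qed

text \<open>One constant \<open>g j\<close> makes all of them constant. If there is none, the degree
  sum 1 makes every \<open>h j\<close> constant, and \<open>h\<close> takes the place of
  \<open>g\<close> after exchanging \<open>v\<close> and \<open>w\<close>.\<close>

lemma classification:
  "\<exists>i \<Psi> \<mu> \<alpha>. presentation M i \<Psi> \<and> realizes (of_int e / 2) M \<Psi> (model \<mu> \<alpha>) \<and> \<mu> \<noteq> 0 \<and> csqrt (\<mu>\<^sup>2) = \<mu>"
proof (cases "\<exists>j. even (j - e) \<and> degree (g j) = 0")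
  case True
  then have "\<And>j. even (j - e) \<Longrightarrow> degree (g j) = 0"
    using svir_coeffs.degree_g_const[OF svir_coeffs] by blast
  from normalize[OF this] show ?thesis by blast
next
  case False
  interpret W: presented_supermodule M "i + 1" "\<Phi> \<circ> prod.swap" e by (rule swapped)
  have "W.T k u = prod.swap (T k (prod.swap u))" if k: "k \<in> svir_index (of_int e / 2) j" for j k u
  proof -
    have "(\<Phi> \<circ> prod.swap) (W.T k u) = \<Phi> (T k (prod.swap u))"
      using W.act_eq[OF k, of u] act_eq[OF k, of "prod.swap u"] by simp
    then have "prod.swap (W.T k u) = T k (prod.swap u)" by simp
    then show ?thesis by (metis swap_swap)
  qed
  then have "W.g j = h j" if "even (j - e)" for j
    using G_index[OF that] by (simp add: W.g_def h_def)
  moreover have "degree (h j) = 0" if j: "even (j - e)" for j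
    using svir_coeffs.degree_g_minus(2)[OF svir_coeffs j] False j by fastforce
  ultimately have "degree (W.g j) = 0" if "even (j - e)" for j
    using that by simp
  from W.normalize[OF this] show ?thesis by blast
qed

end

section \<open>Homogeneous bases of the objects\<close>

context svir_supermodule
begin

lemma L0_closed: "v \<in> carrier M \<Longrightarrow> act M (Lvec 0) v \<in> carrier M"
  by (rule act_closed[OF Lvec_in_svir(1)])

lemma act_HH_const: "v \<in> carrier M \<Longrightarrow> act_HH M [:c:] v = c \<odot>\<^bsub>M\<^esub> v"
  by (simp add: act_HH_def)

lemma act_HH_X:
  assumes "v \<in> carrier M"
  shows "act_HH M [:0, 1:] v = act M (Lvec 0) v"
proof -
  have "{..Suc 0} = {0, Suc 0}" by auto
  then show ?thesis
    using assms L0_closed[OF assms] smult_l_null[OF assms] smult_one[OF L0_closed[OF assms]]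
    by (simp add: act_HH_def finsum_insert)
qed

end

text \<open>The part of the \<open>\<complex>[L\<^sub>0]\<close>-module structure available for both
  kinds of objects: directly in the Neveu-Schwarz case, and through the subring of pairs
  \<open>(p, 0)\<close> of \<open>U_hh\<close> in the Ramond case.\<close>

locale HH_module = S: svir_supermodule \<epsilon> M for \<epsilon> and M :: "'v svir_module" +
  assumes HH_closed: "v \<in> carrier M \<Longrightarrow> act_HH M p v \<in> carrier M"
    and HH_add: "v \<in> carrier M \<Longrightarrow> act_HH M (p + q) v = act_HH M p v \<oplus>\<^bsub>M\<^esub> act_HH M q v"
    and HH_mult: "v \<in> carrier M \<Longrightarrow> act_HH M (p * q) v = act_HH M p (act_HH M q v)"
begin

lemma HH_0: "v \<in> carrier M \<Longrightarrow> act_HH M 0 v = \<zero>\<^bsub>M\<^esub>"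
  using S.act_HH_const[of v 0] S.smult_l_null[of v] by simp

lemma HH_1: "v \<in> carrier M \<Longrightarrow> act_HH M 1 v = v"
  using S.act_HH_const[of v 1] S.smult_one[of v] by (simp add: one_pCons)

lemma HH_const_mult: "v \<in> carrier M \<Longrightarrow> act_HH M ([:c:] * p) v = c \<odot>\<^bsub>M\<^esub> act_HH M p v"
  by (simp only: HH_mult S.act_HH_const HH_closed)

lemma HH_X_mult: "v \<in> carrier M \<Longrightarrow> act_HH M ([:0, 1:] * p) v = act M (Lvec 0) (act_HH M p v)"
  by (simp only: HH_mult S.act_HH_X HH_closed)

lemma HH_part:
  assumes v: "v \<in> part M i"
  shows "act_HH M p v \<in> part M i"
proof (induction p)
  case 0
  show ?case using HH_0[OF S.part_carrier[OF v]] S.part_closed(3) by simp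
next
  case (pCons c p)
  have p: "pCons c p = [:c:] + [:0, 1:] * p" by simp
  have "act M (Lvec 0) (act_HH M p v) \<in> part M (0 + i)"
    by (rule S.act_part[OF Lvec_in_svir(2) pCons.IH])
  then have "act M (Lvec 0) (act_HH M p v) \<in> part M i" by (simp only: add_0_left)
  then show ?case
    unfolding p HH_add[OF S.part_carrier[OF v]] HH_X_mult[OF S.part_carrier[OF v]]
      S.act_HH_const[OF S.part_carrier[OF v]]
    by (intro S.part_closed v)
qed

lemma presented_supermoduleI:
  assumes \<epsilon>: "\<epsilon> = of_int e / 2" and e: "e = 0 \<or> e = 1"
    and v: "v \<in> part M i" and w: "w \<in> part M (i + 1)"
    and bij: "bij_betw (\<lambda>(p, q). act_HH M p v \<oplus>\<^bsub>M\<^esub> act_HH M q w) UNIV (carrier M)"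
  shows "presented_supermodule M i (\<lambda>(p, q). act_HH M p v \<oplus>\<^bsub>M\<^esub> act_HH M q w) e"
proof -
  note vc = S.part_carrier[OF v] and wc = S.part_carrier[OF w]
  note closed = HH_closed[OF vc] HH_closed[OF wc]
  let ?\<Phi> = "\<lambda>(p, q). act_HH M p v \<oplus>\<^bsub>M\<^esub> act_HH M q w"
  have sub: "?\<Phi> ` graded_part j \<subseteq> part M (i + j)" for j
    using bit_cases[of j] HH_part[OF v] HH_part[OF w] HH_0[OF vc] HH_0[OF wc] closed
    by (auto simp: graded_part_def)
  have P: "presentation M i ?\<Phi>"
  proof (rule presentation.intro)
    show "module complex_ring M" by (rule S.module_axioms)
    show "bij_betw ?\<Phi> UNIV (carrier M)" by (rule bij)
    show "?\<Phi> (u + u') = ?\<Phi> u \<oplus>\<^bsub>M\<^esub> ?\<Phi> u'" for u u'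
      by (cases u, cases u') (simp add: HH_add vc wc closed S.M.a_ac)
    show "?\<Phi> ([:c:] *\<^sub>v u) = c \<odot>\<^bsub>M\<^esub> ?\<Phi> u" for c u
      by (cases u) (simp only: pscale_Pair prod.case HH_const_mult[OF vc] HH_const_mult[OF wc]
        S.smult_r_distr[OF _ closed] ring_of_simps UNIV_I)
    show "part M (i + j) = ?\<Phi> ` graded_part j" for j
    proof (rule antisym[OF subsetI sub])
      fix z assume z: "z \<in> part M (i + j)"
      then have "z \<in> carrier M" by (rule S.part_carrier)
      then have "z \<in> range ?\<Phi>" using bij by (simp only: bij_betw_def)
      then obtain p q where pq: "z = act_HH M p v \<oplus>\<^bsub>M\<^esub> act_HH M q w" by auto
      \<comment> \<open>Both summands are homogeneous, so the one whose parity is not that of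
        \<open>z\<close> vanishes by directness of the sum.\<close>
      note parts = HH_part[OF v, of p] HH_part[OF w, of q]
      from bit_cases[of j] show "z \<in> ?\<Phi> ` graded_part j"
      proof
        assume j: "j = 0"
        have "act_HH M q w = \<zero>\<^bsub>M\<^esub>"
        proof (rule S.part_direct_sumD(2)[OF parts(1) _ parts(2) S.part_closed(3)])
          show "z \<in> part M i" using z unfolding j add_0_right .
          show "act_HH M p v \<oplus>\<^bsub>M\<^esub> act_HH M q w = z \<oplus>\<^bsub>M\<^esub> \<zero>\<^bsub>M\<^esub>"
            using S.M.r_zero[OF \<open>z \<in> carrier M\<close>] pq by (simp only:)
        qed
        then have "z = ?\<Phi> (p, 0)" using pq HH_0[OF wc] by simp
        then show ?thesis using j by (auto simp: graded_part_def)
      next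
        assume j: "j = 1"
        have "act_HH M p v = \<zero>\<^bsub>M\<^esub>"
        proof (rule S.part_direct_sumD(1)[OF parts(1) S.part_closed(3) parts(2)])
          show "z \<in> part M (i + 1)" using z unfolding j .
          show "act_HH M p v \<oplus>\<^bsub>M\<^esub> act_HH M q w = \<zero>\<^bsub>M\<^esub> \<oplus>\<^bsub>M\<^esub> z"
            using S.M.l_zero[OF \<open>z \<in> carrier M\<close>] pq by (simp only:)
        qed
        then have "z = ?\<Phi> (0, q)" using pq HH_0[OF vc] by simp
        then show ?thesis using j by (auto simp: graded_part_def)
      qed
    qed
  qed
  show ?thesis
  proof (intro presented_supermodule.intro P presented_supermodule_axioms.intro e)
    show "svir_supermodule (of_int e / 2) M" using S.svir_supermodule_axioms unfolding \<epsilon> .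
    show "act M (Lvec 0) (?\<Phi> u) = ?\<Phi> ([:0, 1:] *\<^sub>v u)" for u
      by (cases u) (simp only: pscale_Pair prod.case HH_X_mult[OF vc] HH_X_mult[OF wc]
        S.act_add_right[OF Lvec_in_svir(1) closed])
  qed
qed

end

section \<open>Homogeneous bases in the Ramond and Neveu-Schwarz cases\<close>

lemma restrict_simps [simp]:
  "carrier (restrict_HH M) = carrier M" "zero (restrict_HH M) = zero M"
  "add (restrict_HH M) = add M" "smult (restrict_HH M) = act_HH M"
  "carrier (restrict_hh M) = carrier M" "zero (restrict_hh M) = zero M"
  "add (restrict_hh M) = add M" "smult (restrict_hh M) = act_hh M"
  by (simp_all add: restrict_HH_def restrict_hh_def)

text \<open>The two basis vectors have opposite parities: otherwise the whole module would have one
  parity, all \<open>G\<^sub>r\<close> would act as zero, and so would \<open>2 L\<^sub>0 =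
  [G\<^sub>1\<^sub>/\<^sub>2, G\<^sub>-\<^sub>1\<^sub>/\<^sub>2]\<close>, against freeness.\<close>

lemma neveu_schwarz_presented:
  assumes M: "M \<in> Obj neveu_schwarz_rank2"
  shows "\<exists>i \<Phi>. presented_supermodule M i \<Phi> 1"
proof -
  have sup: "svir_supermodule (1 / 2) M" using M by (simp add: neveu_schwarz_rank2_def svir_full_subcategory_def)
  obtain B where B: "module_basis U_HH (restrict_HH M) B" "card B = 2" "B \<subseteq> part M 0 \<union> part M 1"
    using M by (auto simp: neveu_schwarz_rank2_def svir_full_subcategory_def)
  obtain v w where vw: "B = {v, w}" "v \<noteq> w" using B(2) by (auto simp: card_2_iff)
  have mod: "module U_HH (restrict_HH M)" and "v \<in> carrier M" "w \<in> carrier M"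
    and bij: "bij_betw (\<lambda>(p, q). act_HH M p v \<oplus>\<^bsub>M\<^esub> act_HH M q w) UNIV (carrier M)"
    using B(1) unfolding vw(1) module_basis_pair_iff[OF vw(2)] by (simp_all add: U_HH_def)
  interpret S: svir_supermodule "1 / 2" M by (rule sup)
  interpret H: HH_module "1 / 2" M
  proof
    show "act_HH M p v \<in> carrier M" if "v \<in> carrier M" for p v
      using module.smult_closed[OF mod, of p v] that by (simp add: U_HH_def)
    show "act_HH M (p + q) v = act_HH M p v \<oplus>\<^bsub>M\<^esub> act_HH M q v" if "v \<in> carrier M" for p q v
      using module.smult_l_distr[OF mod, of p q v] that by (simp add: U_HH_def)
    show "act_HH M (p * q) v = act_HH M p (act_HH M q v)" if "v \<in> carrier M" for p q v
      using module.smult_assoc1[OF mod, of p q v] that by (simp add: U_HH_def)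
  qed
  obtain i j where i: "v \<in> part M i" and j: "w \<in> part M j" using B(3) vw by blast
  have "j = i + 1"
  proof (rule ccontr)
    assume "j \<noteq> i + 1"
    then have "j = i" using bit_cases[of i] bit_cases[of j] by auto
    have all: "z \<in> part M i" if "z \<in> carrier M" for z
    proof -
      have "z \<in> (\<lambda>(p, q). act_HH M p v \<oplus>\<^bsub>M\<^esub> act_HH M q w) ` UNIV"
        using bij that by (simp only: bij_betw_def)
      then obtain p q where "z = act_HH M p v \<oplus>\<^bsub>M\<^esub> act_HH M q w" by auto
      then show ?thesis using H.HH_part[OF i, of p] H.HH_part[OF j, of q] S.part_closed(1) \<open>j = i\<close> by simp
    qed
    have odd: "z = \<zero>\<^bsub>M\<^esub>" if z: "z \<in> part M (i + 1)" for z
    proof (rule S.part_direct_sumD(1)[OF all S.part_closed(3) S.part_closed(3) z])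
      show "z \<in> carrier M" by (rule S.part_carrier[OF z])
      then show "z \<oplus>\<^bsub>M\<^esub> \<zero>\<^bsub>M\<^esub> = \<zero>\<^bsub>M\<^esub> \<oplus>\<^bsub>M\<^esub> z" by simp
    qed
    have Gv: "Gvec (1 / 2) \<in> svir_part (1 / 2) 1" "Gvec (- 1 / 2) \<in> svir_part (1 / 2) 1"
      using Gvec_in_svir(2)[of 1 1] Gvec_in_svir(2)[of "- 1" 1] by simp_all
    have G0: "act M (Gvec r) z = \<zero>\<^bsub>M\<^esub>" if "Gvec r \<in> svir_part (1 / 2) 1" "z \<in> carrier M" for r z
      using S.act_part[OF that(1) all[OF that(2)]] by (intro odd) (simp only: add.commute)
    have "svir_bracket (Gvec (1 / 2)) (Gvec (- 1 / 2)) = Poly_Mapping.single (L 0) 2"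
      unfolding svir_bracket_single by simp
    then have "act M (Poly_Mapping.single (L 0) 2) v = \<zero>\<^bsub>M\<^esub>"
      using S.act_bracket[OF Gv \<open>v \<in> carrier M\<close>] G0[OF Gv(1)] G0[OF Gv(2)] \<open>v \<in> carrier M\<close> by simp
    moreover have "act M (Poly_Mapping.single (L 0) 2) v = 2 \<odot>\<^bsub>M\<^esub> act M (Lvec 0) v"
      using S.act_single[of "L 0" 0 v 2] \<open>v \<in> carrier M\<close> by (simp add: svir_index_0)
    moreover have "act_HH M ([:2:] * [:0, 1:]) v = 2 \<odot>\<^bsub>M\<^esub> act M (Lvec 0) v"
      by (simp only: H.HH_const_mult[OF \<open>v \<in> carrier M\<close>] S.act_HH_X[OF \<open>v \<in> carrier M\<close>])
    ultimately have "act_HH M ([:2:] * [:0, 1:]) v = act_HH M 0 v"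
      using H.HH_0[OF \<open>v \<in> carrier M\<close>] by (simp only:)
    then have "([:2:] * [:0, 1:], 0) = (0 :: complex poly, 0 :: complex poly)"
      by (intro inj_onD[OF bij_betw_imp_inj_on[OF bij]]) (simp_all only: prod.case UNIV_I)
    then show False by simp
  qed
  then show ?thesis
    using H.presented_supermoduleI[of 1 v i w] i j bij by auto
qed

text \<open>The equation reads \<open>a (a - 1) = x b\<^sup>2\<close>. The left side has even degree
  and, for \<open>b \<noteq> 0\<close>, the right side has odd degree.\<close>

lemma square_eq_X_square:
  fixes a b :: "complex poly"
  assumes "a * (1 - a) + [:0, 1:] * b * b = 0"
  shows "b = 0" "a = 0 \<or> a = 1"
proof -
  have eq: "a * (a - 1) = [:0, 1:] * (b * b)"
    using assms by (simp add: algebra_simps)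
  show b: "b = 0"
  proof (rule ccontr)
    assume b: "b \<noteq> 0"
    then have "degree ([:0, 1:] * (b * b)) = Suc (2 * degree b)"
      by (subst degree_mult_eq) (simp_all add: degree_mult_eq)
    moreover have "even (degree (a * (a - 1)))"
    proof (cases "degree a = 0")
      case True
      then obtain c where "a = [:c:]" by (rule degree_0_obtain)
      then show ?thesis by (simp add: one_pCons)
    next
      case False
      then have "degree (a - 1) = degree a"
        using degree_add_eq_left[of "- 1" a] by simp
      moreover have "a \<noteq> 0" "a - 1 \<noteq> 0" using False by auto
      ultimately show ?thesis by (simp add: degree_mult_eq)
    qed
    ultimately show False using eq by simp
  qed
  then show "a = 0 \<or> a = 1" using eq by simp
qed

text \<open>The generator \<open>v\<close> is homogeneous: its even component is
  \<open>(a + G\<^sub>0 b) v\<close>, and the parity decomposition forces \<open>b = 0\<close> and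
  \<open>a\<close> to be 0 or 1. Then \<open>v\<close> and \<open>G\<^sub>0 v\<close> form a
  homogeneous basis over \<open>\<complex>[L\<^sub>0]\<close>.\<close>

lemma ramond_presented:
  assumes M: "M \<in> Obj ramond_rank1"
  shows "\<exists>i \<Phi>. presented_supermodule M i \<Phi> 0"
proof -
  have sup: "svir_supermodule 0 M" using M by (simp add: ramond_rank1_def svir_full_subcategory_def)
  obtain v where B: "module_basis U_hh (restrict_hh M) {v}"
    using M by (auto simp: ramond_rank1_def svir_full_subcategory_def card_1_singleton_iff)
  have mod: "module U_hh (restrict_hh M)" and v: "v \<in> carrier M"
    and bij: "bij_betw (\<lambda>p. act_hh M p v) UNIV (carrier M)"
    using B unfolding module_basis_single_iff by simp_all
  interpret S: svir_supermodule 0 M by (rule sup)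
  have zero: "act_HH M 0 z = \<zero>\<^bsub>M\<^esub>" if "z \<in> carrier M" for z
    using S.act_HH_const[OF that, of 0] S.smult_l_null[OF that] by simp
  have hh_closed: "act_hh M p z \<in> carrier M" if "z \<in> carrier M" for p z
    using module.smult_closed[OF mod, of p z] that by simp
  have hh_add: "act_hh M (p + q) z = act_hh M p z \<oplus>\<^bsub>M\<^esub> act_hh M q z" if "z \<in> carrier M" for p q z
    using module.smult_l_distr[OF mod, of p q z] that by simp
  have hh_mult: "act_hh M (p \<otimes>\<^bsub>U_hh\<^esub> q) z = act_hh M p (act_hh M q z)" if "z \<in> carrier M" for p q z
    using module.smult_assoc1[OF mod, of p q z] that by simp
  have hh_fst: "act_hh M (p, 0) z = act_HH M p z" if "z \<in> carrier M" for p z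
  proof -
    have "act_hh M (p, 0) z = act_HH M p z \<oplus>\<^bsub>M\<^esub> \<zero>\<^bsub>M\<^esub>"
      by (simp add: act_hh_def zero[OF that] S.act_zero_right[OF Gvec_0_in_svir(1)])
    moreover have "(act M (Lvec 0) ^^ n) z \<in> carrier M" for n
      by (induction n) (simp_all add: that S.L0_closed)
    then have "act_HH M p z \<in> carrier M"
      unfolding act_HH_def by (intro S.finsum_closed) simp
    ultimately show ?thesis by simp
  qed
  interpret H: HH_module 0 M
  proof
    fix z assume z: "z \<in> carrier M"
    show c: "act_HH M p z \<in> carrier M" for p
      using hh_closed[OF z, of "(p, 0)"] by (simp only: hh_fst[OF z])
    show "act_HH M (p + q) z = act_HH M p z \<oplus>\<^bsub>M\<^esub> act_HH M q z" for p q
      using hh_add[OF z, of "(p, 0)" "(q, 0)"] by (simp add: hh_fst[OF z])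
    show "act_HH M (p * q) z = act_HH M p (act_HH M q z)" for p q
      using hh_mult[OF z, of "(p, 0)" "(q, 0)"] by (simp add: hh_fst[OF z] hh_fst[OF c])
  qed
  define G0 where "G0 = act M (Gvec 0)"
  have G0: "G0 z \<in> carrier M" if "z \<in> carrier M" for z
    unfolding G0_def by (rule S.act_closed[OF Gvec_0_in_svir(1) that])
  have G0_part: "G0 z \<in> part M (i + 1)" if "z \<in> part M i" for z i
    using S.act_part[OF Gvec_0_in_svir(2) that] unfolding G0_def by (simp only: add.commute)
  have hh_eq: "act_hh M (p, q) z = act_HH M p z \<oplus>\<^bsub>M\<^esub> G0 (act_HH M q z)" for p q z
    by (simp add: act_hh_def G0_def)
  have hh_snd: "act_hh M (0, q) z = G0 (act_HH M q z)" if "z \<in> carrier M" for q z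
    using that by (simp add: hh_eq zero G0 H.HH_closed)
  have HH_G0: "act_HH M q (G0 z) = G0 (act_HH M q z)" if z: "z \<in> carrier M" for q z
  proof -
    have "act_HH M q (G0 z) = act_hh M (q, 0) (act_hh M (0, 1) z)"
      by (simp add: hh_fst[OF G0[OF z]] hh_snd[OF z] H.HH_1[OF z])
    also have "\<dots> = act_hh M (0, q) z" using hh_mult[OF z, of "(q, 0)" "(0, 1)"] by simp
    finally show ?thesis by (simp only: hh_snd[OF z])
  qed
  have inj: "p = q" if "act_hh M p v = act_hh M q v" for p q
    using bij that by (auto simp: bij_betw_def dest: injD)
  obtain v0 v1 where v01: "v0 \<in> part M 0" "v1 \<in> part M 1" "v = v0 \<oplus>\<^bsub>M\<^esub> v1"
    using S.part_direct_sum[OF v] by (auto simp: mem_Times_iff)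
  note c0 = S.part_carrier[OF v01(1)] and c1 = S.part_carrier[OF v01(2)]
  have "v0 \<in> range (\<lambda>p. act_hh M p v)" using bij c0 by (simp only: bij_betw_def)
  then obtain a b where ab: "v0 = act_hh M (a, b) v" by auto
  have v1: "v1 = act_hh M (1 - a, - b) v"
  proof -
    have "v0 \<oplus>\<^bsub>M\<^esub> act_hh M (1 - a, - b) v = act_hh M (1, 0) v"
      unfolding ab using hh_add[OF v, of "(a, b)" "(1 - a, - b)"] by simp
    also have "\<dots> = v0 \<oplus>\<^bsub>M\<^esub> v1" by (simp only: hh_fst[OF v] H.HH_1[OF v] v01(3)[symmetric])
    finally have eq: "v0 \<oplus>\<^bsub>M\<^esub> act_hh M (1 - a, - b) v = v0 \<oplus>\<^bsub>M\<^esub> v1" .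
    have "v1 = \<ominus>\<^bsub>M\<^esub> v0 \<oplus>\<^bsub>M\<^esub> (v0 \<oplus>\<^bsub>M\<^esub> v1)" by (simp only: S.M.r_neg1[OF c0 c1])
    also have "\<dots> = act_hh M (1 - a, - b) v"
      unfolding eq[symmetric] by (rule S.M.r_neg1[OF c0 hh_closed[OF v]])
    finally show ?thesis .
  qed
  \<comment> \<open>The odd component of \<open>v0 = (a + G\<^sub>0 b) (v0 + v1)\<close>. Writing
    \<open>v0\<close> and \<open>v1\<close> as multiples of \<open>v\<close> turns it into an
    equation in \<open>U_hh\<close>.\<close>
  have "act_HH M a v1 \<oplus>\<^bsub>M\<^esub> G0 (act_HH M b v0) = \<zero>\<^bsub>M\<^esub>"
  proof (rule S.part_direct_sumD(2)[of _ 0 v0])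
    show "act_HH M a v0 \<oplus>\<^bsub>M\<^esub> G0 (act_HH M b v1) \<in> part M 0"
      using S.part_closed(1)[OF H.HH_part[OF v01(1)] G0_part[OF H.HH_part[OF v01(2)], simplified]] by simp
    show "act_HH M a v1 \<oplus>\<^bsub>M\<^esub> G0 (act_HH M b v0) \<in> part M (0 + 1)"
      using S.part_closed(1)[OF H.HH_part[OF v01(2)] G0_part[OF H.HH_part[OF v01(1)], simplified]] by simp
    have "act_hh M (a, b) v = act_hh M (a, b) v0 \<oplus>\<^bsub>M\<^esub> act_hh M (a, b) v1"
      using module.smult_r_distr[OF mod, of "(a, b)" v0 v1] c0 c1 unfolding v01(3) by simp
    then have "v0 = act_hh M (a, b) v0 \<oplus>\<^bsub>M\<^esub> act_hh M (a, b) v1"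
      by (simp only: ab[symmetric])
    then show "act_HH M a v0 \<oplus>\<^bsub>M\<^esub> G0 (act_HH M b v1) \<oplus>\<^bsub>M\<^esub> (act_HH M a v1 \<oplus>\<^bsub>M\<^esub> G0 (act_HH M b v0))
        = v0 \<oplus>\<^bsub>M\<^esub> \<zero>\<^bsub>M\<^esub>"
      using c0 c1 by (simp add: hh_eq G0 H.HH_closed S.M.a_ac)
  qed (use v01(1) S.part_closed(3) in auto)
  then have "act_hh M (a, 0) v1 \<oplus>\<^bsub>M\<^esub> act_hh M (0, b) v0 = \<zero>\<^bsub>M\<^esub>"
    by (simp only: hh_fst[OF c1] hh_snd[OF c0])
  then have "act_hh M ((a, 0) \<otimes>\<^bsub>U_hh\<^esub> (1 - a, - b) \<oplus>\<^bsub>U_hh\<^esub> (0, b) \<otimes>\<^bsub>U_hh\<^esub> (a, b)) v = act_hh M (0, 0) v"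
    using v by (simp only: hh_add hh_mult U_hh_simps(5) v1[symmetric] ab[symmetric] hh_fst zero)
  then have "(a, 0) \<otimes>\<^bsub>U_hh\<^esub> (1 - a, - b) \<oplus>\<^bsub>U_hh\<^esub> (0, b) \<otimes>\<^bsub>U_hh\<^esub> (a, b) = (0, 0)" by (rule inj)
  then have "a * (1 - a) + [:0, 1:] * b * b = 0" by (simp add: algebra_simps)
  note ab01 = square_eq_X_square[OF this]
  have "\<exists>i. v \<in> part M i"
    using ab01(2)
  proof
    assume "a = 1"
    then show ?thesis using ab ab01(1) v01(1) by (auto simp: hh_fst[OF v] H.HH_1[OF v])
  next
    assume "a = 0"
    then have "v0 = \<zero>\<^bsub>M\<^esub>" using ab ab01(1) by (simp add: hh_fst[OF v] zero[OF v])
    then have "v = v1" using v01(3) c1 by simp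
    then show ?thesis using v01(2) by blast
  qed
  then obtain i where i: "v \<in> part M i" by blast
  have "(\<lambda>(p, q). act_HH M p v \<oplus>\<^bsub>M\<^esub> act_HH M q (G0 v)) = (\<lambda>p. act_hh M p v)"
    by (simp add: fun_eq_iff hh_eq HH_G0[OF v])
  then show ?thesis
    using H.presented_supermoduleI[of 0 v i "G0 v"] i G0_part[OF i] bij by auto
qed

section \<open>The equivalence of categories\<close>

lemma svir_full_subcategory_simps [simp]:
  "Hom (svir_full_subcategory \<epsilon> P) = svir_hom \<epsilon>"
  "Ident (svir_full_subcategory \<epsilon> P) M = (\<lambda>v\<in>carrier M. v)"
  "Comp (svir_full_subcategory \<epsilon> P) M N K g f = compose (carrier M) g f"
  "M \<in> Obj (svir_full_subcategory \<epsilon> P) \<longleftrightarrow> svir_supermodule \<epsilon> M \<and> P M"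
  by (simp_all add: svir_full_subcategory_def)

lemma svir_homD:
  assumes "f \<in> svir_hom \<epsilon> M N"
  shows "f \<in> extensional (carrier M)" "v \<in> carrier M \<Longrightarrow> f v \<in> carrier N"
    "\<lbrakk>v \<in> carrier M; w \<in> carrier M\<rbrakk> \<Longrightarrow> f (v \<oplus>\<^bsub>M\<^esub> w) = f v \<oplus>\<^bsub>N\<^esub> f w"
    "v \<in> carrier M \<Longrightarrow> f (c \<odot>\<^bsub>M\<^esub> v) = c \<odot>\<^bsub>N\<^esub> f v"
    "v \<in> part M i \<Longrightarrow> f v \<in> part N i"
    "\<lbrakk>x \<in> svir \<epsilon>; v \<in> carrier M\<rbrakk> \<Longrightarrow> f (act M x v) = act N x (f v)"
  using assms by (auto simp: svir_hom_def PiE_iff image_subset_iff)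

lemma svir_homI:
  assumes "f \<in> extensional (carrier M)" "\<And>v. v \<in> carrier M \<Longrightarrow> f v \<in> carrier N"
    "\<And>v w. \<lbrakk>v \<in> carrier M; w \<in> carrier M\<rbrakk> \<Longrightarrow> f (v \<oplus>\<^bsub>M\<^esub> w) = f v \<oplus>\<^bsub>N\<^esub> f w"
    "\<And>c v. v \<in> carrier M \<Longrightarrow> f (c \<odot>\<^bsub>M\<^esub> v) = c \<odot>\<^bsub>N\<^esub> f v"
    "\<And>i v. v \<in> part M i \<Longrightarrow> f v \<in> part N i"
    "\<And>x v. \<lbrakk>x \<in> svir \<epsilon>; v \<in> carrier M\<rbrakk> \<Longrightarrow> f (act M x v) = act N x (f v)"
  shows "f \<in> svir_hom \<epsilon> M N"
  using assms by (auto simp: svir_hom_def PiE_iff)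

lemma svir_hom_id:
  assumes "svir_supermodule \<epsilon> M"
  shows "(\<lambda>v\<in>carrier M. v) \<in> svir_hom \<epsilon> M M"
proof -
  interpret svir_supermodule \<epsilon> M by fact
  show ?thesis
    by (rule svir_homI) (use part_carrier smult_closed act_closed in auto)
qed

lemma svir_hom_compose:
  assumes M: "svir_supermodule \<epsilon> M" and f: "f \<in> svir_hom \<epsilon> M N" and g: "g \<in> svir_hom \<epsilon> N K"
  shows "compose (carrier M) g f \<in> svir_hom \<epsilon> M K"
proof -
  interpret svir_supermodule \<epsilon> M by fact
  show ?thesis
  proof (rule svir_homI)
    show "compose (carrier M) g f v \<in> part K i" if "v \<in> part M i" for i v
      using svir_homD(5)[OF g svir_homD(5)[OF f that]] part_carrier[OF that] by (simp add: compose_eq)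
  qed (use smult_closed act_closed in \<open>auto simp: compose_eq svir_homD[OF f] svir_homD[OF g]\<close>)
qed

lemma category_svir_full_subcategory: "category (svir_full_subcategory \<epsilon> P)"
proof
  fix W X Y Z f g h
  let ?C = "svir_full_subcategory \<epsilon> P"
  show "Ident ?C X \<in> Hom ?C X X" if "X \<in> Obj ?C"
    using that by (simp add: svir_hom_id)
  show "Comp ?C X Y Z g f \<in> Hom ?C X Z" if "X \<in> Obj ?C" "f \<in> Hom ?C X Y" "g \<in> Hom ?C Y Z"
    using that by (simp add: svir_hom_compose)
  show "Comp ?C X X Y f (Ident ?C X) = f" if "f \<in> Hom ?C X Y"
    using that svir_homD(1)[of f \<epsilon> X Y] by (auto simp: compose_def fun_eq_iff extensional_def)
  show "Comp ?C X Y Y (Ident ?C Y) f = f" if "f \<in> Hom ?C X Y"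
    using that svir_homD(1,2)[of f \<epsilon> X Y] by (auto simp: compose_def fun_eq_iff extensional_def)
  show "Comp ?C W Y Z h (Comp ?C W X Y g f) = Comp ?C W X Z (Comp ?C X Y Z h g) f"
    if "f \<in> Hom ?C W X"
    using that svir_homD(2)[of f \<epsilon> W X] by (auto simp: compose_def fun_eq_iff)
qed

section \<open>Transfer of morphisms between the two algebras\<close>

definition normal_presentation ::
    "int \<Rightarrow> 'v svir_module \<Rightarrow> bit \<Rightarrow> (poly2 \<Rightarrow> 'v) \<Rightarrow> complex \<Rightarrow> complex \<Rightarrow> bool" where
  "normal_presentation e M i \<Phi> \<mu> \<alpha> \<longleftrightarrow> presentation M i \<Phi> \<and>
    realizes (of_int e / 2) M \<Phi> (model \<mu> \<alpha>) \<and> \<mu> \<noteq> 0 \<and> csqrt (\<mu>\<^sup>2) = \<mu>"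

text \<open>In coordinates \<open>f\<close> intertwines two models. The operators
  \<open>L\<^sub>m\<close> belong to both algebras, and \<open>model_intertwiner\<close> extends the
  relation from the odd operators of one parity class to those of the other.\<close>

lemma svir_hom_transfer:
  assumes M: "normal_presentation e M i \<Phi> \<mu> \<alpha>" "normal_presentation e' M' i \<Phi> \<mu> \<alpha>"
    and N: "normal_presentation e N j \<Psi> \<nu> \<beta>" "normal_presentation e' N' j \<Psi> \<nu> \<beta>"
    and M': "carrier M' = carrier M" "add M' = add M" "smult M' = smult M" "part M' = part M"
    and N': "carrier N' = carrier N" "add N' = add N" "smult N' = smult N" "part N' = part N"
    and f: "f \<in> svir_hom (of_int e / 2) M N"
  shows "f \<in> svir_hom (of_int e' / 2) M' N'"
proof -
  interpret M: presentation M i \<Phi> using M(1) by (simp add: normal_presentation_def)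
  interpret N: presentation N j \<Psi> using N(1) by (simp add: normal_presentation_def)
  note fD = svir_homD[OF f]
  have act: "act M x (\<Phi> u) = \<Phi> (lin_ext (model \<mu> \<alpha>) x u)" "act N x (\<Psi> u) = \<Psi> (lin_ext (model \<nu> \<beta>) x u)"
    if "x \<in> svir (of_int e / 2)" for x u
    using M(1) N(1) that unfolding normal_presentation_def realizes_def by blast+
  have act': "act M' x (\<Phi> u) = \<Phi> (lin_ext (model \<mu> \<alpha>) x u)" "act N' x (\<Psi> u) = \<Psi> (lin_ext (model \<nu> \<beta>) x u)"
    if "x \<in> svir (of_int e' / 2)" for x u
    using M(2) N(2) that unfolding normal_presentation_def realizes_def by blast+
  define h where "h u = N.coords (f (\<Phi> u))" for u
  have h: "f (\<Phi> u) = \<Psi> (h u)" for u unfolding h_def by (simp add: fD(2))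
  have lin: "clinear h"
    unfolding clinear_def
  proof (intro conjI allI)
    show "h (u + v) = h u + h v" for u v
      using fD(3)[OF M.\<Phi>_closed M.\<Phi>_closed, of u v]
      by (simp only: M.\<Phi>_add[symmetric] N.\<Phi>_add[symmetric] h N.\<Phi>_inject)
    show "h ([:c:] *\<^sub>v u) = [:c:] *\<^sub>v h u" for c u
      using fD(4)[OF M.\<Phi>_closed, of c u]
      by (simp only: M.\<Phi>_smult[symmetric] N.\<Phi>_smult[symmetric] h N.\<Phi>_inject)
  qed
  have inter: "h (model \<mu> \<alpha> k u) = model \<nu> \<beta> k (h u)" if "Poly_Mapping.single k 1 \<in> svir (of_int e / 2)" for k u
  proof -
    have "h (lin_ext (model \<mu> \<alpha>) (Poly_Mapping.single k 1) u)
      = lin_ext (model \<nu> \<beta>) (Poly_Mapping.single k 1) (h u)"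
      using fD(6)[OF that M.\<Phi>_closed, of u] by (simp only: act[OF that] h N.\<Phi>_inject)
    then show ?thesis by (simp flip: one_pCons)
  qed
  have L: "h (model \<mu> \<alpha> (L m) u) = model \<nu> \<beta> (L m) (h u)" for m u
    by (rule inter[OF Lvec_in_svir(1)])
  have \<mu>\<nu>: "\<mu> \<noteq> 0" "csqrt (\<mu>\<^sup>2) = \<mu>" "csqrt (\<nu>\<^sup>2) = \<nu>"
    using M(1) N(1) by (simp_all add: normal_presentation_def)
  have G: "h (model \<mu> \<alpha> (G (of_int l / 2)) u) = model \<nu> \<beta> (G (of_int l / 2)) (h u)" for l u
    using lin \<mu>\<nu> L by (rule model_intertwiner) (rule inter[OF Gvec_in_svir(1)])
  have inter': "h (lin_ext (model \<mu> \<alpha>) x u) = lin_ext (model \<nu> \<beta>) x (h u)"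
    if x: "x \<in> svir (of_int e' / 2)" for x u
  proof -
    have "h (model \<mu> \<alpha> k u) = model \<nu> \<beta> k (h u)" if "k \<in> Poly_Mapping.keys x" for k
      using that x L G unfolding svir_def svir_index_0 svir_index_1 by blast
    then show ?thesis unfolding lin_ext_def by (simp add: clinearD[OF lin])
  qed
  show ?thesis
  proof (rule svir_homI, unfold M' N')
    fix x v assume x: "x \<in> svir (of_int e' / 2)" and v: "v \<in> carrier M"
    from v obtain u where u: "v = \<Phi> u" by (rule M.carrier_cases)
    show "f (act M' x v) = act N' x (f v)"
      unfolding u act'[OF x] h inter'[OF x] ..
  qed (use fD in auto)
qed

text \<open>The index \<open>e\<close> lets one argument treat both functors and both
  composites.\<close>

definition free_rank_category :: "int \<Rightarrow> ('v svir_module, 'v \<Rightarrow> 'v) category" where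
  "free_rank_category e = (if e = 0 then ramond_rank1 else neveu_schwarz_rank2)"

lemma free_rank_category_eq:
  assumes "e = 0 \<or> e = 1"
  obtains P where "free_rank_category e = svir_full_subcategory (of_int e / 2) P"
  using assms by (auto simp: free_rank_category_def ramond_rank1_def neveu_schwarz_rank2_def)

lemma free_rank_category_simps:
  fixes M N K :: "'v svir_module" and f g :: "'v \<Rightarrow> 'v"
  assumes "e = 0 \<or> e = 1"
  shows "Hom (free_rank_category e) = (svir_hom (of_int e / 2) :: 'v svir_module \<Rightarrow> _)"
    "Ident (free_rank_category e) M = (\<lambda>v\<in>carrier M. v)"
    "Comp (free_rank_category e) M N K g f = compose (carrier M) g f"
    "M \<in> Obj (free_rank_category e) \<Longrightarrow> svir_supermodule (of_int e / 2) M"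
    "category (free_rank_category e :: ('v svir_module, 'v \<Rightarrow> 'v) category)"
proof -
  obtain P where "(free_rank_category e :: ('v svir_module, 'v \<Rightarrow> 'v) category)
    = svir_full_subcategory (of_int e / 2) P"
    by (rule free_rank_category_eq[OF assms])
  then show "Hom (free_rank_category e) = (svir_hom (of_int e / 2) :: 'v svir_module \<Rightarrow> _)"
    "Ident (free_rank_category e) M = (\<lambda>v\<in>carrier M. v)"
    "Comp (free_rank_category e) M N K g f = compose (carrier M) g f"
    "M \<in> Obj (free_rank_category e) \<Longrightarrow> svir_supermodule (of_int e / 2) M"
    "category (free_rank_category e :: ('v svir_module, 'v \<Rightarrow> 'v) category)"
    by (simp_all add: category_svir_full_subcategory)
qed

section \<open>The two functors and their composites\<close>

lemma normal_presentation_exists: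
  assumes e: "e = 0 \<or> e = 1" and M: "M \<in> Obj (free_rank_category e)"
  shows "\<exists>i \<Phi> \<mu> \<alpha>. normal_presentation e M i \<Phi> \<mu> \<alpha>"
proof -
  have "\<exists>i \<Phi>. presented_supermodule M i \<Phi> e"
    using e M ramond_presented[of M] neveu_schwarz_presented[of M] by (auto simp: free_rank_category_def)
  then obtain i \<Phi> where "presented_supermodule M i \<Phi> e" by blast
  from presented_supermodule.classification[OF this] show ?thesis
    unfolding normal_presentation_def .
qed

text \<open>The new action comes from a chosen normal presentation. The target algebra is not an
  argument because the model acts for all symbols at once.\<close>

definition switch :: "int \<Rightarrow> 'v svir_module \<Rightarrow> 'v svir_module" where
  "switch e M = (SOME N. \<exists>i \<Phi> \<mu> \<alpha>. normal_presentation e M i \<Phi> \<mu> \<alpha> \<and> N = with_action M \<Phi> (model \<mu> \<alpha>))"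

lemma switch:
  assumes e: "e = 0 \<or> e = 1" and e': "e' = 0 \<or> e' = 1" and M: "M \<in> Obj (free_rank_category e)"
  obtains i \<Phi> \<mu> \<alpha> where "normal_presentation e M i \<Phi> \<mu> \<alpha>" "normal_presentation e' (switch e M) i \<Phi> \<mu> \<alpha>"
    "switch e M \<in> Obj (free_rank_category e')"
    "carrier (switch e M) = carrier M" "add (switch e M) = add M"
    "smult (switch e M) = smult M" "part (switch e M) = part M"
proof -
  have "\<exists>i \<Phi> \<mu> \<alpha>. normal_presentation e M i \<Phi> \<mu> \<alpha> \<and> switch e M = with_action M \<Phi> (model \<mu> \<alpha>)"
    unfolding switch_def by (rule someI_ex) (use normal_presentation_exists[OF e M] in blast)
  then obtain i \<Phi> \<mu> \<alpha> where n: "normal_presentation e M i \<Phi> \<mu> \<alpha>"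
    and N: "switch e M = with_action M \<Phi> (model \<mu> \<alpha>)" by blast
  interpret P: presentation M i \<Phi> using n by (simp add: normal_presentation_def)
  interpret N: presentation "switch e M" i \<Phi> unfolding N by (rule P.presentation_with_action)
  have r: "realizes \<epsilon> (switch e M) \<Phi> (model \<mu> \<alpha>)" for \<epsilon>
    unfolding N by (rule P.realizes_with_action)
  have \<mu>: "\<mu> \<noteq> 0" "csqrt (\<mu>\<^sup>2) = \<mu>" using n by (simp_all add: normal_presentation_def)
  have sup: "svir_supermodule (of_int e' / 2) (switch e M)"
    unfolding N by (rule P.svir_supermodule_with_action[OF free_rank_category_simps(4)[OF e M]
      svir_rep_model[OF \<mu>(1)] graded_model])
  have "switch e M \<in> Obj (free_rank_category e')"
    using e' sup N.model_in_ramond_rank1[OF _ r] N.model_in_neveu_schwarz_rank2[OF _ r]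
    by (auto simp: free_rank_category_def)
  moreover have "normal_presentation e' (switch e M) i \<Phi> \<mu> \<alpha>"
    using N.presentation_axioms r \<mu> by (simp add: normal_presentation_def)
  ultimately show ?thesis using that n by (simp add: N)
qed

lemma switch_hom:
  assumes e: "e = 0 \<or> e = 1" and e': "e' = 0 \<or> e' = 1"
    and M: "M \<in> Obj (free_rank_category e)" and N: "N \<in> Obj (free_rank_category e)"
    and f: "f \<in> Hom (free_rank_category e) M N"
  shows "f \<in> Hom (free_rank_category e') (switch e M) (switch e N)"
proof -
  note sM = switch[OF e e' M] and sN = switch[OF e e' N]
  have "f \<in> svir_hom (of_int e / 2) M N"
    using f unfolding free_rank_category_simps(1)[OF e] .
  then show ?thesis
    unfolding free_rank_category_simps(1)[OF e']
    by - (rule sM, rule sN, rule svir_hom_transfer)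
qed

lemma cat_functor_switch:
  assumes e: "e = 0 \<or> e = 1" and e': "e' = 0 \<or> e' = 1"
  shows "cat_functor (free_rank_category e) (free_rank_category e') (switch e) (\<lambda>X Y f. f)"
proof (intro cat_functor.intro cat_functor_axioms.intro)
  let ?C = "free_rank_category e" and ?D = "free_rank_category e'"
  fix X assume X: "X \<in> Obj ?C"
  show "switch e X \<in> Obj ?D" by (rule switch[OF e e' X])
  have c: "carrier (switch e X) = carrier X" by (rule switch[OF e e' X])
  show "Ident ?C X = Ident ?D (switch e X)"
    by (simp only: free_rank_category_simps(2)[OF e] free_rank_category_simps(2)[OF e'] c)
  show "Comp ?C X Y Z g f = Comp ?D (switch e X) (switch e Y) (switch e Z) g f" for Y Z f g
    by (simp only: free_rank_category_simps(3)[OF e] free_rank_category_simps(3)[OF e'] c)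
qed (simp_all add: free_rank_category_simps(5) e e' switch_hom)

text \<open>The return switch may choose a different presentation of the middle module. Hence the
  identity of the middle module is transferred back, with the first presentation on one side and the
  second on the other.\<close>

lemma switch_switch:
  assumes e: "e = 0 \<or> e = 1" and e': "e' = 0 \<or> e' = 1" and X: "X \<in> Obj (free_rank_category e)"
  shows "carrier (switch e' (switch e X)) = carrier X"
    "(\<lambda>v\<in>carrier X. v) \<in> Hom (free_rank_category e) X (switch e' (switch e X))"
    "(\<lambda>v\<in>carrier X. v) \<in> Hom (free_rank_category e) (switch e' (switch e X)) X"
proof -
  obtain i \<Phi> \<mu> \<alpha> where Y: "normal_presentation e X i \<Phi> \<mu> \<alpha>" "normal_presentation e' (switch e X) i \<Phi> \<mu> \<alpha>"
    and Y_obj: "switch e X \<in> Obj (free_rank_category e')"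
    and Yc: "carrier (switch e X) = carrier X" "add (switch e X) = add X"
    "smult (switch e X) = smult X" "part (switch e X) = part X"
    by (rule switch[OF e e' X])
  obtain j \<Psi> \<nu> \<beta> where Z: "normal_presentation e' (switch e X) j \<Psi> \<nu> \<beta>"
    "normal_presentation e (switch e' (switch e X)) j \<Psi> \<nu> \<beta>"
    and Zc: "carrier (switch e' (switch e X)) = carrier (switch e X)"
    "add (switch e' (switch e X)) = add (switch e X)"
    "smult (switch e' (switch e X)) = smult (switch e X)"
    "part (switch e' (switch e X)) = part (switch e X)"
    by (rule switch[OF e' e Y_obj])
  show "carrier (switch e' (switch e X)) = carrier X" by (simp only: Zc Yc)
  have id: "(\<lambda>v\<in>carrier X. v) \<in> svir_hom (of_int e' / 2) (switch e X) (switch e X)"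
    using svir_hom_id[OF free_rank_category_simps(4)[OF e' Y_obj]] by (simp only: Yc)
  show "(\<lambda>v\<in>carrier X. v) \<in> Hom (free_rank_category e) X (switch e' (switch e X))"
    unfolding free_rank_category_simps(1)[OF e]
    by (rule svir_hom_transfer[OF Y(2) Y(1) Z _ _ _ _ _ _ _ _ id]) (simp_all only: Yc Zc)
  show "(\<lambda>v\<in>carrier X. v) \<in> Hom (free_rank_category e) (switch e' (switch e X)) X"
    unfolding free_rank_category_simps(1)[OF e]
    by (rule svir_hom_transfer[OF Z Y(2) Y(1) _ _ _ _ _ _ _ _ id]) (simp_all only: Yc Zc)
qed

lemma cat_functor_switch_switch:
  assumes e: "e = 0 \<or> e = 1" and e': "e' = 0 \<or> e' = 1"
  shows "cat_functor (free_rank_category e) (free_rank_category e) (\<lambda>X. switch e' (switch e X)) (\<lambda>X Y f. f)"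
proof -
  interpret F: cat_functor "free_rank_category e" "free_rank_category e'" "switch e" "\<lambda>X Y f. f"
    by (rule cat_functor_switch[OF e e'])
  interpret G: cat_functor "free_rank_category e'" "free_rank_category e" "switch e'" "\<lambda>X Y f. f"
    by (rule cat_functor_switch[OF e' e])
  show ?thesis
  proof
    fix X Y Z f g
    assume X: "X \<in> Obj (free_rank_category e)"
    show "switch e' (switch e X) \<in> Obj (free_rank_category e)"
      by (intro G.map_obj F.map_obj X)
    show "Ident (free_rank_category e) X = Ident (free_rank_category e) (switch e' (switch e X))"
      using F.map_ident[OF X] G.map_ident[OF F.map_obj[OF X]] by (simp only:)
    assume Y: "Y \<in> Obj (free_rank_category e)" and f: "f \<in> Hom (free_rank_category e) X Y"
    show "f \<in> Hom (free_rank_category e) (switch e' (switch e X)) (switch e' (switch e Y))"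
      by (intro G.map_hom F.map_hom F.map_obj X Y f)
    assume Z: "Z \<in> Obj (free_rank_category e)" and g: "g \<in> Hom (free_rank_category e) Y Z"
    show "Comp (free_rank_category e) X Y Z g f = Comp (free_rank_category e)
      (switch e' (switch e X)) (switch e' (switch e Y)) (switch e' (switch e Z)) g f"
      using F.map_comp[OF X Y Z f g] G.map_comp[OF F.map_obj[OF X] F.map_obj[OF Y] F.map_obj[OF Z]
        F.map_hom[OF X Y f] F.map_hom[OF Y Z g]] by (simp only:)
  qed
qed

lemma compose_ident:
  "compose A (\<lambda>v\<in>A. v) (\<lambda>v\<in>A. v) = (\<lambda>v\<in>A. v)"
  by (auto simp: compose_def fun_eq_iff)

text \<open>The components are identity maps and the functors fix all morphisms, so naturality is
  immediate. Two directions are given because the unit starts at the identity functor and the counit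
  ends there.\<close>

lemma switch_switch_natural_iso:
  assumes e: "e = 0 \<or> e = 1" and e': "e' = 0 \<or> e' = 1"
  shows "natural_iso (free_rank_category e) (free_rank_category e) (\<lambda>X. X) (\<lambda>X Y f. f)
      (\<lambda>X. switch e' (switch e X)) (\<lambda>X Y f. f) (\<lambda>X. \<lambda>v\<in>carrier X. v)"
    "natural_iso (free_rank_category e) (free_rank_category e)
      (\<lambda>X. switch e' (switch e X)) (\<lambda>X Y f. f) (\<lambda>X. X) (\<lambda>X Y f. f) (\<lambda>X. \<lambda>v\<in>carrier X. v)"
proof -
  let ?C = "free_rank_category e"
  have cat: "category ?C" by (rule free_rank_category_simps(5)[OF e])
  have id: "cat_functor ?C ?C (\<lambda>X. X) (\<lambda>X Y f. f)"
    by (intro cat_functor.intro cat cat_functor_axioms.intro) (assumption | rule refl)+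
  note S = cat_functor_switch_switch[OF e e']
  note simps = free_rank_category_simps[OF e]
  have iso: "iso_in ?C X (switch e' (switch e X)) (\<lambda>v\<in>carrier X. v)"
    "iso_in ?C (switch e' (switch e X)) X (\<lambda>v\<in>carrier X. v)" if X: "X \<in> Obj ?C" for X
    using switch_switch[OF e e' X] unfolding iso_in_def
    by (auto simp: simps(2,3) compose_ident intro!: bexI[of _ "\<lambda>v\<in>carrier X. v"])
  have nat: "compose (carrier X) (\<lambda>v\<in>carrier Y. v) f = compose (carrier X) f (\<lambda>v\<in>carrier X. v)"
    if "f \<in> Hom ?C X Y" for X Y f
    using that svir_homD(2)[of f "of_int e / 2" X Y] by (auto simp: simps(1) compose_def fun_eq_iff)
  show "natural_iso ?C ?C (\<lambda>X. X) (\<lambda>X Y f. f)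
      (\<lambda>X. switch e' (switch e X)) (\<lambda>X Y f. f) (\<lambda>X. \<lambda>v\<in>carrier X. v)"
    by (intro natural_iso.intro id S natural_iso_axioms.intro iso) (simp_all only: simps(3) nat)
  show "natural_iso ?C ?C (\<lambda>X. switch e' (switch e X)) (\<lambda>X Y f. f)
      (\<lambda>X. X) (\<lambda>X Y f. f) (\<lambda>X. \<lambda>v\<in>carrier X. v)"
    by (intro natural_iso.intro id S natural_iso_axioms.intro iso)
      (simp_all only: simps(3) nat switch_switch(1)[OF e e'])
qed

theorem corollary4p4:
  shows "equivalent_categories
    (ramond_rank1 :: ('v svir_module, 'v \<Rightarrow> 'v) category)
    (neveu_schwarz_rank2 :: ('v svir_module, 'v \<Rightarrow> 'v) category)"
proof -
  have e: "(0 :: int) = 0 \<or> (0 :: int) = 1" "(1 :: int) = 0 \<or> (1 :: int) = 1" by simp_all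
  have "equivalent_categories (free_rank_category 0 :: ('v svir_module, 'v \<Rightarrow> 'v) category)
      (free_rank_category 1 :: ('v svir_module, 'v \<Rightarrow> 'v) category)"
    unfolding equivalent_categories_def
  proof (rule exI[of _ "switch 0"], rule exI[of _ "\<lambda>X Y f. f"], rule exI[of _ "switch 1"],
      rule exI[of _ "\<lambda>X Y f. f"], intro conjI exI)
  qed (rule cat_functor_switch[OF e] cat_functor_switch[OF e(2,1)]
      switch_switch_natural_iso(1)[OF e] switch_switch_natural_iso(2)[OF e(2,1)])+
  then show ?thesis by (simp add: free_rank_category_def)
qed

end
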